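(* Let $A,B,C$ be complex vector spaces of dimension at least $2$ and let $X=\mathrm{Seg}(\mathbb P A\times\mathbb P B\times\mathbb P C)\subset\mathbb P(A\otimes B\otimes C)$. The rank of a general point of the form $[y+y'+y'']$ of $\sigma_3(X)$, as well as the rank of a general point of the form $[x'+y']$ where $[x],[y]$ lie on a line in $X$, is $5$. All other points of $\sigma_3(X)$ have rank less than five, so in particular, the maximum rank of any point of $\sigma_3(X)$ is $5$.
   Context: The ground field is $\mathbb C$. The Segre variety $X$ is the set of classes of decomposable tensors $a\otimes b\otimes c$. $\sigma_3(X)$ is the set of points $p$ (those of border rank at most three) for which there are curves $x_1(t),x_2(t),x_3(t)\in X$ with $p$ in the limiting plane $\lim_{t\to0}\langle x_1(t),x_2(t),x_3(t)\rangle$. The rank of $[T]\in\mathbb P(A\otimes B\otimes C)$ is the smallest $r$ such that $T$ is a sum of $r$ decomposable tensors. In the form $[y+y'+y'']$, $y(t)$ is a curve in the affine cone $\hat X\subset A\otimes B\otimes C$ over $X$, and $y=y(0)$, $y'=y'(0)$, $y''=y''(0)$. In the form $[x'+y']$, $[x],[y]\in X$, $x'\in\hat T_{[x]}X$ and $y'\in\hat T_{[y]}X$, where $\hat T_{[x]}X$ is the affine tangent space to $X$ at $[x]$ (the tangent space to $\hat X$ at $x$).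
   Formalization: The claims that general points of the two forms have rank 5 and that rank 5 is attained are made only when A, B, C all have dimension at least 3; if one has dimension 2, every point of σ₃(X) has rank at most 4, so they fail. The upper bounds hold for all dimensions at least 2. *)

theory Defs
  imports "HOL-Analysis.Analysis"
begin

text \<open>
  We work in coordinates: A, B, C are \<open>complex^'a\<close>, \<open>complex^'b\<close>, \<open>complex^'c\<close>, and the tensor
  product of A, B, C is \<open>complex^('a \<times> 'b \<times> 'c)\<close>.  Linear algebra over the complex numbers is
  that of the interpretation \<open>vec\<close> (scalar multiplication \<open>*s\<close>).
\<close>

definition tensor3 ::
  "complex^'a::finite \<Rightarrow> complex^'b::finite \<Rightarrow> complex^'c::finite \<Rightarrow> complex^('a \<times> 'b \<times> 'c)" where
  "tensor3 a b c = (\<chi> p. case p of (i, j, k) \<Rightarrow> a $ i * b $ j * c $ k)"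

definition tensor_rank :: "complex^('a::finite \<times> 'b::finite \<times> 'c::finite) \<Rightarrow> nat" where
  "tensor_rank T = (LEAST r. \<exists>a b c. T = (\<Sum>i<r. tensor3 (a i) (b i) (c i)))"


subsection \<open>Projective space and its Zariski topology\<close>

text \<open>A point of a projective space is a one-dimensional linear subspace.\<close>

definition pt :: "complex^'n::finite \<Rightarrow> (complex^'n) set" where
  "pt v = vec.span {v}"

definition projectivization :: "(complex^'n::finite) set \<Rightarrow> (complex^'n) set set" where
  "projectivization L = {pt v | v. v \<in> L \<and> v \<noteq> 0}"

definition affine_cone :: "(complex^'n::finite) set set \<Rightarrow> (complex^'n) set" where
  "affine_cone X = {v. v = 0 \<or> pt v \<in> X}"

inductive hom_poly :: "nat \<Rightarrow> (complex^'n::finite \<Rightarrow> complex) \<Rightarrow> bool" where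
  const: "hom_poly 0 (\<lambda>v. c)"
| coord: "hom_poly 1 (\<lambda>v. v $ i)"
| add: "hom_poly d f \<Longrightarrow> hom_poly d g \<Longrightarrow> hom_poly d (\<lambda>v. f v + g v)"
| mult: "hom_poly d f \<Longrightarrow> hom_poly e g \<Longrightarrow> hom_poly (d + e) (\<lambda>v. f v * g v)"

text \<open>Generated by the complements of hypersurfaces; its carrier is the whole projective space.\<close>

definition zariski :: "(complex^'n::finite) set topology" where
  "zariski = topology_generated_by
     {{pt v | v. v \<noteq> 0 \<and> f v \<noteq> 0} | f. \<exists>d. hom_poly d f}"


subsection \<open>Curves, tangent spaces, limiting planes\<close>

text \<open>Germs at 0 of holomorphic curves contained in a given set of vectors.\<close>

definition curve_in :: "(complex \<Rightarrow> complex^'n::finite) \<Rightarrow> (complex^'n) set \<Rightarrow> bool" where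
  "curve_in y M \<longleftrightarrow> (\<exists>r>0. (\<forall>i. (\<lambda>t. y t $ i) holomorphic_on ball 0 r) \<and> (\<forall>t\<in>ball 0 r. y t \<in> M))"

definition curve_deriv :: "(complex \<Rightarrow> complex^'n::finite) \<Rightarrow> complex \<Rightarrow> complex^'n" where
  "curve_deriv y t = (\<chi> i. deriv (\<lambda>s. y s $ i) t)"

text \<open>
  Used only for \<open>x \<noteq> 0\<close> in the affine cone over a Segre variety; this cone is smooth at \<open>x\<close>, so its
  tangent space there is the set of velocities at \<open>x\<close> of curves in the cone.
\<close>

definition affine_tangent_space :: "(complex^'n::finite) set set \<Rightarrow> complex^'n \<Rightarrow> (complex^'n) set" where
  "affine_tangent_space X x = {curve_deriv \<gamma> 0 | \<gamma>. curve_in \<gamma> (affine_cone X) \<and> \<gamma> 0 = x}"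

text \<open>
  Convergence in the Grassmannian of three-dimensional subspaces (projective planes), expressed by
  convergence of suitable frames: the Grassmannian carries the quotient topology from the space
  of linearly independent triples.
\<close>

definition plane_tendsto ::
  "('s \<Rightarrow> (complex^'n::finite) set) \<Rightarrow> (complex^'n) set \<Rightarrow> 's filter \<Rightarrow> bool" where
  "plane_tendsto P E F \<longleftrightarrow> vec.dim E = 3 \<and>
     (\<exists>e1 e2 e3 l1 l2 l3.
        (\<forall>\<^sub>F t in F. vec.dim (P t) = 3 \<and> P t = vec.span {e1 t, e2 t, e3 t}) \<and>
        (e1 \<longlongrightarrow> l1) F \<and> (e2 \<longlongrightarrow> l2) F \<and> (e3 \<longlongrightarrow> l3) F \<and>
        E = vec.span {l1, l2, l3})"

text \<open>A curve in the projective variety X is given by a nowhere zero holomorphic lift.\<close>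

definition sigma3 :: "(complex^'n::finite) set set \<Rightarrow> (complex^'n) set set" where
  "sigma3 X = {p \<in> projectivization UNIV. \<exists>x1 x2 x3 E.
     curve_in x1 {v. v \<noteq> 0 \<and> pt v \<in> X} \<and>
     curve_in x2 {v. v \<noteq> 0 \<and> pt v \<in> X} \<and>
     curve_in x3 {v. v \<noteq> 0 \<and> pt v \<in> X} \<and>
     plane_tendsto (\<lambda>t. vec.span {x1 t, x2 t, x3 t}) E (at 0) \<and>
     p \<subseteq> E}"

definition on_line_in :: "(complex^'n::finite) set set \<Rightarrow> (complex^'n) set \<Rightarrow> (complex^'n) set \<Rightarrow> bool" where
  "on_line_in X p q \<longleftrightarrow> (\<exists>L. vec.subspace L \<and> vec.dim L = 2 \<and> projectivization L \<subseteq> X \<and>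
     p \<in> projectivization L \<and> q \<in> projectivization L)"


subsection \<open>The Segre variety and the two families of points\<close>

definition segre :: "(complex^('a::finite \<times> 'b::finite \<times> 'c::finite)) set set" where
  "segre = {pt (tensor3 a b c) | a b c. a \<noteq> 0 \<and> b \<noteq> 0 \<and> c \<noteq> 0}"

text \<open>Points of \<open>sigma3 X\<close> of the form \<open>[y + y' + y'']\<close>.\<close>

definition osculating_points :: "(complex^'n::finite) set set \<Rightarrow> (complex^'n) set set" where
  "osculating_points X = {p \<in> sigma3 X. \<exists>y. curve_in y (affine_cone X) \<and>
     p = pt (y 0 + curve_deriv y 0 + curve_deriv (curve_deriv y) 0)}"

text \<open>Points of \<open>sigma3 X\<close> of the form \<open>[x' + y']\<close> with \<open>[x]\<close>, \<open>[y]\<close> on a line in X.\<close>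

definition line_tangent_points :: "(complex^'n::finite) set set \<Rightarrow> (complex^'n) set set" where
  "line_tangent_points X = {p \<in> sigma3 X. \<exists>x y x' y'.
     x \<noteq> 0 \<and> y \<noteq> 0 \<and> pt x \<in> X \<and> pt y \<in> X \<and> on_line_in X (pt x) (pt y) \<and>
     x' \<in> affine_tangent_space X x \<and> y' \<in> affine_tangent_space X y \<and>
     p = pt (x' + y')}"

end

theory Submission
  imports Defs "HOL-Complex_Analysis.Cauchy_Integral_Formula"
begin

text \<open>
  A point of the third secant variety is a limit of tensors of rank at most three, and all that is
  used about such a limit \<open>T\<close> is that its multilinear ranks are at most three and that Strassen's
  identity \<open>M x (adj M y) M z = M z (adj M y) M x\<close> holds for its slices.

  If one of the multilinear ranks of \<open>T\<close> is at most two, then \<open>T\<close> is a pencil of 3 by 3 matrices, and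
  every such pencil has rank at most four: one subtracts a rank one matrix and diagonalizes.
  Otherwise \<open>T\<close> is a concise 3 by 3 by 3 tensor.  Strassen's identity provides an invertible slice in
  one of the three directions; normalizing this slice to the identity turns the others into a commuting pair
  \<open>X, Y\<close>.  With \<open>u v\<^sup>T\<close> a rank one matrix commuting with both (\<open>X - \<lambda>\<close> or its adjugate), \<open>T\<close> has
  rank at most four unless \<open>X\<close> and \<open>Y\<close> are nilpotent up to scalars, and then \<open>T\<close> is of the form
  \<open>y + y' + y''\<close> or \<open>x' + y'\<close>.

  Hence \<open>U\<close> and \<open>V\<close> are the concise points of the two families.  They have rank at least five because in
  one direction the slice at \<open>x\<close> is singular only if one fixed coordinate of \<open>x\<close> vanishes: with only four
  summands \<open>a\<^sub>i \<otimes> b\<^sub>i \<otimes> c\<^sub>i\<close>, the slice at \<open>a\<^sub>i \<times> a\<^sub>j\<close> is singular for all \<open>i, j\<close>, which makes the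
  \<open>a\<^sub>i\<close> lie in a plane.
\<close>

subsection \<open>Three by three matrices\<close>

text \<open>The adjugate stands in for the inverse because Strassen's identity has to be polynomial
  to survive the limit and has to say something at singular slices: an invertible slice need not
  exist in a prescribed direction. In \<open>line_form\<close> every slice in the first direction is
  singular. Hence every tool is stated for the first factor and carried to the others by
  \<open>rotate\<close>. A line in the Segre variety moves only one of the three factors, so the
  second family has three types, collected in \<open>is_any_line\<close>, while
  \<open>osculating_form\<close> is cyclically symmetric. "General" is read as "on a relatively open
  dense subset". Conciseness is Zariski open, being the nonvanishing of minors of the three
  flattenings, and it is dense because frames can be made independent by arbitrarily small
  perturbations. With a factor of dimension two nothing is concise: both open sets are then empty,
  and density is claimed only for dimensions at least three. The curve \<open>y\<close> may pass
  through the vertex of the cone, where it has no obvious lift to the three factors; there a power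
  of the parameter is divided out.\<close>

definition adj3 :: "complex^3^3 \<Rightarrow> complex^3^3" where
  "adj3 M = vector [
     vector [M$2$2*M$3$3 - M$2$3*M$3$2, M$1$3*M$3$2 - M$1$2*M$3$3, M$1$2*M$2$3 - M$1$3*M$2$2],
     vector [M$2$3*M$3$1 - M$2$1*M$3$3, M$1$1*M$3$3 - M$1$3*M$3$1, M$1$3*M$2$1 - M$1$1*M$2$3],
     vector [M$2$1*M$3$2 - M$2$2*M$3$1, M$1$2*M$3$1 - M$1$1*M$3$2, M$1$1*M$2$2 - M$1$2*M$2$1]]"

definition cross :: "complex^3 \<Rightarrow> complex^3 \<Rightarrow> complex^3" where
  "cross x y = vector [x$2*y$3 - x$3*y$2, x$3*y$1 - x$1*y$3, x$1*y$2 - x$2*y$1]"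

text \<open>Bilinear, without conjugation: it has to be algebraic, and \<open>bdot x\<close> ranges
  over the linear forms.\<close>

definition bdot :: "complex^'n::finite \<Rightarrow> complex^'n \<Rightarrow> complex" where
  "bdot x y = (\<Sum>i\<in>UNIV. x$i * y$i)"

text \<open>On a matrix the scalars of \<open>*s\<close> would be rows, hence a separate scaling by
  complex numbers.\<close>

definition mscale :: "complex \<Rightarrow> complex^'n::finite^'m::finite \<Rightarrow> complex^'n^'m" (infixl "*k" 70) where
  "c *k A = (\<chi> i j. c * A$i$j)"

lemma mscale_nth [simp]: "(c *k A) $ i $ j = c * A$i$j"
  by (simp add: mscale_def)

definition outer :: "complex^'m::finite \<Rightarrow> complex^'n::finite \<Rightarrow> complex^'n^'m" where
  "outer x y = (\<chi> i j. x$i * y$j)"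

lemma outer_nth [simp]: "outer x y $ i $ j = x$i * y$j"
  by (simp add: outer_def)

lemmas mat3_simps = vec_eq_iff forall_3 sum_3 matrix_matrix_mult_def matrix_vector_mult_def
  vector_matrix_mult_def mat_def

lemma bdot_3: "bdot x y = x$1*y$1 + x$2*y$2 + x$3*y$3" for x y :: "complex^3"
  by (simp add: bdot_def sum_3)

lemma adj3_mult: "adj3 (A ** B) = adj3 B ** adj3 A"
  by (simp add: mat3_simps adj3_def) (simp add: algebra_simps)

lemma adj3_right: "A ** adj3 A = det A *k mat 1"
  by (simp add: mat3_simps adj3_def det_3) (simp add: algebra_simps)

lemma adj3_left: "adj3 A ** A = det A *k mat 1"
  by (simp add: mat3_simps adj3_def det_3) (simp add: algebra_simps)

text \<open>For singular \<open>A\<close> the right side vanishes, so \<open>adj3 A\<close> has rank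
  at most one; this is the source of the rank one matrices \<open>outer u v\<close> below.\<close>

lemma adj3_adj3: "adj3 (adj3 A) = det A *k A"
  by (simp add: mat3_simps adj3_def det_3) (simp add: algebra_simps)

text \<open>The Cayley-Hamilton theorem with one factor \<open>A\<close> cancelled;
  \<open>trace (adj3 A)\<close> is the second elementary symmetric function of the eigenvalues. It
  makes \<open>adj3 A\<close> a polynomial in \<open>A\<close>.\<close>

lemma adj3_poly: "adj3 A = A ** A - trace A *k A + trace (adj3 A) *k mat 1"
  by (simp add: mat3_simps adj3_def trace_def) (simp add: algebra_simps)

text \<open>By Jacobi's formula the middle coefficients are the derivatives of the determinant at
  \<open>A\<close> towards \<open>B\<close> and at \<open>B\<close> towards
  \<open>A\<close>.\<close>

lemma det_pencil:
  "det (A + s *k B) = det A + s * trace (adj3 A ** B) + s^2 * trace (A ** adj3 B) + s^3 * det B"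
  for A B :: "complex^3^3"
  by (simp add: mat3_simps adj3_def trace_def det_3) (simp add: algebra_simps power2_eq_square power3_eq_cube)

lemma cross_cross: "cross x (cross y z) = bdot x z *s y - bdot x y *s z"
  by (simp add: mat3_simps bdot_3 cross_def algebra_simps)

lemma bdot_cross [simp]: "bdot x (cross x y) = 0" "bdot y (cross x y) = 0"
   "bdot (cross x y) x = 0" "bdot (cross x y) y = 0"
  by (simp_all add: bdot_3 cross_def algebra_simps)


lemma mscale_simps:
  "A ** (c *k B) = c *k (A ** B)" "(c *k A) ** B = c *k (A ** B)"
  "c *k (A + B) = c *k A + c *k B" "c *k (d *k A) = (c * d) *k A" "1 *k A = A"
  "(c + d) *k A = c *k A + d *k A" "0 *k A = 0" "c *k 0 = 0"
  by (simp_all add: vec_eq_iff matrix_matrix_mult_def sum_distrib_left mult_ac distrib_left distrib_right)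

lemma mscale_eq_0: "c *k A = 0 \<longleftrightarrow> c = 0 \<or> A = 0"
  by (auto simp: vec_eq_iff)

lemma outer_add_left: "outer (x + x') y = outer x y + outer x' y"
  and outer_scale_left: "outer (c *s x) y = c *k outer x y"
  and outer_scale_right: "outer x (c *s y) = c *k outer x y"
  by (simp_all add: vec_eq_iff algebra_simps)

lemma matrix_add_rdistrib: "(A + B) ** C = A ** C + B ** C"
  for A B :: "complex^'n::finite^'m::finite"
  by (simp add: vec_eq_iff matrix_matrix_mult_def distrib_right sum.distrib)

lemma matrix_mult_outer: "A ** outer x y = outer (A *v x) y"
  by (simp add: vec_eq_iff matrix_matrix_mult_def matrix_vector_mult_def sum_distrib_left mult_ac)

lemma outer_mult_matrix: "outer x y ** A = outer x (y v* A)"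
  by (simp add: vec_eq_iff matrix_matrix_mult_def vector_matrix_mult_def sum_distrib_left mult_ac)

lemma outer_vector_mult: "outer x y *v z = bdot y z *s x"
  by (simp add: vec_eq_iff matrix_vector_mult_def bdot_def sum_distrib_right sum_distrib_left mult_ac)

lemma vector_outer_mult: "z v* outer x y = bdot z x *s y"
  by (simp add: vec_eq_iff vector_matrix_mult_def bdot_def sum_distrib_right sum_distrib_left mult_ac)

lemma bdot_vector_matrix: "bdot (x v* A) y = bdot x (A *v y)"
proof -
  have "bdot (x v* A) y = (\<Sum>j\<in>UNIV. \<Sum>i\<in>UNIV. x$i * A$i$j * y$j)"
    by (simp add: bdot_def vector_matrix_mult_def sum_distrib_left mult_ac)
  also have "\<dots> = (\<Sum>i\<in>UNIV. \<Sum>j\<in>UNIV. x$i * A$i$j * y$j)" by (rule sum.swap)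
  also have "\<dots> = bdot x (A *v y)"
    by (simp add: bdot_def matrix_vector_mult_def sum_distrib_left mult_ac)
  finally show ?thesis .
qed

lemma outer_eq_0: "outer x y = 0 \<longleftrightarrow> x = 0 \<or> y = 0"
  by (auto simp: vec_eq_iff)

lemma adj3_eq_0_outer:
  assumes "adj3 Z = 0"
  shows "\<exists>u v. Z = outer u v"
proof (cases "Z = 0")
  case True
  then show ?thesis by (intro exI[of _ 0]) (simp add: vec_eq_iff)
next
  case False
  then obtain i0 j0 where nz: "Z$i0$j0 \<noteq> 0" by (auto simp: vec_eq_iff)
  \<comment> \<open>Up to sign the entries of \<open>adj3 Z\<close> are all the 2 by 2 minors; equal
    row or column indices make the identity trivial.\<close>
  have minor: "Z$i$j * Z$i0$j0 = Z$i$j0 * Z$i0$j" for i j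
    using assms exhaust_3[of i] exhaust_3[of j] exhaust_3[of i0] exhaust_3[of j0]
    apply (elim disjE)
    apply (simp_all add: vec_eq_iff forall_3 adj3_def algebra_simps)
    done
  have "Z = outer (\<chi> i. Z$i$j0) (\<chi> j. Z$i0$j / Z$i0$j0)"
    using minor nz by (simp add: vec_eq_iff field_simps)
  then show ?thesis by blast
qed

lemma ex_kernel_vector:
  fixes M :: "complex^'n::finite^'n"
  assumes "det M = 0"
  shows "\<exists>w. w \<noteq> 0 \<and> M *v w = 0"
proof -
  have "\<not> invertible M" using assms by (simp add: invertible_det_nz)
  then have "\<nexists>B. B ** M = mat 1" by (simp add: invertible_left_inverse)
  then show ?thesis by (auto simp: matrix_left_invertible_ker)
qed

lemma solve_linear3:
  fixes a b c x y z :: complex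
  assumes "a * x + b * y + c * z = 0" "x \<noteq> 0"
  shows "a = b * (- y/x) + c * (- z/x)"
proof -
  have "a * x = - (b * y) - c * z" using assms(1) by algebra
  then have "a = (- (b * y) - c * z) / x" using assms(2) by (simp add: nonzero_eq_divide_eq)
  then show ?thesis by (simp add: diff_divide_distrib)
qed

text \<open>A kernel vector with a nonzero coordinate expresses one column through the other two,
  which serve as the left factors.\<close>

lemma singular_sum_two_outer:
  fixes M :: "complex^3^3"
  assumes "det M = 0"
  shows "\<exists>u v x y. M = outer u v + outer x y"
proof -
  obtain w where w: "w \<noteq> 0" "M *v w = 0" using ex_kernel_vector[OF assms] by blast
  then have eqs: "M$i$1 * w$1 + M$i$2 * w$2 + M$i$3 * w$3 = 0" for i
    by (simp add: vec_eq_iff matrix_vector_mult_def sum_3)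
  consider "w$1 \<noteq> 0" | "w$2 \<noteq> 0" | "w$3 \<noteq> 0" using w(1) by (auto simp: vec_eq_iff forall_3)
  then show ?thesis
  proof cases
    case 1
    then have "M$i$1 = M$i$2 * (- w$2/w$1) + M$i$3 * (- w$3/w$1)" for i
      using eqs[of i] solve_linear3[of "M$i$1" "w$1" "M$i$2" "w$2" "M$i$3" "w$3"] by (simp add: add_ac)
    then have "M = outer (\<chi> i. M$i$2) (vector [- w$2/w$1, 1, 0]) + outer (\<chi> i. M$i$3) (vector [- w$3/w$1, 0, 1])"
      by (simp add: vec_eq_iff forall_3)
    then show ?thesis by blast
  next
    case 2
    then have "M$i$2 = M$i$1 * (- w$1/w$2) + M$i$3 * (- w$3/w$2)" for i
      using eqs[of i] solve_linear3[of "M$i$2" "w$2" "M$i$1" "w$1" "M$i$3" "w$3"] by (simp add: add_ac)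
    then have "M = outer (\<chi> i. M$i$1) (vector [1, - w$1/w$2, 0]) + outer (\<chi> i. M$i$3) (vector [0, - w$3/w$2, 1])"
      by (simp add: vec_eq_iff forall_3)
    then show ?thesis by blast
  next
    case 3
    then have "M$i$3 = M$i$1 * (- w$1/w$3) + M$i$2 * (- w$2/w$3)" for i
      using eqs[of i] solve_linear3[of "M$i$3" "w$3" "M$i$1" "w$1" "M$i$2" "w$2"] by (simp add: add_ac)
    then have "M = outer (\<chi> i. M$i$1) (vector [1, 0, - w$1/w$3]) + outer (\<chi> i. M$i$2) (vector [0, 1, - w$2/w$3])"
      by (simp add: vec_eq_iff forall_3)
    then show ?thesis by blast
  qed
qed

text \<open>The fundamental theorem of algebra for degree at most three; polynomials of smaller
  degree are included, as they arise from pencils with singular leading matrix.\<close>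

lemma rootless_cubic_constant:
  fixes c0 c1 c2 c3 :: complex
  assumes "\<And>s. c0 + s * c1 + s^2 * c2 + s^3 * c3 \<noteq> 0"
  shows "c1 = 0" "c2 = 0" "c3 = 0"
proof -
  have "c1 = 0 \<and> c2 = 0 \<and> c3 = 0"
  proof (rule ccontr)
    assume c: "\<not> ?thesis"
    define a where "a = (\<lambda>i::nat. [c0, c1, c2, c3] ! i)"
    have "a 0 = 0 \<or> (\<exists>i\<in>{1..3}. a i \<noteq> 0)"
    proof -
      have "1 \<in> {1..3::nat}" "2 \<in> {1..3::nat}" "3 \<in> {1..3::nat}" by auto
      moreover have "a 1 \<noteq> 0 \<or> a 2 \<noteq> 0 \<or> a 3 \<noteq> 0" using c by (simp add: a_def)
      ultimately show ?thesis by blast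
    qed
    then obtain z where "(\<Sum>i\<le>3. a i * z^i) = 0" by (rule fundamental_theorem_of_algebra)
    then have "c0 + z * c1 + z^2 * c2 + z^3 * c3 = 0"
      by (simp add: a_def numeral_3_eq_3 numeral_2_eq_2 mult_ac)
    with assms show False by blast
  qed
  then show "c1 = 0" "c2 = 0" "c3 = 0" by auto
qed

text \<open>No \<open>W + s *k Z\<close> is singular, so \<open>Z\<close> relative to
  \<open>W\<close> has no nonzero eigenvalue, and \<open>adj3 Z \<noteq> 0\<close> means rank two:
  the inverse of \<open>W\<close> times \<open>Z\<close> is a single nilpotent Jordan block. Up to
  scaling, the vectors are a Jordan chain moved by \<open>W\<close> and the basis dual to the
  chain.\<close>

lemma nilpotent_jordan_basis:
  fixes Z W :: "complex^3^3"
  assumes W: "\<And>s. det (W + s *k Z) \<noteq> 0" and Z: "det Z = 0" "adj3 Z \<noteq> 0"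
  shows "\<exists>a b c f g h. W = outer a f + outer b g + outer c h \<and> Z = outer a g + outer b h"
proof -
  have "det W + s * trace (adj3 W ** Z) + s^2 * trace (W ** adj3 Z) + s^3 * 0 \<noteq> 0" for s
    using W[of s] Z(1) by (simp add: det_pencil)
  from rootless_cubic_constant[OF this]
  have tr: "trace (adj3 W ** Z) = 0" "trace (W ** adj3 Z) = 0" by auto
  have dW: "det W \<noteq> 0" using W[of 0] by (simp add: mscale_simps)
  define N where "N = adj3 W ** Z"
  have WN: "W ** N = det W *k Z"
    by (simp add: N_def matrix_mul_assoc adj3_right mscale_simps)
  have "adj3 N = det W *k (adj3 Z ** W)"
    by (simp add: N_def adj3_mult adj3_adj3 mscale_simps)
  moreover have "trace (c *k A) = c * trace A" for c and A :: "complex^3^3"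
    by (simp add: trace_def sum_distrib_left)
  ultimately have trN: "trace N = 0" "trace (adj3 N) = 0"
    using tr by (simp_all add: N_def trace_mul_sym[of "adj3 Z"])
  have "adj3 N ** adj3 W \<noteq> 0"
    using Z(2) dW \<open>adj3 N = _\<close>
    by (simp add: mscale_simps matrix_mul_assoc[symmetric] adj3_right mscale_eq_0)
  then have "adj3 N \<noteq> 0" by auto
  \<comment> \<open>With both traces zero, Cayley-Hamilton leaves only the square;
    \<open>adj3_right\<close> then makes the cube vanish.\<close>
  moreover have NN: "adj3 N = N ** N" using adj3_poly[of N] trN by (simp add: mscale_simps)
  ultimately obtain v where v: "(N ** N) *v v \<noteq> 0"
    by (metis matrix_eq matrix_vector_mult_0)
  have dN: "det N = 0" using Z by (simp add: N_def det_mul)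
  have "N ** (N ** N) = 0"
    using adj3_right[of N] dN unfolding NN by (simp add: mscale_simps)
  then have N3: "N *v (N *v (N *v v)) = 0"
    by (metis matrix_vector_mul_assoc matrix_vector_mult_0)
  define b where "b = N *v v"
  define a where "a = N *v b"
  have a: "a \<noteq> 0" using v by (simp add: a_def b_def matrix_vector_mul_assoc)
  have Na: "N *v a = 0" using N3 by (simp add: a_def b_def)
  \<comment> \<open>The columns are the Jordan chain \<open>a\<close>, \<open>b\<close>,
    \<open>v\<close>; the rows of the inverse \<open>Q\<close> form the dual basis \<open>f\<close>,
    \<open>g\<close>, \<open>h\<close>.\<close>
  define P :: "complex^3^3" where "P = outer a (axis 1 1) + outer b (axis 2 1) + outer v (axis 3 1)"
  have Px: "P *v x = x$1 *s a + x$2 *s b + x$3 *s v" for x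
    by (simp add: P_def matrix_vector_mult_add_rdistrib outer_vector_mult bdot_3 axis_def)
  have lin: "N *v (c *s x) = c *s (N *v x)" for c x
    by (simp add: vec_eq_iff matrix_vector_mult_def sum_distrib_left mult_ac)
  have "x = 0" if "P *v x = 0" for x
  proof -
    have 0: "x$1 *s a + x$2 *s b + x$3 *s v = 0" using that Px by simp
    have Nb: "N *v b = a" "N *v v = b" by (simp_all add: a_def b_def)
    have 1: "x$2 *s a + x$3 *s b = 0"
      using arg_cong[OF 0, of "\<lambda>y. N *v y"] by (simp add: matrix_vector_right_distrib lin Na Nb)
    have 2: "x$3 *s a = 0"
      using arg_cong[OF 1, of "\<lambda>y. N *v y"] by (simp add: matrix_vector_right_distrib lin Na Nb)
    have "x$3 = 0" using 2 a by simp
    then have "x$2 = 0" using 1 a by simp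
    then have "x$1 = 0" using 0 a \<open>x$3 = 0\<close> by simp
    with \<open>x$2 = 0\<close> \<open>x$3 = 0\<close> show ?thesis by (simp add: vec_eq_iff forall_3)
  qed
  then obtain Q where "Q ** P = mat 1" using matrix_left_invertible_ker[of P] by auto
  then have PQ: "P ** Q = mat 1" by (simp add: matrix_left_right_inverse)
  define f where "f = axis 1 1 v* Q"
  define g where "g = axis 2 1 v* Q"
  define h where "h = axis 3 1 v* Q"
  have I: "mat 1 = outer a f + outer b g + outer v h"
    unfolding PQ[symmetric] by (simp add: P_def f_def g_def h_def matrix_add_rdistrib outer_mult_matrix)
  have "W = W ** mat 1" by simp
  also have "\<dots> = outer (W *v a) f + outer (W *v b) g + outer (W *v v) h"
    unfolding I by (simp add: matrix_add_ldistrib matrix_mult_outer)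
  finally have 1: "W = outer (W *v a) f + outer (W *v b) g + outer (W *v v) h" .
  have "N = N ** mat 1" by simp
  also have "\<dots> = outer a g + outer b h"
    unfolding I by (simp add: matrix_add_ldistrib matrix_mult_outer Na outer_eq_0[THEN iffD2] flip: a_def b_def)
  finally have Neq: "N = outer a g + outer b h" .
  have "Z = inverse (det W) *k (W ** N)" using dW by (simp add: WN mscale_simps)
  also have "\<dots> = inverse (det W) *k outer (W *v a) g + inverse (det W) *k outer (W *v b) h"
    by (simp add: Neq matrix_add_ldistrib matrix_mult_outer mscale_simps)
  finally have 2: "Z = inverse (det W) *k outer (W *v a) g + inverse (det W) *k outer (W *v b) h" .
  \<comment> \<open>\<open>N\<close> is \<open>?d\<close> times the nilpotent block, so
    \<open>Z\<close> carries a factor \<open>1/?d\<close>. Powers of \<open>?d\<close> are shifted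
    between left and right factors until both expansions use the same six vectors.\<close>
  let ?d = "det W"
  show ?thesis
  proof (intro exI conjI)
    show "W = outer (W *v a) f + outer (?d *s (W *v b)) (inverse ?d *s g)
        + outer (?d^2 *s (W *v v)) (inverse (?d^2) *s h)"
      using dW by (subst 1) (simp add: outer_scale_left outer_scale_right mscale_simps)
    show "Z = outer (W *v a) (inverse ?d *s g) + outer (?d *s (W *v b)) (inverse (?d^2) *s h)"
      using dW by (subst 2) (simp add: outer_scale_left outer_scale_right mscale_simps power2_eq_square mult.assoc)
  qed
qed

subsection \<open>Sums of decomposable tensors\<close>

text \<open>The monotone predicate behind \<open>tensor_rank\<close>; the passage to the least
  number is made in \<open>tensor_rank_le_iff\<close>.\<close>

definition rank_le :: "nat \<Rightarrow> complex^('a::finite \<times> 'b::finite \<times> 'c::finite) \<Rightarrow> bool" where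
  "rank_le r T \<longleftrightarrow> (\<exists>a b c. T = (\<Sum>i<r. tensor3 (a i) (b i) (c i)))"

definition rotate :: "complex^('a::finite \<times> 'b::finite \<times> 'c::finite) \<Rightarrow> complex^('b \<times> 'c \<times> 'a)" where
  "rotate T = (\<chi> p. case p of (j, k, i) \<Rightarrow> T $ (i, j, k))"

definition map_first :: "complex^'x::finite^'a::finite \<Rightarrow> complex^('x \<times> 'b::finite \<times> 'c::finite) \<Rightarrow> complex^('a \<times> 'b \<times> 'c)" where
  "map_first M T = (\<chi> p. case p of (i, j, k) \<Rightarrow> \<Sum>l\<in>UNIV. M$i$l * T $ (l, j, k))"

definition slice :: "complex^('a::finite \<times> 'b::finite \<times> 'c::finite) \<Rightarrow> complex^'a \<Rightarrow> complex^'c^'b" where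
  "slice T x = (\<chi> j k. \<Sum>i\<in>UNIV. x$i * T $ (i, j, k))"

definition tensor_matrix :: "complex^'a::finite \<Rightarrow> complex^'c::finite^'b::finite \<Rightarrow> complex^('a \<times> 'b \<times> 'c)" where
  "tensor_matrix p M = (\<chi> q. case q of (i, j, k) \<Rightarrow> p$i * M$j$k)"

definition nondegenerate :: "complex^('a::finite \<times> 'b::finite \<times> 'c::finite) \<Rightarrow> bool" where
  "nondegenerate T \<longleftrightarrow> (\<forall>x. slice T x = 0 \<longrightarrow> x = 0)"

lemma tensor3_nth [simp]: "tensor3 a b c $ (i, j, k) = a$i * b$j * c$k"
  by (simp add: tensor3_def)

lemma rotate_nth [simp]: "rotate T $ (j, k, i) = T $ (i, j, k)"
  by (simp add: rotate_def)

lemma map_first_nth [simp]: "map_first M T $ (i, j, k) = (\<Sum>l\<in>UNIV. M$i$l * T $ (l, j, k))"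
  by (simp add: map_first_def)

lemma slice_nth [simp]: "slice T x $ j $ k = (\<Sum>i\<in>UNIV. x$i * T $ (i, j, k))"
  by (simp add: slice_def)

lemma tensor_matrix_nth [simp]: "tensor_matrix p M $ (i, j, k) = p$i * M$j$k"
  by (simp add: tensor_matrix_def)

lemma tensor_eq_iff: "T = S \<longleftrightarrow> (\<forall>i j k. T $ (i, j, k) = S $ (i, j, k))"
  by (simp add: vec_eq_iff split_paired_all)

lemma rotate_tensor3 [simp]: "rotate (tensor3 a b c) = tensor3 b c a"
  by (simp add: tensor_eq_iff mult_ac)

lemma rotate_rotate_rotate [simp]: "rotate (rotate (rotate T)) = T"
  by (simp add: tensor_eq_iff)

lemma rotate_eq_iff [simp]: "rotate T = rotate S \<longleftrightarrow> T = S"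
  by (auto simp: tensor_eq_iff)

lemma rotate_add: "rotate (T + S) = rotate T + rotate S"
  by (simp add: tensor_eq_iff)

lemma rotate_sum: "rotate (sum f A) = (\<Sum>i\<in>A. rotate (f i))"
  by (simp add: tensor_eq_iff)

lemma map_first_tensor3 [simp]: "map_first M (tensor3 a b c) = tensor3 (M *v a) b c"
  by (simp add: tensor_eq_iff matrix_vector_mult_def sum_distrib_left sum_distrib_right mult_ac)

lemma map_first_add: "map_first M (T + S) = map_first M T + map_first M S"
  by (simp add: tensor_eq_iff distrib_left sum.distrib)

lemma map_first_sum: "map_first M (sum f A) = (\<Sum>i\<in>A. map_first M (f i))"
proof -
  have "map_first M (sum f A) $ (i, j, k) = (\<Sum>i\<in>A. map_first M (f i)) $ (i, j, k)" for i j k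
    by (simp add: sum_distrib_left) (rule sum.swap)
  then show ?thesis by (simp add: tensor_eq_iff)
qed

lemma slice_tensor3: "slice (tensor3 a b c) x = bdot x a *k outer b c"
  by (simp add: vec_eq_iff bdot_def sum_distrib_left mult_ac)

lemma slice_add: "slice (T + S) x = slice T x + slice S x"
  by (simp add: vec_eq_iff distrib_left sum.distrib)

lemma slice_sum: "slice (sum f A) x = (\<Sum>i\<in>A. slice (f i) x)"
proof -
  have "slice (sum f A) x $ j $ k = (\<Sum>i\<in>A. slice (f i) x) $ j $ k" for j k
    by (simp add: sum_distrib_left) (rule sum.swap)
  then show ?thesis by (simp add: vec_eq_iff)
qed

lemma slice_add_right: "slice T (x + y) = slice T x + slice T y"
  by (simp add: vec_eq_iff distrib_right sum.distrib)

lemma slice_scale_right: "slice T (c *s x) = c *k slice T x"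
  by (simp add: vec_eq_iff sum_distrib_left mult_ac)

lemma tensor_matrix_outer: "tensor_matrix p (outer b c) = tensor3 p b c"
  by (simp add: tensor_eq_iff mult_ac)

lemma tensor_matrix_add_right: "tensor_matrix p (M + N) = tensor_matrix p M + tensor_matrix p N"
  by (simp add: tensor_eq_iff algebra_simps)

text \<open>A shear of the pencil, used to bring a singular member into one of the two
  positions.\<close>

lemma tensor_matrix_shift:
  "tensor_matrix p Z + tensor_matrix q W = tensor_matrix p (Z + s *k W) + tensor_matrix (q - s *s p) W"
  by (simp add: tensor_eq_iff algebra_simps)

lemma rank_le_0: "rank_le 0 T \<longleftrightarrow> T = 0"
  by (simp add: rank_le_def)

lemma rank_le_Suc: "rank_le (Suc n) T \<longleftrightarrow> (\<exists>S a b c. rank_le n S \<and> T = S + tensor3 a b c)"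
proof
  assume "rank_le (Suc n) T"
  then show "\<exists>S a b c. rank_le n S \<and> T = S + tensor3 a b c"
    unfolding rank_le_def by auto
next
  assume "\<exists>S a b c. rank_le n S \<and> T = S + tensor3 a b c"
  then obtain a b c f g h where T: "T = (\<Sum>i<n. tensor3 (f i) (g i) (h i)) + tensor3 a b c"
    unfolding rank_le_def by blast
  have "T = (\<Sum>i<Suc n. tensor3 ((f(n:=a)) i) ((g(n:=b)) i) ((h(n:=c)) i))"
    unfolding sum.lessThan_Suc T by (auto intro!: sum.cong arg_cong2[where f="(+)"])
  then show "rank_le (Suc n) T" unfolding rank_le_def by blast
qed

lemma rank_le_add: "rank_le m T \<Longrightarrow> rank_le n S \<Longrightarrow> rank_le (m + n) (T + S)"
proof (induction n arbitrary: S)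
  case 0
  then show ?case by (simp add: rank_le_0)
next
  case (Suc n)
  then obtain S' a b c where "rank_le n S'" "S = S' + tensor3 a b c" by (auto simp: rank_le_Suc)
  then have "rank_le (m + n) (T + S')" "T + S = (T + S') + tensor3 a b c"
    using Suc by (auto simp: add_ac)
  then show ?case unfolding add_Suc_right rank_le_Suc by blast
qed

lemma rank_le_tensor3: "rank_le (Suc 0) (tensor3 a b c)"
  by (auto simp: rank_le_Suc rank_le_0)

lemma rank_le_plus_tensor3: "rank_le n S \<Longrightarrow> rank_le (Suc n) (S + tensor3 a b c)"
  by (auto simp: rank_le_Suc)

lemma tensor3_zero [simp]: "tensor3 0 b c = 0" "tensor3 a 0 c = 0" "tensor3 a b 0 = 0"
  by (simp_all add: tensor_eq_iff)

lemma rank_le_mono: "rank_le m T \<Longrightarrow> m \<le> n \<Longrightarrow> rank_le n T"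
proof (induction n)
  case (Suc n)
  then show ?case
    by (metis add.right_neutral le_Suc_eq rank_le_plus_tensor3 tensor3_zero(1))
qed (simp add: rank_le_0)

lemma rank_le_rotate: "rank_le r T \<Longrightarrow> rank_le r (rotate T)"
  unfolding rank_le_def by (force simp: rotate_sum)

lemma rank_le_rotate_iff [simp]: "rank_le r (rotate T) \<longleftrightarrow> rank_le r T"
  by (metis rank_le_rotate rotate_rotate_rotate)

lemma rank_le_map_first:
  assumes "rank_le r T"
  shows "rank_le r (map_first M T)"
proof -
  obtain a b c where "T = (\<Sum>i<r. tensor3 (a i) (b i) (c i))" using assms rank_le_def by blast
  then have "map_first M T = (\<Sum>i<r. tensor3 (M *v a i) (b i) (c i))" by (simp add: map_first_sum)
  then show ?thesis unfolding rank_le_def by (intro exI[of _ "\<lambda>i. M *v a i"] exI[of _ b] exI[of _ c])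
qed

section \<open>Ranks of pencils of 3 by 3 matrices\<close>

lemma rank_le_tensor_matrix_outer:
  "M = outer b c \<Longrightarrow> rank_le 1 (tensor_matrix p M)"
  by (simp add: tensor_matrix_outer rank_le_tensor3)

lemma rank_le_tensor_matrix_singular:
  assumes "det M = 0"
  shows "rank_le 2 (tensor_matrix p (M :: complex^3^3))"
proof -
  obtain u v x y where "M = outer u v + outer x y" using singular_sum_two_outer[OF assms] by blast
  then have "tensor_matrix p M = tensor3 p u v + tensor3 p x y"
    by (simp add: tensor_matrix_add_right tensor_matrix_outer)
  then show ?thesis
    using rank_le_plus_tensor3[OF rank_le_tensor3, of p u v p x y] by (simp add: numeral_2_eq_2)
qed

lemma rank_le_tensor_matrix: "rank_le 3 (tensor_matrix p (M :: complex^3^3))"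
proof -
  have "M = outer (axis 1 1) (M$1) + outer (axis 2 1) (M$2) + outer (axis 3 1) (M$3)"
    by (simp add: mat3_simps axis_def)
  then have "tensor_matrix p M = tensor3 p (axis 1 1) (M$1) + tensor3 p (axis 2 1) (M$2) + tensor3 p (axis 3 1) (M$3)"
    by (metis tensor_matrix_add_right tensor_matrix_outer)
  moreover have "rank_le (Suc (Suc (Suc 0))) (tensor3 p (axis 1 1) (M$1) + tensor3 p (axis 2 1) (M$2) + tensor3 p (axis 3 1) (M$3))"
    by (intro rank_le_plus_tensor3 rank_le_tensor3)
  ultimately show ?thesis by (simp add: numeral_3_eq_3)
qed

text \<open>With \<open>N = W\<inverse> Z\<close> a nilpotent Jordan block \<open>e\<^sub>1f\<^sub>2 + e\<^sub>2f\<^sub>3\<close>, the matrix \<open>N + e\<^sub>3f\<^sub>2\<close> has the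
  distinct eigenvalues 0, 1, -1, so a rank one correction makes the pencil diagonalizable.\<close>

lemma rank_le_4_jordan_pencil:
  "rank_le 4 (tensor_matrix q (outer a f + outer b g + outer c h) + tensor_matrix p (outer a g + outer b h))"
proof -
  have "tensor_matrix q (outer a f + outer b g + outer c h) + tensor_matrix p (outer a g + outer b h)
     = tensor3 q a (f - h) + tensor3 (q + p) (a + b + c) ((1/2) *s (g + h))
       + tensor3 (q - p) (a - b + c) ((1/2) *s (h - g)) + tensor3 p (- c) g"
    by (simp add: tensor_eq_iff) (simp add: field_simps)
  moreover have "rank_le (Suc (Suc (Suc (Suc 0)))) \<dots>"
    by (intro rank_le_plus_tensor3 rank_le_tensor3)
  ultimately show ?thesis by (simp add: eval_nat_numeral)
qed

text \<open>A second singular member gives 2 + 2 summands. If there is none, either \<open>Z\<close>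
  has rank at most one and 1 + 3 summands suffice, or it has rank two and the pencil is a Jordan
  pencil.\<close>

lemma rank_le_4_singular_pencil:
  fixes Z W :: "complex^3^3"
  assumes "det Z = 0"
  shows "rank_le 4 (tensor_matrix p Z + tensor_matrix q W)"
proof (cases "\<exists>s. det (W + s *k Z) = 0")
  case True
  then obtain s where s: "det (W + s *k Z) = 0" by blast
  have "rank_le (2 + 2) (tensor_matrix q (W + s *k Z) + tensor_matrix (p - s *s q) Z)"
    using assms s by (intro rank_le_add rank_le_tensor_matrix_singular)
  then show ?thesis by (simp add: tensor_matrix_shift[symmetric] add.commute)
next
  case False
  show ?thesis
  proof (cases "adj3 Z = 0")
    case True
    then obtain u v where "Z = outer u v" using adj3_eq_0_outer by blast
    then have "rank_le (1 + 3) (tensor_matrix p Z + tensor_matrix q W)"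
      by (intro rank_le_add rank_le_tensor_matrix_outer rank_le_tensor_matrix)
    then show ?thesis by simp
  next
    case nz: False
    obtain a b c f g h where "W = outer a f + outer b g + outer c h" "Z = outer a g + outer b h"
      using nilpotent_jordan_basis[of W Z] False assms nz by blast
    then show ?thesis using rank_le_4_jordan_pencil by (metis add.commute)
  qed
qed

text \<open>Every pencil has a singular member: \<open>Z + s *k W\<close> for a root
  \<open>s\<close> of the determinant, or \<open>W\<close> itself when this cubic has no
  root.\<close>

lemma rank_le_4_pencil:
  fixes Z W :: "complex^3^3"
  shows "rank_le 4 (tensor_matrix p Z + tensor_matrix q W)"
proof (cases "\<exists>s. det (Z + s *k W) = 0")
  case True
  then obtain s where s: "det (Z + s *k W) = 0" by blast
  then show ?thesis by (subst tensor_matrix_shift) (rule rank_le_4_singular_pencil)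
next
  case False
  then have "det Z + s * trace (adj3 Z ** W) + s^2 * trace (Z ** adj3 W) + s^3 * det W \<noteq> 0" for s
    by (simp flip: det_pencil)
  then have "det W = 0" by (rule rootless_cubic_constant(3))
  then show ?thesis using rank_le_4_singular_pencil[of W q p Z] by (simp add: add.commute)
qed

lemma rank_le_4_2x3x3: "rank_le 4 (T :: complex^(2 \<times> 3 \<times> 3))"
proof -
  have "T = tensor_matrix (axis 1 1) (slice T (axis 1 1)) + tensor_matrix (axis 2 1) (slice T (axis 2 1))"
    by (simp add: tensor_eq_iff forall_2 sum_2 axis_def)
  then show ?thesis using rank_le_4_pencil by metis
qed

subsection \<open>Multilinear rank and limits of tensors of rank three\<close>

definition fiber :: "complex^('a::finite \<times> 'b::finite \<times> 'c::finite) \<Rightarrow> 'b \<Rightarrow> 'c \<Rightarrow> complex^'a" where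
  "fiber T j k = (\<chi> i. T $ (i, j, k))"

text \<open>Their span is the smallest subspace of the first factor that carries \<open>T\<close>,
  so \<open>vec.dim (fibers T)\<close> is the first multilinear rank.\<close>

definition fibers :: "complex^('a::finite \<times> 'b::finite \<times> 'c::finite) \<Rightarrow> (complex^'a) set" where
  "fibers T = range (\<lambda>(j, k). fiber T j k)"

lemma fiber_nth [simp]: "fiber T j k $ i = T $ (i, j, k)"
  by (simp add: fiber_def)

lemma fiber_in_fibers [simp]: "fiber T j k \<in> fibers T"
  by (auto simp: fibers_def)

lemma fiber_map_first: "fiber (map_first M T) j k = M *v fiber T j k"
  by (simp add: vec_eq_iff matrix_vector_mult_def)

lemma bdot_commute: "bdot x y = bdot y x"
  by (simp add: bdot_def mult.commute)

lemma bdot_axis [simp]: "bdot x (axis i 1) = x $ i"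
  by (simp add: bdot_def axis_def if_distrib cong: if_cong)

lemma matrix_mult_axis: "(A *v axis k 1) $ i = A$i$k"
  for A :: "complex^'n::finite^'m::finite"
  by (simp add: matrix_vector_mult_def axis_def if_distrib cong: if_cong)

lemma slice_eq_0_iff: "slice T x = 0 \<longleftrightarrow> (\<forall>v\<in>fibers T. bdot x v = 0)"
  by (auto simp: fibers_def vec_eq_iff bdot_def)

lemma independent_dual_matrix:
  fixes f :: "'d::finite \<Rightarrow> complex^'a::finite"
  assumes "vec.independent (range f)" "inj f"
  shows "\<exists>Q::complex^'a^'d. \<forall>m. Q *v f m = axis m 1"
proof -
  obtain g where g: "Vector_Spaces.linear (*s) (*s) g" "\<forall>x\<in>range f. g x = axis (inv f x) (1::complex)"
    using vec.linear_independent_extend[OF assms(1), of "\<lambda>x. axis (inv f x) (1::complex)"] by blast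
  then have "matrix g *v f m = axis m 1" for m
    using assms(2) by (simp add: matrix_works inv_f_f)
  then show ?thesis by blast
qed

text \<open>\<open>Q\<close> sends a basis of the span of the fibers to distinct unit vectors and
  \<open>P\<close> sends them back, so \<open>P ** Q\<close> fixes this span and hence
  \<open>T\<close>. If the basis uses up all unit vectors, each of them is a fiber of
  \<open>map_first Q T\<close>, which forces nondegeneracy.\<close>

lemma reduce_first:
  fixes T :: "complex^('a::finite \<times> 'b::finite \<times> 'c::finite)"
  assumes "vec.dim (fibers T) \<le> CARD('d::finite)"
  shows "\<exists>(P::complex^'d^'a) (Q::complex^'a^'d). map_first P (map_first Q T) = T \<and>
     (vec.dim (fibers T) = CARD('d) \<longrightarrow> nondegenerate (map_first Q T))"
proof -
  obtain B where B: "B \<subseteq> fibers T" "vec.independent B" "fibers T \<subseteq> vec.span B" "card B = vec.dim (fibers T)"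
    by (rule vec.basis_exists)
  have fin: "finite B" using B(2) vec.independent_bound_general by blast
  obtain f :: "complex^'a \<Rightarrow> 'd" where f: "inj_on f B"
    using card_le_inj[OF fin, of "UNIV :: 'd set"] assms B(4) by auto
  obtain g where g: "Vector_Spaces.linear (*s) (*s) g" "\<forall>x\<in>B. g x = axis (f x) (1::complex)"
    using vec.linear_independent_extend[OF B(2), of "\<lambda>x. axis (f x) (1::complex)"] by blast
  define Q where "Q = matrix g"
  define P :: "complex^'d^'a" where "P = (\<chi> i m. if m \<in> f ` B then inv_into B f m $ i else 0)"
  have Q: "Q *v x = axis (f x) 1" if "x \<in> B" for x
    using g that by (simp add: Q_def matrix_works)
  have "P *v axis (f x) 1 = x" if "x \<in> B" for x
    using that f by (simp add: vec_eq_iff matrix_mult_axis P_def)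
  then have PQB: "(P ** Q) *v x = x" if "x \<in> B" for x
    using that Q by (simp flip: matrix_vector_mul_assoc)
  have "vec.subspace {x. (P ** Q) *v x = x}"
    unfolding vec.subspace_def
    by (simp add: matrix_vector_right_distrib vec.scale)
  then have "vec.span B \<subseteq> {x. (P ** Q) *v x = x}"
    using PQB by (intro vec.span_minimal) auto
  then have PQ: "P *v (Q *v x) = x" if "x \<in> fibers T" for x
    using that B(3) by (auto simp: matrix_vector_mul_assoc)
  have "map_first P (map_first Q T) = T"
  proof -
    have "fiber (map_first P (map_first Q T)) j k = fiber T j k" for j k
      by (simp add: fiber_map_first PQ)
    then show ?thesis by (simp add: vec_eq_iff tensor_eq_iff del: map_first_nth)
  qed
  moreover have "nondegenerate (map_first Q T)" if "vec.dim (fibers T) = CARD('d)"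
    unfolding nondegenerate_def
  proof (intro allI impI)
    fix x assume x: "slice (map_first Q T) x = 0"
    have "f ` B = UNIV"
      using f that B(4) by (intro card_subset_eq) (auto simp: card_image)
    have "x $ m = 0" for m
    proof -
      obtain y where "y \<in> B" "m = f y" using \<open>f ` B = UNIV\<close> by blast
      moreover then obtain j k where "y = fiber T j k" using B(1) by (auto simp: fibers_def)
      ultimately have "axis m 1 \<in> fibers (map_first Q T)"
        using Q fiber_map_first fiber_in_fibers by metis
      then show ?thesis using x by (auto simp: slice_eq_0_iff)
    qed
    then show "x = 0" by (simp add: vec_eq_iff)
  qed
  ultimately show ?thesis by blast
qed

lemma fibers_span_mono:
  assumes "fibers T \<subseteq> vec.span (fibers S)"
  shows "vec.dim (fibers T) \<le> vec.dim (fibers S)"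
  using assms by (rule vec.dim_mono)

text \<open>\<open>map_first\<close> combines whole slices linearly, so the fibers in the other
  directions stay in the span of the old ones.\<close>

lemma dim_fibers_rotate_map_first_le:
  "vec.dim (fibers (rotate (map_first M T))) \<le> vec.dim (fibers (rotate T))"
proof (rule fibers_span_mono, clarify)
  fix x assume "x \<in> fibers (rotate (map_first M T))"
  then obtain k i where "x = fiber (rotate (map_first M T)) k i" by (auto simp: fibers_def)
  then have "x = (\<Sum>l\<in>UNIV. M$i$l *s fiber (rotate T) k l)" by (simp add: vec_eq_iff)
  also have "\<dots> \<in> vec.span (fibers (rotate T))"
    by (intro vec.span_sum vec.span_scale vec.span_base fiber_in_fibers)
  finally show "x \<in> vec.span (fibers (rotate T))" .
qed

lemma dim_fibers_rotate_rotate_map_first_le: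
  "vec.dim (fibers (rotate (rotate (map_first M T)))) \<le> vec.dim (fibers (rotate (rotate T)))"
proof (rule fibers_span_mono, clarify)
  fix x assume "x \<in> fibers (rotate (rotate (map_first M T)))"
  then obtain k i where "x = fiber (rotate (rotate (map_first M T))) i k" by (auto simp: fibers_def)
  then have "x = (\<Sum>l\<in>UNIV. M$i$l *s fiber (rotate (rotate T)) l k)" by (simp add: vec_eq_iff)
  also have "\<dots> \<in> vec.span (fibers (rotate (rotate T)))"
    by (intro vec.span_sum vec.span_scale vec.span_base fiber_in_fibers)
  finally show "x \<in> vec.span (fibers (rotate (rotate T)))" .
qed

text \<open>A vector that annihilates \<open>T\<close> in the second direction also annihilates the
  combined tensor; nondegeneracy is thus inherited backwards along \<open>map_first\<close>.\<close>

lemma nondegenerate_rotate_map_first: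
  assumes "nondegenerate (rotate (map_first M T))"
  shows "nondegenerate (rotate T)"
  unfolding nondegenerate_def
proof (intro allI impI)
  fix x assume x: "slice (rotate T) x = 0"
  have "slice (rotate (map_first M T)) x $ k $ i = (\<Sum>l\<in>UNIV. M$i$l * slice (rotate T) x $ k $ l)" for k i
    by (simp add: sum_distrib_left mult_ac) (rule sum.swap)
  then have "slice (rotate (map_first M T)) x = 0" using x by (simp add: vec_eq_iff del: slice_nth)
  then show "x = 0" using assms by (simp add: nondegenerate_def)
qed

lemma nondegenerate_rotate_rotate_map_first:
  assumes "nondegenerate (rotate (rotate (map_first M T)))"
  shows "nondegenerate (rotate (rotate T))"
  unfolding nondegenerate_def
proof (intro allI impI)
  fix x assume x: "slice (rotate (rotate T)) x = 0"
  have "slice (rotate (rotate (map_first M T))) x $ i $ j = (\<Sum>l\<in>UNIV. M$i$l * slice (rotate (rotate T)) x $ l $ j)" for i j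
    by (simp add: sum_distrib_left mult_ac) (rule sum.swap)
  then have "slice (rotate (rotate (map_first M T))) x = 0" using x by (simp add: vec_eq_iff del: slice_nth)
  then show "x = 0" using assms by (simp add: nondegenerate_def)
qed

section \<open>Limits of tensors of rank at most three\<close>

definition border3 :: "complex^('a::finite \<times> 'b::finite \<times> 'c::finite) \<Rightarrow> bool" where
  "border3 T \<longleftrightarrow> (\<exists>S. (S \<longlongrightarrow> T) (at (0::complex)) \<and> (\<forall>\<^sub>F s in at 0. rank_le 3 (S s)))"

lemma border3_rotate: "border3 T \<Longrightarrow> border3 (rotate T)"
proof -
  assume "border3 T"
  then obtain S where S: "(S \<longlongrightarrow> T) (at (0::complex))" "\<forall>\<^sub>F s in at 0. rank_le 3 (S s)"
    unfolding border3_def by blast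
  have "((\<lambda>s. rotate (S s)) \<longlongrightarrow> rotate T) (at 0)"
  proof (rule vec_tendstoI)
    show "((\<lambda>s. rotate (S s) $ p) \<longlongrightarrow> rotate T $ p) (at 0)" for p
      by (cases p) (simp add: tendsto_vec_nth[OF S(1)])
  qed
  then show ?thesis unfolding border3_def using S(2) by (auto intro!: exI[of _ "\<lambda>s. rotate (S s)"])
qed

lemma border3_map_first: "border3 T \<Longrightarrow> border3 (map_first M T)"
proof -
  assume "border3 T"
  then obtain S where S: "(S \<longlongrightarrow> T) (at (0::complex))" "\<forall>\<^sub>F s in at 0. rank_le 3 (S s)"
    unfolding border3_def by blast
  have "((\<lambda>s. map_first M (S s)) \<longlongrightarrow> map_first M T) (at 0)"
  proof (rule vec_tendstoI)
    show "((\<lambda>s. map_first M (S s) $ p) \<longlongrightarrow> map_first M T $ p) (at 0)" for p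
      by (cases p) (simp add: tendsto_sum tendsto_mult tendsto_vec_nth[OF S(1)])
  qed
  moreover have "\<forall>\<^sub>F s in at 0. rank_le 3 (map_first M (S s))"
    using S(2) by eventually_elim (rule rank_le_map_first)
  ultimately show ?thesis unfolding border3_def by blast
qed

text \<open>All fibers of \<open>S\<close> lie in the span of three vectors, so any four are
  dependent. The dependency is recorded as a vanishing determinant because this passes to
  limits.\<close>

lemma rank_le_3_fibers_det:
  assumes "rank_le 3 S"
  shows "det (\<chi> m n. (Q *v fiber S (fst (f n)) (snd (f n))) $ m :: complex^4^4) = 0"
proof -
  obtain a b c where S: "S = (\<Sum>i<3::nat. tensor3 (a i) (b i) (c i))" using assms rank_le_def by blast
  define h where "h n i = b i $ fst (f n) * c i $ snd (f n)" for n i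
  have col: "fiber S (fst (f n)) (snd (f n)) = (\<Sum>i<3::nat. h n i *s a i)" for n
    by (cases "f n") (simp add: vec_eq_iff S h_def mult_ac)
  \<comment> \<open>The three coefficient rows are padded by a zero row to a singular square matrix,
    whose kernel vector is the dependency.\<close>
  define V :: "complex^4^4" where "V = (\<chi> m n. if m = 1 then h n 0 else if m = 2 then h n 1 else if m = 3 then h n 2 else 0)"
  have "V $ 4 = 0" by (simp add: vec_eq_iff V_def)
  then have "det V = 0" by (intro det_zero_row(2)[of 4]) (simp_all add: row_def vec_eq_iff)
  then obtain w where w: "w \<noteq> 0" "V *v w = 0" using ex_kernel_vector by blast
  have "(\<Sum>n\<in>UNIV. h n i * w $ n) = 0" if "i < 3" for i :: nat
  proof -
    have "(V *v w) $ 1 = 0" "(V *v w) $ 2 = 0" "(V *v w) $ 3 = 0" using w by simp_all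
    moreover have "i = 0 \<or> i = 1 \<or> i = 2" using that by auto
    ultimately show ?thesis by (auto simp: matrix_vector_mult_def V_def)
  qed
  then have 0: "(\<Sum>n\<in>UNIV. w $ n *s fiber S (fst (f n)) (snd (f n))) = 0"
  proof -
    assume *: "\<And>i::nat. i < 3 \<Longrightarrow> (\<Sum>n\<in>UNIV. h n i * w $ n) = 0"
    have "(\<Sum>n\<in>UNIV. w $ n *s fiber S (fst (f n)) (snd (f n))) $ l
      = (\<Sum>i<3::nat. (\<Sum>n\<in>UNIV. h n i * w $ n) * a i $ l)" for l
      by (simp add: col sum_distrib_left sum_distrib_right mult_ac del: sum.lessThan_Suc) (rule sum.swap)
    with * show ?thesis by (simp add: vec_eq_iff)
  qed
  let ?G = "\<chi> m n. (Q *v fiber S (fst (f n)) (snd (f n))) $ m :: complex^4^4"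
  have "?G *v w = Q *v (\<Sum>n\<in>UNIV. w $ n *s fiber S (fst (f n)) (snd (f n)))"
    by (simp add: vec.sum vec.scale) (simp add: vec_eq_iff matrix_vector_mult_def mult_ac)
  then have "?G *v w = 0" using 0 by simp
  with w(1) have "\<not> invertible ?G"
    unfolding invertible_left_inverse matrix_left_invertible_ker by blast
  then show ?thesis by (simp add: invertible_det_nz)
qed

lemma tendsto_det:
  fixes A :: "'x \<Rightarrow> complex^'n::finite^'n"
  assumes "\<And>i j. ((\<lambda>x. A x $ i $ j) \<longlongrightarrow> B $ i $ j) F"
  shows "((\<lambda>x. det (A x)) \<longlongrightarrow> det B) F"
  unfolding det_def by (intro tendsto_sum tendsto_mult tendsto_const tendsto_prod assms)

lemma ex_independent_fibers:
  fixes T :: "complex^('a::finite \<times> 'b::finite \<times> 'c::finite)"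
  assumes "CARD('d::finite) \<le> vec.dim (fibers T)"
  shows "\<exists>(Q::complex^'a^'d) f. \<forall>m. Q *v fiber T (fst (f m)) (snd (f m)) = axis m 1"
proof -
  obtain B where B: "B \<subseteq> fibers T" "vec.independent B" "card B = vec.dim (fibers T)"
    by (rule vec.basis_exists)
  have "finite B" using B(2) vec.independent_bound_general by blast
  then obtain v :: "'d \<Rightarrow> complex^'a" where v: "inj v" "range v \<subseteq> B"
    using card_le_inj[of "UNIV :: 'd set" B] assms B(3) by auto
  then have "vec.independent (range v)" using B(2) vec.independent_mono by blast
  then obtain Q :: "complex^'a^'d" where Q: "\<And>m. Q *v v m = axis m 1"
    using independent_dual_matrix v(1) by blast
  have "\<forall>m. \<exists>p. v m = fiber T (fst p) (snd p)"
    using v(2) B(1) by (fastforce simp: fibers_def)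
  then obtain f where "\<And>m. v m = fiber T (fst (f m)) (snd (f m))" by metis
  then show ?thesis using Q by (intro exI[of _ Q] exI[of _ f]) simp
qed

text \<open>Four independent fibers of the limit would have a minor equal to 1, whereas that minor
  vanishes along the family.\<close>

lemma border3_dim:
  fixes T :: "complex^('a::finite \<times> 'b::finite \<times> 'c::finite)"
  assumes "border3 T"
  shows "vec.dim (fibers T) \<le> 3"
proof (rule ccontr)
  assume "\<not> ?thesis"
  then have "CARD(4) \<le> vec.dim (fibers T)" by simp
  then obtain Q :: "complex^'a^4" and f where Q: "\<And>m. Q *v fiber T (fst (f m)) (snd (f m)) = axis m 1"
    using ex_independent_fibers by blast
  obtain S where S: "(S \<longlongrightarrow> T) (at (0::complex))" "\<forall>\<^sub>F s in at 0. rank_le 3 (S s)"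
    using assms unfolding border3_def by blast
  let ?G = "\<lambda>S. \<chi> m n. (Q *v fiber S (fst (f n)) (snd (f n))) $ m :: complex^4^4"
  have "((\<lambda>s. det (?G (S s))) \<longlongrightarrow> det (?G T)) (at 0)"
    by (rule tendsto_det)
       (simp add: matrix_vector_mult_def tendsto_sum tendsto_mult tendsto_vec_nth[OF S(1)])
  moreover have "?G T = mat 1"
    by (simp add: vec_eq_iff mat_def axis_def Q)
  moreover have "\<forall>\<^sub>F s in at 0. det (?G (S s)) = 0"
    using S(2) by eventually_elim (rule rank_le_3_fibers_det)
  ultimately have "((\<lambda>s. 0::complex) \<longlongrightarrow> 1) (at (0::complex))"
    using tendsto_cong[of "\<lambda>s. det (?G (S s))" "\<lambda>s. 0" "at 0"] by (simp only: det_I)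
  then show False using tendsto_unique[of "at (0::complex)" "\<lambda>s. 0::complex" 1 0] by simp
qed

text \<open>The other two multilinear ranks are at most three by \<open>border3_dim\<close>, so
  \<open>T\<close> comes from a tensor of format 2 by 3 by 3, which is a pencil.\<close>

lemma rank_le_4_degenerate:
  fixes T :: "complex^('a::finite \<times> 'b::finite \<times> 'c::finite)"
  assumes T: "border3 T" and dim: "vec.dim (fibers T) \<le> 2"
  shows "rank_le 4 T"
proof -
  have red: "\<exists>(P::complex^3^'x) T'. U = map_first P T' \<and> border3 T'" if U: "border3 U"
    for U :: "complex^('x::finite \<times> 'y::finite \<times> 'z::finite)"
  proof -
    obtain P :: "complex^3^'x" and Q where "map_first P (map_first Q U) = U"
      using reduce_first[of U, where 'd=3] border3_dim[OF U] by auto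
    then show ?thesis using border3_map_first[OF U] by metis
  qed
  obtain P :: "complex^2^'a" and Q :: "complex^'a^2" where PQ: "T = map_first P (map_first Q T)"
  proof -
    have "vec.dim (fibers T) \<le> CARD(2)" using dim by simp
    then show ?thesis using reduce_first[of T, where 'd=2] that by metis
  qed
  define T1 where "T1 = rotate (map_first Q T)"
  have "border3 T1" unfolding T1_def by (intro border3_rotate border3_map_first T)
  then obtain P2 :: "complex^3^'b" and T2 where T2: "T1 = map_first P2 T2" "border3 T2"
    using red by blast
  then have "border3 (rotate T2)" using border3_rotate by blast
  then obtain P3 :: "complex^3^'c" and T3 where T3: "rotate T2 = map_first P3 T3"
    using red by blast
  have "rank_le 4 (rotate T3)" by (rule rank_le_4_2x3x3)
  then have "rank_le 4 (rotate T2)" unfolding T3 by (intro rank_le_map_first) simp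
  then have "rank_le 4 T1" unfolding T2 by (intro rank_le_map_first) simp
  then have "rank_le 4 (map_first Q T)" unfolding T1_def by simp
  then show ?thesis by (subst PQ) (rule rank_le_map_first)
qed

section \<open>Reduction of a concise tensor to format 3 by 3 by 3\<close>

definition tensor_map ::
  "complex^'x::finite^'a::finite \<Rightarrow> complex^'y::finite^'b::finite \<Rightarrow> complex^'z::finite^'c::finite \<Rightarrow>
   complex^('x \<times> 'y \<times> 'z) \<Rightarrow> complex^('a \<times> 'b \<times> 'c)" where
  "tensor_map A B C T = map_first A (rotate (rotate (map_first B (rotate (rotate (map_first C (rotate (rotate T))))))))"

lemma tensor_map_tensor3 [simp]:
  "tensor_map A B C (tensor3 a b c) = tensor3 (A *v a) (B *v b) (C *v c)"
  by (simp add: tensor_map_def)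

lemma tensor_map_add: "tensor_map A B C (T + S) = tensor_map A B C T + tensor_map A B C S"
  by (simp add: tensor_map_def map_first_add rotate_add)

lemma rank_le_tensor_map: "rank_le r T \<Longrightarrow> rank_le r (tensor_map A B C T)"
  by (simp add: tensor_map_def rank_le_map_first)

text \<open>Relative to three and not to the dimensions of the factors, which may be larger; with
  \<open>border3_dim\<close> all three multilinear ranks are then equal to three.\<close>

definition concise :: "complex^('a::finite \<times> 'b::finite \<times> 'c::finite) \<Rightarrow> bool" where
  "concise T \<longleftrightarrow> 3 \<le> vec.dim (fibers T) \<and> 3 \<le> vec.dim (fibers (rotate T)) \<and>
     3 \<le> vec.dim (fibers (rotate (rotate T)))"

lemma concise_rotate [simp]: "concise (rotate T) \<longleftrightarrow> concise T"
  by (auto simp: concise_def)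

lemma rank_le_4_not_concise:
  assumes "border3 T" "\<not> concise T"
  shows "rank_le 4 T"
  using assms rank_le_4_degenerate[of T] rank_le_4_degenerate[of "rotate T"]
    rank_le_4_degenerate[of "rotate (rotate T)"]
  by (auto simp: concise_def border3_rotate not_le)

text \<open>The three factors are compressed in turn. The tensor before a step is recovered from the
  one after it by \<open>map_first\<close>, so a step can neither lower the remaining multilinear
  ranks nor destroy the nondegeneracy already reached.\<close>

lemma concise_border3_reduce:
  fixes T :: "complex^('a::finite \<times> 'b::finite \<times> 'c::finite)"
  assumes T: "border3 T" and con: "concise T"
  shows "\<exists>(t::complex^(3 \<times> 3 \<times> 3)) A B C. T = tensor_map A B C t \<and> border3 t \<and>
    nondegenerate t \<and> nondegenerate (rotate t) \<and> nondegenerate (rotate (rotate t))"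
proof -
  have red: "\<exists>(P::complex^3^'x) Q. U = map_first P (map_first Q U) \<and> nondegenerate (map_first Q U)"
    if "border3 U" "3 \<le> vec.dim (fibers U)"
    for U :: "complex^('x::finite \<times> 'y::finite \<times> 'z::finite)"
  proof -
    have "vec.dim (fibers U) = CARD(3)" using border3_dim[OF that(1)] that(2) by simp
    then show ?thesis using reduce_first[of U, where 'd=3] by (metis order_refl)
  qed
  obtain P :: "complex^3^'a" and Q where 1: "T = map_first P (map_first Q T)" "nondegenerate (map_first Q T)"
    using red[OF T] con unfolding concise_def by blast
  define T1 where "T1 = map_first Q T"
  have T1: "border3 T1" "T = map_first P T1" "nondegenerate T1"
    using 1 T by (auto simp: T1_def border3_map_first)
  have d1: "3 \<le> vec.dim (fibers (rotate T1))" "3 \<le> vec.dim (fibers (rotate (rotate T1)))"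
    using con dim_fibers_rotate_map_first_le[of P T1] dim_fibers_rotate_rotate_map_first_le[of P T1]
    unfolding concise_def T1(2)[symmetric] by linarith+
  obtain P2 :: "complex^3^'b" and Q2 where 2: "rotate T1 = map_first P2 (map_first Q2 (rotate T1))"
      "nondegenerate (map_first Q2 (rotate T1))"
    using red[OF border3_rotate[OF T1(1)] d1(1)] by blast
  define T2 where "T2 = map_first Q2 (rotate T1)"
  have T2: "border3 T2" "rotate T1 = map_first P2 T2" "nondegenerate T2"
    using 2 T1 by (auto simp: T2_def border3_map_first border3_rotate)
  have n2: "nondegenerate (rotate (rotate T2))"
    by (rule nondegenerate_rotate_rotate_map_first[of P2]) (simp add: T1(3) flip: T2(2))
  have d2: "3 \<le> vec.dim (fibers (rotate T2))"
    using d1(2) dim_fibers_rotate_map_first_le[of P2 T2] unfolding T2(2)[symmetric] by linarith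
  obtain P3 :: "complex^3^'c" and Q3 where 3: "rotate T2 = map_first P3 (map_first Q3 (rotate T2))"
      "nondegenerate (map_first Q3 (rotate T2))"
    using red[OF border3_rotate[OF T2(1)] d2] by blast
  define T3 where "T3 = map_first Q3 (rotate T2)"
  have T3: "border3 T3" "rotate T2 = map_first P3 T3" "nondegenerate T3"
    using 3 T2 by (auto simp: T3_def border3_map_first border3_rotate)
  have n3: "nondegenerate (rotate T3)"
    by (rule nondegenerate_rotate_map_first[of P3]) (simp add: n2 flip: T3(2))
  have n3': "nondegenerate (rotate (rotate T3))"
    by (rule nondegenerate_rotate_rotate_map_first[of P3]) (simp add: T2(3) flip: T3(2))
  have "T = tensor_map P P2 P3 (rotate T3)"
    by (simp add: tensor_map_def flip: T3(2) T2(2) T1(2))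
  then show ?thesis
    using T3(3) n3 n3' border3_rotate[OF T3(1)] by (intro exI[of _ "rotate T3"]) auto
qed

subsection \<open>Strassen's commutation identity\<close>

text \<open>For invertible \<open>slice t y\<close> this says that the other slices, multiplied by
  its inverse, commute. With the adjugate the condition is closed and also constrains singular
  slices.\<close>

definition strassen :: "complex^(3 \<times> 3 \<times> 3) \<Rightarrow> bool" where
  "strassen t \<longleftrightarrow> (\<forall>x y z. slice t x ** adj3 (slice t y) ** slice t z = slice t z ** adj3 (slice t y) ** slice t x)"

text \<open>The slices are \<open>G ** D x ** H\<close> with fixed \<open>G\<close>,
  \<open>H\<close> and diagonal \<open>D x\<close>. As the adjugate reverses products, the inner
  copies of \<open>G\<close> and \<open>H\<close> collapse to determinants, and diagonal matrices
  commute.\<close>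

lemma strassen_rank_le_3:
  assumes "rank_le 3 t"
  shows "strassen t"
proof -
  obtain a b c where t: "t = (\<Sum>i<3::nat. tensor3 (a i) (b i) (c i))" using assms rank_le_def by blast
  define G :: "complex^3^3" where "G = (\<chi> j m. (if m = 1 then b 0 else if m = 2 then b 1 else b 2) $ j)"
  define H :: "complex^3^3" where "H = (\<chi> m. if m = 1 then c 0 else if m = 2 then c 1 else c 2)"
  define D :: "complex^3 \<Rightarrow> complex^3^3" where
    "D x = (\<chi> m n. if m = n then bdot x (if m = 1 then a 0 else if m = 2 then a 1 else a 2) else 0)" for x
  have sl: "slice t x = G ** D x ** H" for x
  proof -
    have "slice t x = bdot x (a 0) *k outer (b 0) (c 0) + bdot x (a 1) *k outer (b 1) (c 1) + bdot x (a 2) *k outer (b 2) (c 2)"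
      by (simp add: t slice_add slice_tensor3 eval_nat_numeral)
    also have "\<dots> = G ** D x ** H"
      by (simp add: vec_eq_iff matrix_matrix_mult_def sum_3 G_def D_def H_def mult_ac)
    finally show ?thesis .
  qed
  have comm: "D x ** adj3 (D y) ** D z = D z ** adj3 (D y) ** D x" for x y z
    by (simp add: mat3_simps adj3_def D_def)
  have "slice t x ** adj3 (slice t y) ** slice t z
      = G ** D x ** (H ** adj3 H) ** adj3 (D y) ** (adj3 G ** G) ** D z ** H" for x y z
    by (simp add: sl adj3_mult matrix_mul_assoc)
  then have "slice t x ** adj3 (slice t y) ** slice t z
      = (det H * det G) *k (G ** (D x ** adj3 (D y) ** D z) ** H)" for x y z
    by (simp add: adj3_left adj3_right mscale_simps matrix_mul_assoc mult.commute)
  then show ?thesis unfolding strassen_def by (simp add: comm)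
qed

lemma tendsto_matrix_mult:
  fixes A :: "'x \<Rightarrow> complex^'n::finite^'m::finite" and B :: "'x \<Rightarrow> complex^'k::finite^'n"
  assumes "(A \<longlongrightarrow> a) F" "(B \<longlongrightarrow> b) F"
  shows "((\<lambda>x. A x ** B x) \<longlongrightarrow> a ** b) F"
  unfolding matrix_matrix_mult_def
  by (intro vec_tendstoI) (simp add: tendsto_sum tendsto_mult tendsto_vec_nth assms)

lemma tendsto_adj3:
  assumes "(A \<longlongrightarrow> a) F"
  shows "((\<lambda>x. adj3 (A x)) \<longlongrightarrow> adj3 a) F"
proof (intro vec_tendstoI)
  fix i j :: 3
  have "((\<lambda>x. A x $ i $ j) \<longlongrightarrow> a $ i $ j) F" for i j by (intro tendsto_vec_nth assms)
  then show "((\<lambda>x. adj3 (A x) $ i $ j) \<longlongrightarrow> adj3 a $ i $ j) F"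
    using exhaust_3[of i] exhaust_3[of j]
    by (elim disjE) (simp_all add: adj3_def tendsto_diff tendsto_mult)
qed

lemma tendsto_slice:
  assumes "(S \<longlongrightarrow> T) F"
  shows "((\<lambda>s. slice (S s) x) \<longlongrightarrow> slice T x) F"
  by (intro vec_tendstoI) (simp add: tendsto_sum tendsto_mult tendsto_vec_nth assms)

lemma strassen_border3:
  assumes "border3 t"
  shows "strassen t"
  unfolding strassen_def
proof (intro allI)
  fix x y z :: "complex^3"
  obtain S where S: "(S \<longlongrightarrow> t) (at (0::complex))" "\<forall>\<^sub>F s in at 0. rank_le 3 (S s)"
    using assms unfolding border3_def by blast
  let ?f = "\<lambda>t x z. slice t x ** adj3 (slice t y) ** slice t z"
  have lim: "((\<lambda>s. ?f (S s) x z) \<longlongrightarrow> ?f t x z) (at 0)" for x z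
    by (intro tendsto_matrix_mult tendsto_adj3 tendsto_slice S)
  have "\<forall>\<^sub>F s in at 0. ?f (S s) x z = ?f (S s) z x"
    using S(2) by eventually_elim (use strassen_rank_le_3 strassen_def in blast)
  then have "((\<lambda>s. ?f (S s) x z) \<longlongrightarrow> ?f t z x) (at 0)"
    using lim[of z x] by (simp add: tendsto_cong)
  from tendsto_unique[OF _ lim this] show "?f t x z = ?f t z x" by simp
qed

subsection \<open>Vectors in three-space\<close>

lemma cross_eq_0_parallel:
  assumes "cross x y = 0" "x \<noteq> 0"
  shows "\<exists>c. y = c *s x"
proof -
  have e: "x$2*y$3 = x$3*y$2" "x$3*y$1 = x$1*y$3" "x$1*y$2 = x$2*y$1"
    using assms(1) by (simp_all add: cross_def vec_eq_iff forall_3)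
  obtain i where i: "x $ i \<noteq> 0" using assms(2) by (auto simp: vec_eq_iff)
  have "\<forall>i j. y $ j * x $ i = y $ i * x $ j"
    unfolding forall_3 by (intro conjI; use e in \<open>simp add: mult.commute\<close>)
  then have "y $ j = y $ i / x $ i * x $ j" for j
    using i by (simp add: nonzero_eq_divide_eq)
  then have "y = (y $ i / x $ i) *s x" unfolding vec_eq_iff vector_smult_component by blast
  then show ?thesis by blast
qed

lemma ex_bdot_1:
  assumes "(x :: complex^3) \<noteq> 0"
  shows "\<exists>y. bdot x y = 1"
proof -
  obtain i where "x $ i \<noteq> 0" using assms by (auto simp: vec_eq_iff)
  then have "bdot x (axis i (1 / x $ i)) = 1"
    by (simp add: bdot_def axis_def if_distrib cong: if_cong)
  then show ?thesis by blast
qed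

lemma bdot_simps:
  "bdot x (y + z) = bdot x y + bdot x z" "bdot (x + y) z = bdot x z + bdot y z"
  "bdot x (c *s y) = c * bdot x y" "bdot (c *s x) y = c * bdot x y"
  "bdot x 0 = 0" "bdot 0 x = 0"
  by (simp_all add: bdot_def distrib_left distrib_right sum.distrib sum_distrib_left mult_ac)

lemma bdot_eqI: "(\<And>x. bdot x y = bdot x z) \<Longrightarrow> y = z"
  by (metis bdot_axis bdot_commute vec_eq_iff)

text \<open>The witness is \<open>cross v y\<close> with \<open>bdot u y = 1\<close>: expanding the
  double cross product leaves only \<open>v\<close>.\<close>

lemma perp_pair_of_perp:
  assumes "bdot v u = 0" "u \<noteq> 0"
  shows "\<exists>w. bdot v w = 0 \<and> cross u w = v"
proof -
  obtain y where "bdot u y = 1" using ex_bdot_1[OF assms(2)] by blast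
  then have "cross u (cross v y) = v" using assms by (simp add: cross_cross bdot_commute)
  then show ?thesis using bdot_cross by blast
qed

lemma ex_perp: "\<exists>u. u \<noteq> 0 \<and> bdot v u = 0" for v :: "complex^3"
proof (cases "v$1 = 0")
  case True
  then show ?thesis by (intro exI[of _ "axis 1 1"]) simp
next
  case False
  then have "vector [v$2, - v$1, 0] \<noteq> (0 :: complex^3)" "bdot v (vector [v$2, - v$1, 0]) = 0"
    by (auto simp: vec_eq_iff bdot_3 forall_3)
  then show ?thesis by blast
qed

lemma perp_pair: "\<exists>u w. bdot v u = 0 \<and> bdot v w = 0 \<and> cross u w = v"
  using ex_perp perp_pair_of_perp by metis

text \<open>The scaled cross products are the reciprocal basis, dual to \<open>u1\<close>,
  \<open>u2\<close>, \<open>u3\<close>.\<close>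

lemma resolution_of_identity:
  fixes u1 u2 u3 :: "complex^3"
  assumes d: "bdot u1 (cross u2 u3) = d" "d \<noteq> 0"
  shows "mat 1 = outer u1 ((1/d) *s cross u2 u3) + outer u2 ((1/d) *s cross u3 u1) + outer u3 ((1/d) *s cross u1 u2)"
proof -
  have "d *k mat 1 = outer u1 (cross u2 u3) + outer u2 (cross u3 u1) + outer u3 (cross u1 u2)"
    unfolding d(1)[symmetric]
    by (simp add: mat3_simps bdot_3 cross_def) (simp add: algebra_simps)
  then have "(1/d) *k (d *k mat 1) = (1/d) *k (outer u1 (cross u2 u3) + outer u2 (cross u3 u1) + outer u3 (cross u1 u2))"
    by simp
  then show ?thesis using d(2) by (simp add: mscale_simps outer_scale_right)
qed

lemma triple_rotate: "bdot u1 (cross u2 u3) = bdot u2 (cross u3 u1)"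
  by (simp add: bdot_3 cross_def algebra_simps)

text \<open>The triple products make \<open>m\<close>, \<open>n\<close>, \<open>r\<close> pairwise
  dependent modulo \<open>a\<close>, so all four vectors lie in a plane. Its normal is the cross
  product of \<open>a\<close> with one of the others, unless all are multiples of
  \<open>a\<close>.\<close>

lemma common_perp:
  fixes a m n r :: "complex^3"
  assumes a: "a \<noteq> 0" and "bdot a (cross m n) = 0" "bdot a (cross r n) = 0" "bdot a (cross m r) = 0"
  shows "\<exists>x. x \<noteq> 0 \<and> bdot x a = 0 \<and> bdot x m = 0 \<and> bdot x n = 0 \<and> bdot x r = 0"
proof -
  have tr: "bdot (cross a m) n = 0" "bdot (cross a m) r = 0" "bdot (cross a n) r = 0"
      "bdot (cross a n) m = 0" "bdot (cross a r) m = 0" "bdot (cross a r) n = 0"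
    using assms(2-) by (simp_all add: bdot_3 cross_def algebra_simps)
  consider "cross a m \<noteq> 0" | "cross a n \<noteq> 0" | "cross a r \<noteq> 0" | "cross a m = 0" "cross a n = 0" "cross a r = 0" by blast
  then show ?thesis
  proof cases
    case 4
    obtain x where x: "x \<noteq> 0" "bdot a x = 0" using ex_perp by blast
    obtain c d e where "m = c *s a" "n = d *s a" "r = e *s a" using cross_eq_0_parallel a 4 by metis
    then show ?thesis using x by (intro exI[of _ x]) (simp add: bdot_simps bdot_commute[of x])
  qed (use tr bdot_cross in blast)+
qed

subsection \<open>A concise tensor of border rank three has an invertible slice\<close>

text \<open>As a linear form in \<open>x\<close> this is the entry of \<open>slice T x\<close> in
  the directions \<open>y\<close> and \<open>z\<close>, see \<open>bdot_contract\<close>. Vectors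
  thus stand for the entries of a matrix of linear forms.\<close>

definition contract :: "complex^('a::finite \<times> 'b::finite \<times> 'c::finite) \<Rightarrow> complex^'b \<Rightarrow> complex^'c \<Rightarrow> complex^'a" where
  "contract T y z = (\<chi> i. \<Sum>j\<in>UNIV. \<Sum>k\<in>UNIV. y$j * z$k * T $ (i, j, k))"

lemma bdot_contract: "bdot x (contract T y z) = bdot y (slice T x *v z)" for T :: "complex^(3 \<times> 3 \<times> 3)"
  by (simp add: contract_def bdot_3 sum_3 matrix_vector_mult_def algebra_simps)

lemma contract_rotate: "contract T y z = z v* slice (rotate T) y" for T :: "complex^(3 \<times> 3 \<times> 3)"
  by (simp add: contract_def vec_eq_iff sum_3 vector_matrix_mult_def algebra_simps)

lemma contract_rotate_rotate: "contract T y z = slice (rotate (rotate T)) z *v y" for T :: "complex^(3 \<times> 3 \<times> 3)"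
  by (simp add: contract_def vec_eq_iff sum_3 matrix_vector_mult_def algebra_simps)

lemma contract_add_left: "contract T (y + y') z = contract T y z + contract T y' z"
  by (simp add: contract_def vec_eq_iff algebra_simps sum.distrib)

text \<open>The three contractions lie in the row space of a singular matrix; the auxiliary identity
  is multiplicativity of the determinant, written with triple products.\<close>

lemma singular_rotate_triple:
  fixes t :: "complex^(3 \<times> 3 \<times> 3)"
  assumes "det (slice (rotate t) y) = 0"
  shows "bdot (contract t y z1) (cross (contract t y z2) (contract t y z3)) = 0"
proof -
  have tr: "bdot (z1 v* N) (cross (z2 v* N) (z3 v* N)) = bdot z1 (cross z2 z3) * det N" for N :: "complex^3^3"
    by (simp add: bdot_3 cross_def det_3 vector_matrix_mult_def sum_3) (simp add: algebra_simps)
  show ?thesis using assms by (simp add: contract_rotate tr)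
qed

lemma singular_rotate_rotate_triple:
  fixes t :: "complex^(3 \<times> 3 \<times> 3)"
  assumes "det (slice (rotate (rotate t)) z) = 0"
  shows "bdot (contract t y1 z) (cross (contract t y2 z) (contract t y3 z)) = 0"
proof -
  have tr: "bdot (N *v y1) (cross (N *v y2) (N *v y3)) = bdot y1 (cross y2 y3) * det N" for N :: "complex^3^3"
    by (simp add: bdot_3 cross_def det_3 matrix_vector_mult_def sum_3) (simp add: algebra_simps)
  show ?thesis using assms by (simp add: contract_rotate_rotate tr)
qed

lemma rotate_slice_eq_0:
  fixes t :: "complex^(3 \<times> 3 \<times> 3)"
  assumes "\<And>x. y v* slice t x = 0"
  shows "slice (rotate t) y = 0"
proof -
  have "slice (rotate t) y $ k $ i = (y v* slice t (axis i 1)) $ k" for i k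
    by (simp add: vector_matrix_mult_def axis_def if_distrib if_distribR mult_ac cong: if_cong)
  then show ?thesis using assms by (simp add: vec_eq_iff del: slice_nth)
qed

lemma rotate_rotate_slice_eq_0:
  fixes t :: "complex^(3 \<times> 3 \<times> 3)"
  assumes "\<And>x. slice t x *v z = 0"
  shows "slice (rotate (rotate t)) z = 0"
proof -
  have "slice (rotate (rotate t)) z $ i $ j = (slice t (axis i 1) *v z) $ j" for i j
    by (simp add: matrix_vector_mult_def axis_def if_distrib if_distribR mult_ac cong: if_cong)
  then show ?thesis using assms by (simp add: vec_eq_iff del: slice_nth)
qed

lemma ex_common_perp_parallel:
  assumes "cross b1 b2 = 0" "cross b1 b3 = 0" "b1 \<noteq> 0"
  shows "\<exists>v. v \<noteq> 0 \<and> bdot v b1 = 0 \<and> bdot v b2 = 0 \<and> bdot v b3 = 0"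
proof -
  obtain c d where "b2 = c *s b1" "b3 = d *s b1" using assms cross_eq_0_parallel by metis
  moreover obtain v where "v \<noteq> 0" "bdot b1 v = 0" using ex_perp by blast
  ultimately show ?thesis by (intro exI[of _ v]) (simp add: bdot_simps bdot_commute[of v])
qed

lemma slice_expand:
  "slice t x = x$1 *k slice t (axis 1 1) + x$2 *k slice t (axis 2 1) + x$3 *k slice t (axis 3 1)"
  for t :: "complex^(3 \<times> 'b::finite \<times> 'c::finite)"
  by (simp add: vec_eq_iff sum_3 axis_def)

text \<open>Otherwise all slices have rank at most one, and each pair of basis slices has parallel
  left or parallel right factors. Two of the three pairs are of the same kind and share an index, so
  all left or all right factors are parallel, against nondegeneracy in the second or third
  direction.\<close>

lemma ex_slice_adj3:
  fixes t :: "complex^(3 \<times> 3 \<times> 3)"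
  assumes "nondegenerate t" "nondegenerate (rotate t)" "nondegenerate (rotate (rotate t))"
  shows "\<exists>x. adj3 (slice t x) \<noteq> 0"
proof (rule ccontr)
  assume "\<not> ?thesis"
  then have adj: "adj3 (slice t x) = 0" for x by blast
  define e where "e i = axis i (1::complex)" for i :: 3
  have "\<forall>i. \<exists>p. slice t (e i) = outer (fst p) (snd p)" using adj3_eq_0_outer[OF adj] by simp
  then obtain p where p: "\<And>i. slice t (e i) = outer (fst (p i)) (snd (p i))" by metis
  define b where "b = fst \<circ> p"
  define c where "c = snd \<circ> p"
  have sl: "slice t (e i) = outer (b i) (c i)" for i by (simp add: p b_def c_def)
  have "e i \<noteq> 0" for i by (simp add: e_def axis_eq_0_iff)
  then have "outer (b i) (c i) \<noteq> 0" for i using assms(1) sl unfolding nondegenerate_def by metis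
  then have nz: "b i \<noteq> 0" "c i \<noteq> 0" for i by (auto simp: outer_eq_0)
  \<comment> \<open>The adjugate of a sum of two outer products is the outer product of the two
    cross products of their factors.\<close>
  have pair: "cross (b i) (b j) = 0 \<or> cross (c i) (c j) = 0" for i j
  proof -
    have "adj3 (outer (b i) (c i) + outer (b j) (c j)) = 0"
      using adj[of "e i + e j"] by (simp add: slice_add_right sl)
    moreover have "adj3 (outer x y + outer x' y') = outer (cross y y') (cross x x')" for x y x' y'
      by (simp add: mat3_simps adj3_def cross_def) (simp add: algebra_simps)
    ultimately show ?thesis by (auto simp: outer_eq_0)
  qed
  have ex: "slice t x = x$1 *k outer (b 1) (c 1) + x$2 *k outer (b 2) (c 2) + x$3 *k outer (b 3) (c 3)" for x
    by (subst slice_expand) (simp flip: e_def sl)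
  have cr: "cross y x = 0" if "cross x y = 0" for x y
    using that by (simp add: cross_def vec_eq_iff forall_3 mult_ac)
  have noB: False if "v \<noteq> 0" "bdot v (b 1) = 0" "bdot v (b 2) = 0" "bdot v (b 3) = 0" for v
  proof -
    have "v v* slice t x = 0" for x
      using that(2-) by (simp add: ex algebra_simps flip: outer_scale_right) (simp add: vector_outer_mult)
    then show False using assms(2) that(1) rotate_slice_eq_0 unfolding nondegenerate_def by blast
  qed
  have noC: False if "v \<noteq> 0" "bdot v (c 1) = 0" "bdot v (c 2) = 0" "bdot v (c 3) = 0" for v
  proof -
    have "slice t x *v v = 0" for x
      using that(2-) by (simp add: ex algebra_simps flip: outer_scale_left) (simp add: outer_vector_mult bdot_commute[of _ v])
    then show False using assms(3) that(1) rotate_rotate_slice_eq_0 unfolding nondegenerate_def by blast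
  qed
  have B: "\<not> (cross (b i) (b j) = 0 \<and> cross (b i) (b k) = 0)" if "{i, j, k} = UNIV" for i j k
  proof
    assume "cross (b i) (b j) = 0 \<and> cross (b i) (b k) = 0"
    then obtain v where "v \<noteq> 0" "\<And>l. l \<in> {i, j, k} \<Longrightarrow> bdot v (b l) = 0"
      using ex_common_perp_parallel[of "b i" "b j" "b k"] nz by blast
    then have "v \<noteq> 0" "bdot v (b l) = 0" for l using that by auto
    then show False using noB by blast
  qed
  have C: "\<not> (cross (c i) (c j) = 0 \<and> cross (c i) (c k) = 0)" if "{i, j, k} = UNIV" for i j k
  proof
    assume "cross (c i) (c j) = 0 \<and> cross (c i) (c k) = 0"
    then obtain v where "v \<noteq> 0" "\<And>l. l \<in> {i, j, k} \<Longrightarrow> bdot v (c l) = 0"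
      using ex_common_perp_parallel[of "c i" "c j" "c k"] nz by blast
    then have "v \<noteq> 0" "bdot v (c l) = 0" for l using that by auto
    then show False using noC by blast
  qed
  have U: "{1, 2, 3} = (UNIV :: 3 set)" "{2, 1, 3} = (UNIV :: 3 set)" "{3, 1, 2} = (UNIV :: 3 set)"
    using exhaust_3 by auto
  show False
    using pair[of 1 2] pair[of 1 3] pair[of 2 3] B[OF U(1)] B[OF U(2)] B[OF U(3)] C[OF U(1)] C[OF U(2)] C[OF U(3)] cr
    by blast
qed

text \<open>If all slices in the first direction are singular, Strassen's identity at a slice \<open>M y\<close> of
  rank two with \<open>adj (M y) = u v\<^sup>T\<close> says that \<open>M x u\<close> and \<open>v\<^sup>T M x\<close> are multiples of fixed
  vectors by one linear form \<open>l x\<close>.  In bases adapted to \<open>u\<close>, \<open>v\<close> and these two vectors the slices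
  become \<open>[0 l 0; l m n; 0 r 0]\<close>, and singularity in the two other directions forces the
  forms \<open>l, m, n, r\<close> to have a common zero.\<close>

lemma ex_invertible_slice:
  fixes t :: "complex^(3 \<times> 3 \<times> 3)"
  assumes nd: "nondegenerate t" "nondegenerate (rotate t)" "nondegenerate (rotate (rotate t))"
    and st: "strassen t"
  shows "\<exists>x. det (slice t x) \<noteq> 0 \<or> det (slice (rotate t) x) \<noteq> 0 \<or> det (slice (rotate (rotate t)) x) \<noteq> 0"
proof (rule ccontr)
  assume "\<not> ?thesis"
  then have sing: "det (slice t x) = 0" "det (slice (rotate t) x) = 0" "det (slice (rotate (rotate t)) x) = 0" for x
    by auto
  obtain y where y: "adj3 (slice t y) \<noteq> 0" using ex_slice_adj3[OF nd] by blast
  have "adj3 (adj3 (slice t y)) = 0" using sing by (simp add: adj3_adj3 mscale_simps)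
  then obtain u v where uv: "adj3 (slice t y) = outer u v" using adj3_eq_0_outer by blast
  with y have nz: "u \<noteq> 0" "v \<noteq> 0" by (auto simp: outer_eq_0)
  define f where "f x = slice t x *v u" for x
  define g where "g x = v v* slice t x" for x
  \<comment> \<open>Strassen's identity at \<open>y\<close>, with the adjugate replaced by
    \<open>outer u v\<close>.\<close>
  have fg: "outer (f x) (g z) = outer (f z) (g x)" for x z
    using st unfolding strassen_def by (metis uv f_def g_def matrix_mult_outer outer_mult_matrix)
  obtain x1 where "f x1 \<noteq> 0"
    using nd(3) nz(1) rotate_rotate_slice_eq_0[of t u] unfolding f_def nondegenerate_def by blast
  obtain x0 where g0: "g x0 \<noteq> 0"
    using nd(2) nz(2) rotate_slice_eq_0[of v t] unfolding g_def nondegenerate_def by blast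
  have f0: "f x0 \<noteq> 0" using fg[of x1 x0] \<open>f x1 \<noteq> 0\<close> g0 by (metis outer_eq_0)
  obtain k where k: "g x0 $ k \<noteq> 0" using g0 by (auto simp: vec_eq_iff)
  obtain j where j: "f x0 $ j \<noteq> 0" using f0 by (auto simp: vec_eq_iff)
  \<comment> \<open>\<open>fg\<close> makes \<open>f x\<close> and \<open>g x\<close> the same
    multiple of \<open>f x0\<close> and \<open>g x0\<close>; the factor is read off in a coordinate
    where \<open>g x0\<close> does not vanish.\<close>
  define l where "l x = g x $ k / g x0 $ k" for x
  have fgn: "f x $ i * g x0 $ i' = f x0 $ i * g x $ i'" for x i i'
    using fg[of x x0] by (metis outer_nth)
  have fl: "f x = l x *s f x0" for x
    using fgn[of x _ k] k by (simp add: vec_eq_iff l_def field_simps)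
  have gl: "g x = l x *s g x0" for x
    using fgn[of x j] j fl[of x] by (simp add: vec_eq_iff)
  have l_add: "l (x + z) = l x + l z" for x z
    by (simp add: l_def g_def slice_add_right algebra_simps add_divide_distrib)
  have l0: "l x0 = 1" using k by (simp add: l_def)
  \<comment> \<open>This number is the linear coefficient in \<open>s\<close> of
    \<open>det (slice t (y + s *s x0))\<close>, which vanishes identically; \<open>s = 1\<close> and
    \<open>s = -1\<close> separate it from the quadratic one.\<close>
  have gu: "bdot u (g x0) = 0"
  proof -
    let ?b = "trace (adj3 (slice t y) ** slice t x0)" and ?c = "trace (slice t y ** adj3 (slice t x0))"
    have "s * ?b + s^2 * ?c = 0" for s
      using sing(1)[of "y + s *s x0"] det_pencil[of "slice t y" s "slice t x0"] sing(1)
      by (simp add: slice_add_right slice_scale_right)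
    from this[of 1] this[of "-1"] have "?b = 0" by simp
    then show ?thesis
      by (simp add: uv outer_mult_matrix trace_def bdot_def flip: g_def)
  qed
  have vf: "bdot v (f x0) = 0"
    using gu by (simp add: f_def g_def bdot_commute[of u] bdot_vector_matrix)
  \<comment> \<open>In the bases \<open>v, v2, v3\<close> and \<open>u, u2, u3\<close> the slice at
    \<open>x\<close> will be \<open>[0 l 0; l m n; 0 r q]\<close>. The prescribed cross products
    make both triple products \<open>-1\<close>.\<close>
  obtain u2 where u2: "bdot (g x0) u2 = 1" using ex_bdot_1[OF g0] by blast
  obtain u3 where u3: "bdot (g x0) u3 = 0" "cross u u3 = g x0"
    using perp_pair_of_perp[of "g x0" u] gu nz by (auto simp: bdot_commute)
  obtain v2 where v2: "bdot v2 (f x0) = 1" using ex_bdot_1[OF f0] by (auto simp: bdot_commute)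
  obtain v3 where v3: "bdot v3 (f x0) = 0" "cross v v3 = f x0"
    using perp_pair_of_perp[of "f x0" v] vf nz by (auto simp: bdot_commute)
  have c_u: "bdot x (contract t w u) = l x * bdot w (f x0)" for x w
    using fl[of x] by (simp add: bdot_contract bdot_simps flip: f_def)
  have c_v: "bdot x (contract t v w) = l x * bdot (g x0) w" for x w
    using gl[of x] by (simp add: bdot_contract bdot_simps flip: bdot_vector_matrix g_def)
  define a where "a = contract t v2 u"
  define m where "m = contract t v2 u2"
  define n where "n = contract t v2 u3"
  define r where "r = contract t v3 u2"
  define q where "q = contract t v3 u3"
  have xa: "bdot x a = l x" for x by (simp add: a_def c_u v2)
  have c11: "contract t v u = 0" and c31: "contract t v3 u = 0"
    by (rule bdot_eqI; simp add: c_u vf v3 bdot_simps)+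
  have c12: "contract t v u2 = a" by (rule bdot_eqI) (simp add: c_v u2 xa)
  have c13: "contract t v u3 = 0" by (rule bdot_eqI) (simp add: c_v u3 bdot_simps)
  have tripU: "bdot u (cross u2 u3) = -1"
    using u3 u2 by (simp add: bdot_3 cross_def vec_eq_iff forall_3) algebra
  have tripV: "bdot v (cross v2 v3) = -1"
    using v3 v2 by (simp add: bdot_3 cross_def vec_eq_iff forall_3) algebra
  have entries: "det (\<chi> i j. bdot (vector [v, v2, v3] $ i) (A *v vector [u, u2, u3] $ j) :: complex^3^3) = det A"
    for A :: "complex^3^3"
  proof -
    have E1: "(\<chi> i j. bdot (vector [v, v2, v3] $ i) (A *v vector [u, u2, u3] $ j)) =
      (vector [v, v2, v3] :: complex^3^3) ** A ** transpose (vector [u, u2, u3])"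
      by (simp add: vec_eq_iff matrix_matrix_mult_def transpose_def bdot_3 sum_3 matrix_vector_mult_def algebra_simps)
    have E2: "det (vector [x, x', x''] :: complex^3^3) = bdot x (cross x' x'')" for x x' x''
      by (simp add: det_3 bdot_3 cross_def algebra_simps)
    show ?thesis unfolding E1 by (simp add: det_mul E2 tripU tripV)
  qed
  \<comment> \<open>The determinant of the transformed slice is \<open>- l^2 q\<close>.\<close>
  have lq: "l x * l x * bdot x q = 0" for x
    using entries[of "slice t x"] sing(1)[of x]
    by (simp add: det_3 c11 c31 c12 c13 xa bdot_simps flip: bdot_contract a_def m_def n_def r_def q_def)
  have q1: "bdot x q = 0" if "l x \<noteq> 0" for x using lq[of x] that by simp
  \<comment> \<open>A linear form that vanishes off the hyperplane \<open>l = 0\<close> vanishes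
    everywhere: a point of the hyperplane is moved off it by adding \<open>x0\<close>.\<close>
  have "bdot x q = 0" for x
  proof (cases "l x = 0")
    case True
    then show ?thesis using q1[of "x + x0"] q1[of x0] l0 by (simp add: l_add bdot_simps)
  qed (rule q1)
  then have q0: "q = 0" by (intro bdot_eqI) (simp add: bdot_simps)
  \<comment> \<open>The slice of \<open>rotate t\<close> at \<open>v2\<close> has the contractions
    \<open>a, m, n\<close>, the one at \<open>v2 + v3\<close> has \<open>a, m + r, n\<close>, and
    the slice of the twice rotated tensor at \<open>u2\<close> has \<open>a, m, r\<close>.\<close>
  have "bdot a (cross m n) = 0"
    using singular_rotate_triple[OF sing(2), of v2 u u2 u3] by (simp flip: a_def m_def n_def)
  moreover have "bdot a (cross r n) = 0"
  proof -
    have "bdot a (cross (m + r) n) = 0"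
      using singular_rotate_triple[OF sing(2), of "v2 + v3" u u2 u3] q0
      by (simp add: contract_add_left c31 flip: a_def m_def n_def r_def q_def)
    moreover have "cross (m + r) n = cross m n + cross r n"
      by (simp add: cross_def vec_eq_iff forall_3 algebra_simps)
    ultimately show ?thesis using \<open>bdot a (cross m n) = 0\<close> by (simp add: bdot_simps)
  qed
  moreover have "bdot a (cross m r) = 0"
    using singular_rotate_rotate_triple[OF sing(3), of v u2 v2 v3] by (simp add: c12 flip: m_def r_def)
  moreover have "a \<noteq> 0" using xa[of x0] l0 by (auto simp: bdot_simps)
  ultimately obtain x where x: "x \<noteq> 0" "bdot x a = 0" "bdot x m = 0" "bdot x n = 0" "bdot x r = 0"
    using common_perp by blast
  have zero: "z = 0" if "bdot v z = 0" "bdot v2 z = 0" "bdot v3 z = 0" for z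
  proof -
    have "z = mat 1 *v z" by simp
    also have "mat 1 = transpose (mat 1 :: complex^3^3)" by (simp add: transpose_mat)
    also have "transpose (mat 1) = outer (- (cross v2 v3)) v + outer (- (cross v3 v)) v2 + outer (- (cross v v2)) v3"
      by (subst resolution_of_identity[OF tripV]) (simp_all add: transpose_def vec_eq_iff)
    finally show ?thesis
      using that by (simp add: matrix_vector_mult_add_rdistrib outer_vector_mult)
  qed
  have "slice t x *v w = 0" if "w \<in> {u, u2, u3}" for w
    using that x q0
    by (intro zero) (auto simp: c11 c31 c12 c13 bdot_simps simp flip: bdot_contract a_def m_def n_def r_def q_def)
  then have "slice t x ** mat 1 = 0"
    by (subst resolution_of_identity[OF tripU])
       (simp_all add: matrix_add_ldistrib matrix_mult_outer, simp add: vec_eq_iff)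
  then show False using nd(1) x(1) by (simp add: nondegenerate_def)
qed

subsection \<open>Normal forms\<close>

text \<open>The coefficient of \<open>t^2\<close> in the product of the curves with Taylor
  coefficients \<open>a\<close>, \<open>b\<close>, \<open>c\<close>: all index triples with sum
  five. The terms \<open>y\<close> and \<open>y'\<close> are absorbed by a change of frames.\<close>

definition osculating_form ::
  "(3 \<Rightarrow> complex^'a::finite) \<Rightarrow> (3 \<Rightarrow> complex^'b::finite) \<Rightarrow> (3 \<Rightarrow> complex^'c::finite) \<Rightarrow> complex^('a \<times> 'b \<times> 'c)" where
  "osculating_form a b c =
     tensor3 (a 1) (b 1) (c 3) + tensor3 (a 1) (b 2) (c 2) + tensor3 (a 1) (b 3) (c 1) +
     tensor3 (a 2) (b 1) (c 2) + tensor3 (a 2) (b 2) (c 1) + tensor3 (a 3) (b 1) (c 1)"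

text \<open>A tangent vector at \<open>tensor3 (a 1) (b 1) (c 1)\<close> plus one at
  \<open>tensor3 (a 2) (b 1) (c 1)\<close>. These points lie on a line moving the first factor;
  \<open>a 3\<close> collects the motion of the first factor at both.\<close>

definition line_form ::
  "(3 \<Rightarrow> complex^'a::finite) \<Rightarrow> (3 \<Rightarrow> complex^'b::finite) \<Rightarrow> (3 \<Rightarrow> complex^'c::finite) \<Rightarrow> complex^('a \<times> 'b \<times> 'c)" where
  "line_form a b c =
     tensor3 (a 1) (b 2) (c 1) + tensor3 (a 1) (b 1) (c 2) +
     tensor3 (a 2) (b 3) (c 1) + tensor3 (a 2) (b 1) (c 3) + tensor3 (a 3) (b 1) (c 1)"

definition is_osculating :: "complex^('a::finite \<times> 'b::finite \<times> 'c::finite) \<Rightarrow> bool" where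
  "is_osculating T \<longleftrightarrow> (\<exists>a b c. T = osculating_form a b c)"

definition is_line :: "complex^('a::finite \<times> 'b::finite \<times> 'c::finite) \<Rightarrow> bool" where
  "is_line T \<longleftrightarrow> (\<exists>a b c. T = line_form a b c)"

definition is_any_line :: "complex^('a::finite \<times> 'b::finite \<times> 'c::finite) \<Rightarrow> bool" where
  "is_any_line T \<longleftrightarrow> is_line T \<or> is_line (rotate T) \<or> is_line (rotate (rotate T))"

definition triple :: "'x \<Rightarrow> 'x \<Rightarrow> 'x \<Rightarrow> 3 \<Rightarrow> 'x" where
  "triple x y z = (\<lambda>i. if i = 1 then x else if i = 2 then y else z)"

lemma triple_simps [simp]: "triple x y z 1 = x" "triple x y z 2 = y" "triple x y z 3 = z"
  by (simp_all add: triple_def)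

lemma is_osculatingI:
  "T = tensor3 a1 b1 c3 + tensor3 a1 b2 c2 + tensor3 a1 b3 c1 +
     tensor3 a2 b1 c2 + tensor3 a2 b2 c1 + tensor3 a3 b1 c1 \<Longrightarrow> is_osculating T"
  unfolding is_osculating_def osculating_form_def
  by (rule exI[of _ "triple a1 a2 a3"], rule exI[of _ "triple b1 b2 b3"], rule exI[of _ "triple c1 c2 c3"]) simp

lemma is_lineI:
  "T = tensor3 a1 b2 c1 + tensor3 a1 b1 c2 + tensor3 a2 b3 c1 + tensor3 a2 b1 c3 + tensor3 a3 b1 c1 \<Longrightarrow> is_line T"
  unfolding is_line_def line_form_def
  by (rule exI[of _ "triple a1 a2 a3"], rule exI[of _ "triple b1 b2 b3"], rule exI[of _ "triple c1 c2 c3"]) simp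

lemma rotate_osculating_form: "rotate (osculating_form a b c) = osculating_form b c a"
  by (simp add: osculating_form_def rotate_add add_ac)

lemma is_osculating_rotate [simp]: "is_osculating (rotate T) \<longleftrightarrow> is_osculating T"
  unfolding is_osculating_def by (metis rotate_osculating_form rotate_rotate_rotate)

lemma is_any_line_rotate [simp]: "is_any_line (rotate T) \<longleftrightarrow> is_any_line T"
  by (auto simp: is_any_line_def)

lemma tensor_map_osculating_form:
  "tensor_map A B C (osculating_form a b c) = osculating_form (\<lambda>i. A *v a i) (\<lambda>i. B *v b i) (\<lambda>i. C *v c i)"
  by (simp add: osculating_form_def tensor_map_add)

lemma tensor_map_line_form:
  "tensor_map A B C (line_form a b c) = line_form (\<lambda>i. A *v a i) (\<lambda>i. B *v b i) (\<lambda>i. C *v c i)"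
  by (simp add: line_form_def tensor_map_add)

lemma tensor_map_rotate_line_form:
  "tensor_map A B C (rotate (line_form a b c)) = rotate (line_form (\<lambda>i. C *v a i) (\<lambda>i. A *v b i) (\<lambda>i. B *v c i))"
  by (simp add: line_form_def tensor_map_add rotate_add)

lemma tensor_map_rotate_rotate_line_form:
  "tensor_map A B C (rotate (rotate (line_form a b c))) =
    rotate (rotate (line_form (\<lambda>i. B *v a i) (\<lambda>i. C *v b i) (\<lambda>i. A *v c i)))"
  by (simp add: line_form_def tensor_map_add rotate_add)

lemma is_osculating_tensor_map: "is_osculating T \<Longrightarrow> is_osculating (tensor_map A B C T)"
  unfolding is_osculating_def using tensor_map_osculating_form by blast

lemma is_any_line_iff:
  "is_any_line T \<longleftrightarrow> (\<exists>a b c. T = line_form a b c) \<or> (\<exists>a b c. T = rotate (line_form a b c)) \<or>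
     (\<exists>a b c. T = rotate (rotate (line_form a b c)))"
  unfolding is_any_line_def is_line_def by (metis rotate_rotate_rotate)

lemma is_any_line_tensor_map: "is_any_line T \<Longrightarrow> is_any_line (tensor_map A B C T)"
  unfolding is_any_line_iff
  by (elim disjE exE; simp only: tensor_map_line_form tensor_map_rotate_line_form
      tensor_map_rotate_rotate_line_form; blast)

lemma rank_le_5_osculating_form: "rank_le 5 (osculating_form a b c)"
  for a :: "3 \<Rightarrow> complex^'a::finite" and b :: "3 \<Rightarrow> complex^'b::finite" and c :: "3 \<Rightarrow> complex^'c::finite"
proof -
  text \<open>As a quadratic form in (b, c) each of the three slices is a combination of the squares of
    \<open>e\<^sub>1\<close>, \<open>e\<^sub>1 + e\<^sub>2\<close>, \<open>e\<^sub>1 - e\<^sub>2\<close>, \<open>e\<^sub>1 + e\<^sub>3\<close>, \<open>e\<^sub>1 - e\<^sub>3\<close>.\<close>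
  have "osculating_form a b c =
     tensor3 (a 3 - a 1) (b 1) (c 1) +
     tensor3 ((1/2) *s (a 1 + a 2)) (b 1 + b 2) (c 1 + c 2) + tensor3 ((1/2) *s (a 1 - a 2)) (b 1 - b 2) (c 1 - c 2) +
     tensor3 ((1/2) *s a 1) (b 1 + b 3) (c 1 + c 3) + tensor3 (- (1/2) *s a 1) (b 1 - b 3) (c 1 - c 3)"
    by (simp add: tensor_eq_iff osculating_form_def) (simp add: field_simps)
  moreover have "rank_le (Suc (Suc (Suc (Suc (Suc 0))))) \<dots>"
    by (intro rank_le_plus_tensor3 rank_le_tensor3)
  ultimately show ?thesis by (simp add: eval_nat_numeral)
qed

text \<open>Polarization writes each of the two symmetric sums such as \<open>b 2\<close>,
  \<open>c 1\<close> plus \<open>b 1\<close>, \<open>c 2\<close> with two summands; the term with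
  \<open>a 3\<close> is the fifth.\<close>

lemma rank_le_5_line_form: "rank_le 5 (line_form a b c)"
  for a :: "3 \<Rightarrow> complex^'a::finite" and b :: "3 \<Rightarrow> complex^'b::finite" and c :: "3 \<Rightarrow> complex^'c::finite"
proof -
  have "line_form a b c =
     tensor3 (a 3) (b 1) (c 1) +
     tensor3 ((1/2) *s a 1) (b 1 + b 2) (c 1 + c 2) + tensor3 (- (1/2) *s a 1) (b 1 - b 2) (c 1 - c 2) +
     tensor3 ((1/2) *s a 2) (b 1 + b 3) (c 1 + c 3) + tensor3 (- (1/2) *s a 2) (b 1 - b 3) (c 1 - c 3)"
    by (simp add: tensor_eq_iff line_form_def) (simp add: field_simps)
  moreover have "rank_le (Suc (Suc (Suc (Suc (Suc 0))))) \<dots>"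
    by (intro rank_le_plus_tensor3 rank_le_tensor3)
  ultimately show ?thesis by (simp add: eval_nat_numeral)
qed

subsection \<open>Classification of concise tensors of border rank three\<close>

definition classified :: "complex^('a::finite \<times> 'b::finite \<times> 'c::finite) \<Rightarrow> bool" where
  "classified T \<longleftrightarrow> rank_le 4 T \<or> is_osculating T \<or> is_any_line T"

lemma classified_rotate [simp]: "classified (rotate T) \<longleftrightarrow> classified T"
  by (simp add: classified_def)

lemma rank_le_4I:
  "T = tensor3 a1 b1 c1 + tensor3 a2 b2 c2 + tensor3 a3 b3 c3 + tensor3 a4 b4 c4 \<Longrightarrow> rank_le 4 T"
proof -
  assume T: "T = tensor3 a1 b1 c1 + tensor3 a2 b2 c2 + tensor3 a3 b3 c3 + tensor3 a4 b4 c4"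
  have "rank_le (Suc (Suc (Suc (Suc 0)))) T"
    unfolding T by (intro rank_le_plus_tensor3 rank_le_tensor3)
  then show ?thesis by (simp add: eval_nat_numeral)
qed

lemma two_by_two_rank_one:
  fixes a b c d :: complex
  assumes "a * d = b * c"
  shows "\<exists>s1 s2 t1 t2. a = s1 * t1 \<and> b = s1 * t2 \<and> c = s2 * t1 \<and> d = s2 * t2"
proof (cases "a = 0 \<and> b = 0")
  case True
  then show ?thesis by (intro exI[of _ 0] exI[of _ 1] exI[of _ c] exI[of _ d]) auto
next
  case False
  then show ?thesis
  proof (cases "a = 0")
    case True
    then show ?thesis using False assms
      by (intro exI[of _ 1] exI[of _ "d / b"] exI[of _ a] exI[of _ b]) auto
  next
    case False
    then show ?thesis using assms
      by (intro exI[of _ 1] exI[of _ "c / a"] exI[of _ a] exI[of _ b]) (auto simp: field_simps)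
  qed
qed

lemma parallel3:
  fixes x y :: "complex^3"
  assumes "cross x y = 0"
  shows "\<exists>h s s'. x = s *s h \<and> y = s' *s h"
proof (cases "x = 0")
  case True
  then show ?thesis by (intro exI[of _ y] exI[of _ 0] exI[of _ 1]) simp
next
  case False
  then obtain c where "y = c *s x" using cross_eq_0_parallel assms by blast
  then show ?thesis by (intro exI[of _ x] exI[of _ 1] exI[of _ c]) simp
qed

text \<open>With \<open>m\<close> an eigenvalue of the 2 by 2 matrix \<open>[e f; g 0]\<close>,
  subtracting \<open>m\<close> times the identity leaves rank at most one. So the block costs two
  summands for the identity and one for the rest.\<close>

lemma rank_le_4_block:
  fixes b2 b3 c2 c3 :: "complex^3"
  shows "rank_le 4 (tensor3 p b1 c1 + tensor_matrix P (outer b2 c2 + outer b3 c3) +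
     tensor_matrix Q (e *k outer b2 c2 + f *k outer b2 c3 + g *k outer b3 c2))"
proof -
  have "\<exists>m. m^2 - e * m - f * g = 0"
  proof (rule exI)
    let ?m = "(e + csqrt (e^2 + 4 * f * g)) / 2"
    have "(csqrt (e^2 + 4 * f * g))^2 = e^2 + 4 * f * g" by simp
    then show "?m^2 - e * ?m - f * g = 0" by (simp add: power2_eq_square field_simps)
  qed
  then obtain m where "m^2 - e * m - f * g = 0" by blast
  then have "(e - m) * (- m) = f * g" by (simp add: power2_eq_square algebra_simps)
  then obtain s1 s2 t1 t2 where st: "e - m = s1 * t1" "f = s1 * t2" "g = s2 * t1" "- m = s2 * t2"
    using two_by_two_rank_one by metis
  have e: "e = s1 * t1 - s2 * t2" "m = - (s2 * t2)" proof -
    have "e = (e - m) - (- m)" by simp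
    then show "e = s1 * t1 - s2 * t2" by (simp only: st(1,4))
    show "m = - (s2 * t2)" by (simp flip: st(4))
  qed
  show ?thesis
    by (rule rank_le_4I[of _ p b1 c1 "P + m *s Q" b2 c2 "P + m *s Q" b3 c3 Q "s1 *s b2 + s2 *s b3" "t1 *s c2 + t2 *s c3"])
       (simp add: tensor_eq_iff e st(2,3) algebra_simps)
qed

text \<open>Here the slices are the identity, an upper triangular \<open>h\<close> and the corner
  entry. A nonzero \<open>h22\<close> makes \<open>h\<close> a multiple of a projection up to the
  corner. If \<open>h22 = 0\<close>, then \<open>h\<close> is nilpotent modulo the corner, and
  whether one of \<open>h12\<close>, \<open>h23\<close> vanishes separates the two families.\<close>

lemma classified_nilpotent_part:
  "classified (tensor_matrix p (outer b1 c1 + outer b2 c2 + outer b3 c3) +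
     tensor_matrix Q (h12 *k outer b1 c2 + h22 *k outer b2 c2 + h23 *k outer b2 c3) +
     tensor_matrix R (outer b1 c3))" (is "classified ?T")
proof -
  consider "h22 \<noteq> 0" | "h22 = 0" "h12 = 0" | "h22 = 0" "h23 = 0" | "h22 = 0" "h12 \<noteq> 0" "h23 \<noteq> 0" by blast
  then show ?thesis
  proof cases
    case 1
    \<comment> \<open>Completing the product, \<open>h\<close> becomes \<open>h22\<close> times an
      outer product minus a multiple of \<open>outer b1 c3\<close>; that multiple is absorbed into
      \<open>R\<close>.\<close>
    have "rank_le 4 ?T"
      by (rule rank_le_4I[of _ p b1 "c1 - (h12/h22) *s c2" "p + h22 *s Q" "b2 + (h12/h22) *s b1" "c2 + (h23/h22) *s c3"
          p "b3 - (h23/h22) *s (b2 + (h12/h22) *s b1)" c3 "R - (h12*h23/h22) *s Q" b1 c3])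
         (use 1 in \<open>simp add: tensor_eq_iff field_simps\<close>)
    then show ?thesis by (simp add: classified_def)
  next
    case 2
    have "is_line (rotate ?T)"
      by (rule is_lineI[of _ b1 c1 p c3 R b2 c2 "h23 *s Q" b3])
         (simp add: 2 tensor_eq_iff algebra_simps)
    then show ?thesis by (simp add: classified_def is_any_line_def)
  next
    case 3
    have "is_line (rotate (rotate ?T))"
      by (rule is_lineI[of _ c2 "h12 *s Q" b1 p b2 c3 R b3 c1])
         (simp add: 3 tensor_eq_iff algebra_simps)
    then show ?thesis by (simp add: classified_def is_any_line_def)
  next
    case 4
    \<comment> \<open>The right factors enter in reverse order, and the scalars \<open>h12\<close>,
      \<open>h23\<close> are distributed over the frames so that all six coefficients become
      1.\<close>
    have "is_osculating ?T"
      by (rule is_osculatingI[of _ "(1/(h12*h23)) *s p" b1 "(h12*h23) *s c1" "h23 *s b2" "h12 *s c2" "(h12*h23) *s b3" c3 Q R])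
         (use 4 in \<open>simp add: tensor_eq_iff field_simps\<close>)
    then show ?thesis by (simp add: classified_def)
  qed
qed

lemma eigenvectors_of_commuting_outer:
  fixes A :: "complex^3^3"
  assumes "A ** outer u v = outer u v ** A" "u \<noteq> 0" "v \<noteq> 0"
  shows "\<exists>m. A *v u = m *s u \<and> v v* A = m *s v"
proof -
  have e: "(A *v u) $ i * v $ j = u $ i * (v v* A) $ j" for i j
    using assms(1) by (metis matrix_mult_outer outer_mult_matrix outer_nth)
  obtain i j where ij: "u $ i \<noteq> 0" "v $ j \<noteq> 0" using assms by (auto simp: vec_eq_iff)
  define m where "m = (A *v u) $ i / u $ i"
  have "(v v* A) $ k = m * v $ k" for k using e[of i k] ij by (simp add: m_def field_simps)
  then have 2: "v v* A = m *s v" by (simp add: vec_eq_iff)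
  have "(A *v u) $ k = m * u $ k" for k using e[of k j] ij by (simp add: 2 field_simps)
  then show ?thesis using 2 by (auto simp: vec_eq_iff)
qed

lemma adj3_commute:
  assumes "X ** Z = Z ** X"
  shows "X ** adj3 Z = adj3 Z ** X"
proof -
  have ZZ: "X ** (Z ** Z) = Z ** Z ** X" using assms by (metis matrix_mul_assoc)
  have "adj3 Z = Z ** Z + (- trace Z) *k Z + trace (adj3 Z) *k mat 1"
    by (subst adj3_poly) (simp add: vec_eq_iff)
  then obtain c d where "adj3 Z = Z ** Z + c *k Z + d *k mat 1" by blast
  then show ?thesis
    by (simp add: matrix_add_ldistrib matrix_add_rdistrib mscale_simps ZZ assms)
qed

lemma expand_matrix:
  fixes X :: "complex^3^3"
  assumes I: "mat 1 = outer u1 f1 + outer u2 f2 + outer u3 f3"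
  shows "X = bdot f1 (X *v u1) *k outer u1 f1 + bdot f1 (X *v u2) *k outer u1 f2 + bdot f1 (X *v u3) *k outer u1 f3
    + bdot f2 (X *v u1) *k outer u2 f1 + bdot f2 (X *v u2) *k outer u2 f2 + bdot f2 (X *v u3) *k outer u2 f3
    + bdot f3 (X *v u1) *k outer u3 f1 + bdot f3 (X *v u2) *k outer u3 f2 + bdot f3 (X *v u3) *k outer u3 f3"
proof -
  have "X = mat 1 ** (X ** mat 1)" by simp
  also have "\<dots> = mat 1 ** (outer (X *v u1) f1 + outer (X *v u2) f2 + outer (X *v u3) f3)"
    by (simp add: I matrix_add_ldistrib matrix_mult_outer)
  also have "\<dots> = (outer u1 f1 + outer u2 f2 + outer u3 f3) ** (outer (X *v u1) f1 + outer (X *v u2) f2 + outer (X *v u3) f3)"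
    by (simp only: I)
  finally show ?thesis
    by (simp add: matrix_add_ldistrib matrix_add_rdistrib matrix_mult_outer outer_vector_mult outer_scale_left
        matrix_vector_mult_add_rdistrib outer_add_left add_ac)
qed

lemma entry_of_product:
  fixes X Y :: "complex^3^3"
  assumes I: "mat 1 = outer u1 f1 + outer u2 f2 + outer u3 f3"
  shows "bdot f (X *v (Y *v u)) =
     bdot f (X *v u1) * bdot f1 (Y *v u) + bdot f (X *v u2) * bdot f2 (Y *v u) + bdot f (X *v u3) * bdot f3 (Y *v u)"
proof -
  have "bdot f (X *v (Y *v u)) = bdot f (X *v (mat 1 *v (Y *v u)))" by simp
  then show ?thesis
    by (simp add: I matrix_vector_mult_add_rdistrib outer_vector_mult matrix_vector_right_distrib vec.scale bdot_simps mult_ac)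
qed

text \<open>If \<open>bdot v u\<close> is nonzero, the space splits as \<open>u\<close> plus the
  plane orthogonal to \<open>v\<close>, and \<open>X\<close>, \<open>Y\<close> are commuting 2 by 2
  blocks. Otherwise \<open>u\<close> lies in that plane, and a basis adapted to the flag makes
  \<open>X\<close>, \<open>Y\<close> upper triangular with zero first column and last row. In both
  cases commutation makes \<open>X\<close> and \<open>Y\<close> proportional up to a harmless
  summand.\<close>

lemma classified_commuting_kernel:
  fixes X Y G :: "complex^3^3"
  assumes comm: "X ** Y = Y ** X" and nz: "u \<noteq> 0" "v \<noteq> 0"
    and u: "X *v u = 0" "Y *v u = 0" and v: "v v* X = 0" "v v* Y = 0"
  shows "classified (tensor_matrix p G + tensor_matrix q (G ** X) + tensor_matrix r (G ** Y))"
proof -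
  have v': "bdot v (X *v z) = 0" "bdot v (Y *v z) = 0" for z
    using v by (simp_all add: bdot_simps flip: bdot_vector_matrix)
  have XY: "X *v (Y *v z) = Y *v (X *v z)" for z using comm by (simp add: matrix_vector_mul_assoc)
  have Gmul: "G = outer (G *v u1) f1 + outer (G *v u2) f2 + outer (G *v u3) f3"
    if "mat 1 = outer u1 f1 + outer u2 f2 + outer u3 f3" for u1 u2 u3 f1 f2 f3
    using arg_cong[OF that, of "\<lambda>A. G ** A"] by (simp add: matrix_add_ldistrib matrix_mult_outer)
  show ?thesis
  proof (cases "bdot v u = 0")
    case False
    obtain u2 u3 where w: "bdot v u2 = 0" "bdot v u3 = 0" "cross u2 u3 = v" using perp_pair by blast
    define d where "d = bdot v u"
    have I: "mat 1 = outer u ((1/d) *s v) + outer u2 ((1/d) *s cross u3 u) + outer u3 ((1/d) *s cross u u2)"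
      using resolution_of_identity[of u u2 u3 d] False w by (simp add: d_def bdot_commute)
    define f2 where "f2 = (1/d) *s cross u3 u"
    define f3 where "f3 = (1/d) *s cross u u2"
    note I = I[folded f2_def f3_def]
    define x22 x23 x32 x33 where "x22 = bdot f2 (X *v u2)" and "x23 = bdot f2 (X *v u3)"
      and "x32 = bdot f3 (X *v u2)" and "x33 = bdot f3 (X *v u3)"
    define y22 y23 y32 y33 where "y22 = bdot f2 (Y *v u2)" and "y23 = bdot f2 (Y *v u3)"
      and "y32 = bdot f3 (Y *v u2)" and "y33 = bdot f3 (Y *v u3)"
    have X: "X = x22 *k outer u2 f2 + x23 *k outer u2 f3 + x32 *k outer u3 f2 + x33 *k outer u3 f3"
      by (subst expand_matrix[OF I]) (simp add: u v' bdot_simps mscale_simps x22_def x23_def x32_def x33_def)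
    have Y: "Y = y22 *k outer u2 f2 + y23 *k outer u2 f3 + y32 *k outer u3 f2 + y33 *k outer u3 f3"
      by (subst expand_matrix[OF I]) (simp add: u v' bdot_simps mscale_simps y22_def y23_def y32_def y33_def)
    have c: "x22 * y22 + x23 * y32 = y22 * x22 + y23 * x32" "x22 * y23 + x23 * y33 = y22 * x23 + y23 * x33"
        "x32 * y22 + x33 * y32 = y32 * x22 + y33 * x32"
      using XY[of u2] XY[of u3] entry_of_product[OF I, of f2 X Y u2] entry_of_product[OF I, of f2 Y X u2]
        entry_of_product[OF I, of f2 X Y u3] entry_of_product[OF I, of f2 Y X u3]
        entry_of_product[OF I, of f3 X Y u2] entry_of_product[OF I, of f3 Y X u2]
      by (simp_all add: u v' bdot_simps x22_def x23_def x32_def x33_def y22_def y23_def y32_def y33_def)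
    \<comment> \<open>Commuting 2 by 2 matrices are proportional modulo scalars; the three numbers
      are the coordinates of a block modulo the identity.\<close>
    have "cross (vector [x22 - x33, x23, x32]) (vector [y22 - y33, y23, y32]) = 0"
      using c by (simp add: cross_def vec_eq_iff forall_3) (simp add: algebra_simps)
    then obtain h s s' where h: "vector [x22 - x33, x23, x32] = s *s (h :: complex^3)" "vector [y22 - y33, y23, y32] = s' *s h"
      using parallel3 by metis
    have hx: "x22 - x33 = s * h$1" "x23 = s * h$2" "x32 = s * h$3"
      using h(1) by (simp_all add: vec_eq_iff forall_3)
    have hy: "y22 - y33 = s' * h$1" "y23 = s' * h$2" "y32 = s' * h$3"
      using h(2) by (simp_all add: vec_eq_iff forall_3)
    have hx1: "x22 = s * h$1 + x33" "y22 = s' * h$1 + y33" using hx(1) hy(1) by (simp_all add: algebra_simps)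
    have GX: "G ** X = x22 *k outer (G *v u2) f2 + x23 *k outer (G *v u2) f3 + x32 *k outer (G *v u3) f2 + x33 *k outer (G *v u3) f3"
      by (subst X) (simp add: matrix_add_ldistrib mscale_simps matrix_mult_outer)
    have GY: "G ** Y = y22 *k outer (G *v u2) f2 + y23 *k outer (G *v u2) f3 + y32 *k outer (G *v u3) f2 + y33 *k outer (G *v u3) f3"
      by (subst Y) (simp add: matrix_add_ldistrib mscale_simps matrix_mult_outer)
    have "tensor_matrix p G + tensor_matrix q (G ** X) + tensor_matrix r (G ** Y) =
       tensor3 p (G *v u) ((1/d) *s v) + tensor_matrix (p + x33 *s q + y33 *s r) (outer (G *v u2) f2 + outer (G *v u3) f3) +
       tensor_matrix (s *s q + s' *s r) (h$1 *k outer (G *v u2) f2 + h$2 *k outer (G *v u2) f3 + h$3 *k outer (G *v u3) f2)"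
      unfolding GX GY
      by (subst Gmul[OF I]) (simp add: tensor_eq_iff hx hy hx1 algebra_simps)
    then show ?thesis using rank_le_4_block unfolding classified_def by metis
  next
    case True
    \<comment> \<open>\<open>u, w\<close> span the plane orthogonal to \<open>v\<close>, and
      \<open>cross u w = v\<close> with \<open>bdot v z = 1\<close> gives the basis
      \<open>u, w, z\<close> triple product 1, with \<open>v\<close> as its last dual
      vector.\<close>
    obtain w where w: "bdot v w = 0" "cross u w = v" using perp_pair_of_perp True nz by metis
    obtain z where z: "bdot v z = 1" using ex_bdot_1 nz by blast
    define f1 where "f1 = cross w z"
    define f2 where "f2 = cross z u"
    have "bdot u (cross w z) = 1" using z w(2) triple_rotate by (metis bdot_commute)
    then have I: "mat 1 = outer u f1 + outer w f2 + outer z v"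
      using resolution_of_identity[of u w z 1] w(2) by (simp add: f1_def f2_def)
    define x12 x13 x22 x23 where "x12 = bdot f1 (X *v w)" and "x13 = bdot f1 (X *v z)"
      and "x22 = bdot f2 (X *v w)" and "x23 = bdot f2 (X *v z)"
    define y12 y13 y22 y23 where "y12 = bdot f1 (Y *v w)" and "y13 = bdot f1 (Y *v z)"
      and "y22 = bdot f2 (Y *v w)" and "y23 = bdot f2 (Y *v z)"
    have X: "X = x12 *k outer u f2 + x13 *k outer u v + x22 *k outer w f2 + x23 *k outer w v"
      by (subst expand_matrix[OF I]) (simp add: u v' bdot_simps mscale_simps x12_def x13_def x22_def x23_def)
    have Y: "Y = y12 *k outer u f2 + y13 *k outer u v + y22 *k outer w f2 + y23 *k outer w v"
      by (subst expand_matrix[OF I]) (simp add: u v' bdot_simps mscale_simps y12_def y13_def y22_def y23_def)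
    have c: "x12 * y22 = y12 * x22" "x12 * y23 = y12 * x23" "x22 * y23 = y22 * x23"
      using XY[of w] XY[of z] entry_of_product[OF I, of f1 X Y w] entry_of_product[OF I, of f1 Y X w]
        entry_of_product[OF I, of f1 X Y z] entry_of_product[OF I, of f1 Y X z]
        entry_of_product[OF I, of f2 X Y z] entry_of_product[OF I, of f2 Y X z]
      by (simp_all add: u v' bdot_simps x12_def x13_def x22_def x23_def y12_def y13_def y22_def y23_def)
    have "cross (vector [x12, x22, x23]) (vector [y12, y22, y23]) = 0"
      using c by (simp add: cross_def vec_eq_iff forall_3)
    then obtain h s s' where h: "vector [x12, x22, x23] = s *s (h :: complex^3)" "vector [y12, y22, y23] = s' *s h"
      using parallel3 by metis
    have hx: "x12 = s * h$1" "x22 = s * h$2" "x23 = s * h$3"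
      using h(1) by (simp_all add: vec_eq_iff forall_3)
    have hy: "y12 = s' * h$1" "y22 = s' * h$2" "y23 = s' * h$3"
      using h(2) by (simp_all add: vec_eq_iff forall_3)
    have GX: "G ** X = x12 *k outer (G *v u) f2 + x13 *k outer (G *v u) v + x22 *k outer (G *v w) f2 + x23 *k outer (G *v w) v"
      by (subst X) (simp add: matrix_add_ldistrib mscale_simps matrix_mult_outer)
    have GY: "G ** Y = y12 *k outer (G *v u) f2 + y13 *k outer (G *v u) v + y22 *k outer (G *v w) f2 + y23 *k outer (G *v w) v"
      by (subst Y) (simp add: matrix_add_ldistrib mscale_simps matrix_mult_outer)
    have "tensor_matrix p G + tensor_matrix q (G ** X) + tensor_matrix r (G ** Y) =
      tensor_matrix p (outer (G *v u) f1 + outer (G *v w) f2 + outer (G *v z) v) +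
      tensor_matrix (s *s q + s' *s r) (h$1 *k outer (G *v u) f2 + h$2 *k outer (G *v w) f2 + h$3 *k outer (G *v w) v) +
      tensor_matrix (x13 *s q + y13 *s r) (outer (G *v u) v)"
      unfolding GX GY
      by (subst Gmul[OF I]) (simp add: tensor_eq_iff hx hy algebra_simps)
    then show ?thesis using classified_nilpotent_part by metis
  qed
qed

text \<open>\<open>u\<close> and \<open>v\<close> are right and left eigenvectors of both
  \<open>X\<close> and \<open>Y\<close>, with the same eigenvalue on the two sides. Subtracting the
  eigenvalues leads to the case of common kernels; the subtracted multiples of \<open>G\<close> go
  into the first vector.\<close>

lemma classified_commuting:
  fixes X Y G :: "complex^3^3"
  assumes comm: "X ** Y = Y ** X" and X: "\<And>s. X + s *k mat 1 \<noteq> 0"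
  shows "classified (tensor_matrix p G + tensor_matrix q (G ** X) + tensor_matrix r (G ** Y))"
proof -
  have "\<exists>s. det (X + s *k mat 1) = 0"
  proof (rule ccontr)
    assume "\<not> ?thesis"
    then have "det X + s * trace (adj3 X ** mat 1) + s^2 * trace (X ** adj3 (mat 1)) + s^3 * det (mat 1 :: complex^3^3) \<noteq> 0" for s
      by (simp only: det_pencil[symmetric]) blast
    from rootless_cubic_constant(3)[OF this] show False by simp
  qed
  then obtain s where s: "det (X + s *k mat 1) = 0" by blast
  define Z where "Z = X + s *k mat 1"
  have XZ: "X ** Z = Z ** X" and YZ: "Y ** Z = Z ** Y"
    using comm by (simp_all add: Z_def matrix_add_ldistrib matrix_add_rdistrib mscale_simps)
  have "\<exists>u v. u \<noteq> 0 \<and> v \<noteq> 0 \<and> X ** outer u v = outer u v ** X \<and> Y ** outer u v = outer u v ** Y"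
  proof (cases "adj3 Z = 0")
    case True
    then obtain u v where "Z = outer u v" using adj3_eq_0_outer by blast
    then show ?thesis using XZ YZ X[of s] unfolding Z_def[symmetric] by (metis outer_eq_0)
  next
    case False
    have "adj3 (adj3 Z) = 0" using s by (simp add: adj3_adj3 Z_def mscale_simps)
    then obtain u v where "adj3 Z = outer u v" using adj3_eq_0_outer by blast
    then show ?thesis using adj3_commute[OF XZ] adj3_commute[OF YZ] False by (metis outer_eq_0)
  qed
  then obtain u v where uv: "u \<noteq> 0" "v \<noteq> 0" "X ** outer u v = outer u v ** X" "Y ** outer u v = outer u v ** Y"
    by blast
  obtain m n where m: "X *v u = m *s u" "v v* X = m *s v" and n: "Y *v u = n *s u" "v v* Y = n *s v"
    using eigenvectors_of_commuting_outer uv by metis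
  define X' where "X' = X - m *k mat 1"
  define Y' where "Y' = Y - n *k mat 1"
  have sub: "A ** (B - C) = A ** B - A ** C" "(B - C) ** A = B ** A - C ** A" for A B C :: "complex^3^3"
    by (simp_all add: vec_eq_iff matrix_matrix_mult_def algebra_simps sum_subtractf)
  have "X' ** Y' = Y' ** X'"
    using comm by (simp add: X'_def Y'_def sub mscale_simps) (simp add: vec_eq_iff algebra_simps)
  moreover have sc: "(c *k mat 1) *v z = c *s z" "z v* (c *k mat 1) = c *s z" for c and z :: "complex^3"
    by (simp_all add: vec_eq_iff matrix_vector_mult_def vector_matrix_mult_def mat_def if_distrib if_distribR cong: if_cong)
  have vm: "z v* (A - B) = z v* A - z v* B" for z and A B :: "complex^3^3"
    by (simp add: vec_eq_iff vector_matrix_mult_def algebra_simps sum_subtractf)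
  have "X' *v u = 0" "Y' *v u = 0" "v v* X' = 0" "v v* Y' = 0"
    by (simp_all add: X'_def Y'_def m n vm sc matrix_vector_mult_diff_rdistrib)
  ultimately have "classified (tensor_matrix (p + m *s q + n *s r) G + tensor_matrix q (G ** X') + tensor_matrix r (G ** Y'))"
    using classified_commuting_kernel uv(1,2) by blast
  also have "tensor_matrix (p + m *s q + n *s r) G + tensor_matrix q (G ** X') + tensor_matrix r (G ** Y') =
     tensor_matrix p G + tensor_matrix q (G ** X) + tensor_matrix r (G ** Y)"
    by (simp add: X'_def Y'_def sub mscale_simps tensor_eq_iff algebra_simps)
  finally show ?thesis .
qed

lemma classified_invertible_slice:
  fixes t :: "complex^(3 \<times> 3 \<times> 3)"
  assumes nd: "nondegenerate t" and st: "strassen t" and y: "det (slice t y) \<noteq> 0"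
  shows "classified t"
proof -
  define G where "G = slice t y"
  have y0: "y \<noteq> 0" using y by (auto simp: slice_def det_3)
  obtain v where v: "bdot y v = 1" using ex_bdot_1[OF y0] by blast
  obtain y2 y3 where w: "cross y2 y3 = v" using perp_pair by blast
  have tr: "bdot y (cross y2 y3) = 1" using v w by simp
  define f1 where "f1 = cross y2 y3"
  define f2 where "f2 = cross y3 y"
  define f3 where "f3 = cross y y2"
  have I: "mat 1 = outer y f1 + outer y2 f2 + outer y3 f3"
    using resolution_of_identity[OF tr] by (simp add: f1_def f2_def f3_def)
  have t: "t = tensor_matrix f1 G + tensor_matrix f2 (slice t y2) + tensor_matrix f3 (slice t y3)"
  proof -
    have "t $ (i, j, k) = (tensor_matrix f1 G + tensor_matrix f2 (slice t y2) + tensor_matrix f3 (slice t y3)) $ (i, j, k)"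
      for i j k
    proof -
      have "t $ (i, j, k) = (\<Sum>l\<in>UNIV. mat 1 $ l $ i * t $ (l, j, k))"
        by (simp add: mat_def if_distrib if_distribR cong: if_cong)
      also have "\<dots> = (tensor_matrix f1 G + tensor_matrix f2 (slice t y2) + tensor_matrix f3 (slice t y3)) $ (i, j, k)"
        unfolding I by (simp add: G_def sum_3 algebra_simps)
      finally show ?thesis .
    qed
    then show ?thesis unfolding tensor_eq_iff by blast
  qed
  define H where "H = inverse (det G) *k adj3 G"
  have GH: "G ** H = mat 1" using y by (simp add: H_def G_def mscale_simps adj3_right)
  define X where "X = H ** slice t y2"
  define Y where "Y = H ** slice t y3"
  have GX: "slice t y2 = G ** X" and GY: "slice t y3 = G ** Y"
    by (simp_all add: X_def Y_def matrix_mul_assoc GH)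
  have "slice t y2 ** adj3 G ** slice t y3 = slice t y3 ** adj3 G ** slice t y2"
    using st by (simp add: strassen_def G_def)
  then have "X ** Y = Y ** X"
    by (simp add: X_def Y_def H_def mscale_simps) (metis matrix_mul_assoc)
  \<comment> \<open>If \<open>X\<close> were scalar, a nonzero combination of \<open>y2\<close> and
    \<open>y\<close> would have zero slice, against nondegeneracy.\<close>
  moreover have "X + s *k mat 1 \<noteq> 0" for s
  proof
    assume "X + s *k mat 1 = 0"
    then have "G ** (X + s *k mat 1) = 0" by simp
    then have "slice t (y2 + s *s y) = 0"
      by (simp add: slice_add_right slice_scale_right matrix_add_ldistrib mscale_simps flip: GX G_def)
    then have 0: "y2 + s *s y = 0" using nd by (simp add: nondegenerate_def)
    have "bdot (y2 + s *s y) (cross y3 y) = bdot y (cross y2 y3)"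
      by (simp add: bdot_3 cross_def algebra_simps)
    then show False using tr 0 by (simp add: bdot_simps)
  qed
  ultimately show ?thesis by (subst t) (simp add: GX GY classified_commuting)
qed

lemma classified_concise_border3:
  assumes T: "border3 T" "concise T"
  shows "classified T"
proof -
  obtain t :: "complex^(3 \<times> 3 \<times> 3)" and A B C where t: "T = tensor_map A B C t" "border3 t"
    and nd: "nondegenerate t" "nondegenerate (rotate t)" "nondegenerate (rotate (rotate t))"
    using concise_border3_reduce[OF T] by metis
  have st: "strassen t" "strassen (rotate t)" "strassen (rotate (rotate t))"
    using t(2) by (simp_all add: strassen_border3 border3_rotate)
  have "classified t"
    using ex_invertible_slice[OF nd st(1)] classified_invertible_slice nd st by (metis classified_rotate)
  then show ?thesis
    unfolding t(1) classified_def
    using rank_le_tensor_map is_osculating_tensor_map is_any_line_tensor_map by blast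
qed

subsection \<open>The normal forms of rank five\<close>

lemma ex_rank_le: "\<exists>r. rank_le r T" for T :: "complex^('a::finite \<times> 'b::finite \<times> 'c::finite)"
proof -
  let ?f = "\<lambda>p. tensor3 (axis (fst p) (T $ p)) (axis (fst (snd p)) 1) (axis (snd (snd p)) 1)"
  have F: "rank_le (card S) (sum ?f S)" if "finite S" for S
    using that
  proof induction
    case (insert p S)
    then have "rank_le (Suc (card S)) (sum ?f S + ?f p)" by (intro rank_le_plus_tensor3)
    then show ?case using insert by (simp add: add.commute)
  qed (simp add: rank_le_0)
  moreover have "T = (\<Sum>p\<in>UNIV. tensor3 (axis (fst p) (T $ p)) (axis (fst (snd p)) 1) (axis (snd (snd p)) 1))"
  proof -
    have "(\<Sum>p\<in>UNIV. tensor3 (axis (fst p) (T $ p)) (axis (fst (snd p)) 1) (axis (snd (snd p)) 1)) $ (i, j, k)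
      = (\<Sum>p\<in>UNIV. if p = (i, j, k) then T $ p else 0)" for i j k
      unfolding sum_component by (rule sum.cong) (auto simp: axis_def)
    then show ?thesis by (simp add: tensor_eq_iff del: sum_component)
  qed
  moreover have "rank_le (card (UNIV :: ('a \<times> 'b \<times> 'c) set)) (sum ?f UNIV)" by (rule F) simp
  ultimately show ?thesis by metis
qed

lemma tensor_rank_le_iff: "tensor_rank T \<le> n \<longleftrightarrow> rank_le n T"
proof -
  have eq: "tensor_rank T = (LEAST r. rank_le r T)" by (simp add: tensor_rank_def rank_le_def)
  have "rank_le (tensor_rank T) T" unfolding eq using ex_rank_le by (rule LeastI_ex)
  then show ?thesis using rank_le_mono Least_le[of "\<lambda>r. rank_le r T" n] unfolding eq by auto
qed

lemma not_rank_le_4: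
  fixes t :: "complex^(3 \<times> 3 \<times> 3)"
  assumes nd: "nondegenerate t" and sing: "\<And>x w. w \<noteq> 0 \<Longrightarrow> slice t x *v w = 0 \<Longrightarrow> x $ 1 = 0"
  shows "\<not> rank_le 4 t"
proof
  assume "rank_le 4 t"
  then obtain a b c where t: "t = (\<Sum>i<4::nat. tensor3 (a i) (b i) (c i))" using rank_le_def by blast
  have sl: "slice t x = (\<Sum>i<4::nat. bdot x (a i) *k outer (b i) (c i))" for x
    by (simp add: t slice_sum slice_tensor3)
  have minor: "cross (a i) (a j) $ 1 = 0" if ij: "i < 4" "j < 4" for i j
  proof (cases "i = j")
    case True
    then show ?thesis by (simp add: cross_def)
  next
    case False
    \<comment> \<open>At \<open>cross (a i) (a j)\<close> the summands \<open>i\<close> and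
      \<open>j\<close> drop out, and the slice kills every \<open>w\<close> orthogonal to the two
      remaining vectors \<open>c k\<close> and \<open>c l\<close>.\<close>
    then have "card ({..<4} - {i, j}) = 2" using ij by (simp add: card_Diff_subset)
    then obtain k l where kl: "{..<4} - {i, j} = {k, l}" by (auto simp: card_2_iff)
    define M :: "complex^3^3" where "M = vector [c k, c l, 0]"
    have "det M = 0" by (simp add: M_def det_3)
    then obtain w where w: "w \<noteq> 0" "M *v w = 0" using ex_kernel_vector by blast
    have cw: "bdot (c k) w = 0" "bdot (c l) w = 0"
      using w(2) by (simp_all add: M_def vec_eq_iff forall_3 matrix_vector_mult_def sum_3 bdot_3)
    let ?x = "cross (a i) (a j)"
    have "(bdot ?x (a m) *k outer (b m) (c m)) *v w = 0" if "m < 4" for m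
    proof -
      have "m = i \<or> m = j \<or> m \<in> {..<4} - {i, j}" using that by auto
      then consider "m = i \<or> m = j" | "m = k \<or> m = l" unfolding kl by blast
      then show ?thesis
      proof cases
        case 1
        then show ?thesis by (auto simp: mscale_simps)
      next
        case 2
        then have "bdot (c m) w = 0" using cw by auto
        then show ?thesis by (simp add: outer_vector_mult flip: outer_scale_left)
      qed
    qed
    then have "slice t ?x *v w = 0"
      unfolding sl by (simp add: eval_nat_numeral matrix_vector_mult_add_rdistrib)
    then show ?thesis using sing w(1) by blast
  qed
  \<comment> \<open>The projections of the \<open>a i\<close> to the last two coordinates are
    pairwise parallel, so one nonzero vector with first coordinate 0 is orthogonal to all of
    them.\<close>
  have "\<exists>x. x \<noteq> 0 \<and> (\<forall>i<4. bdot x (a i) = 0)"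
  proof (cases "\<exists>i<4. a i $ 2 \<noteq> 0 \<or> a i $ 3 \<noteq> 0")
    case False
    then have "\<forall>i<4. bdot (axis 2 1) (a i) = 0" by (simp add: bdot_commute[of "axis 2 1"])
    then show ?thesis by (intro exI[of _ "axis 2 1"]) (simp add: axis_eq_0_iff)
  next
    case True
    then obtain i where i: "i < 4" "a i $ 2 \<noteq> 0 \<or> a i $ 3 \<noteq> 0" by blast
    define x :: "complex^3" where "x = vector [0, - a i $ 3, a i $ 2]"
    have "x \<noteq> 0" using i by (auto simp: x_def vec_eq_iff forall_3)
    moreover have "bdot x (a j) = 0" if "j < 4" for j
      using minor[OF i(1) that] by (simp add: x_def bdot_3 cross_def)
    ultimately show ?thesis by blast
  qed
  then obtain x where x: "x \<noteq> 0" "\<forall>i<4. bdot x (a i) = 0" by blast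
  then have "slice t x = 0" by (simp add: sl mscale_simps)
  with x(1) nd show False by (simp add: nondegenerate_def)
qed

section \<open>Equivalence of the concise forms with the forms of the unit frames\<close>

definition unit_frame :: "3 \<Rightarrow> complex^3" where
  "unit_frame i = axis i 1"

lemmas unit_simps = unit_frame_def axis_def vec_eq_iff forall_3 sum_3 matrix_vector_mult_def

lemma nondegenerate_unit_osculating:
  "nondegenerate (osculating_form unit_frame unit_frame unit_frame)"
  by (auto simp: nondegenerate_def osculating_form_def unit_simps)

lemma nondegenerate_unit_line:
  "nondegenerate (line_form unit_frame unit_frame unit_frame)"
  "nondegenerate (rotate (line_form unit_frame unit_frame unit_frame))"
  "nondegenerate (rotate (rotate (line_form unit_frame unit_frame unit_frame)))"
  by (auto simp: nondegenerate_def line_form_def unit_simps)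

text \<open>The slice at \<open>x\<close> is triangular about the antidiagonal, all of whose entries
  are \<open>x $ 1\<close>.\<close>

lemma not_rank_le_4_unit_osculating: "\<not> rank_le 4 (osculating_form unit_frame unit_frame unit_frame)"
proof (rule not_rank_le_4[OF nondegenerate_unit_osculating])
  fix x w :: "complex^3"
  assume "w \<noteq> 0" "slice (osculating_form unit_frame unit_frame unit_frame) x *v w = 0"
  then show "x $ 1 = 0" by (auto simp: osculating_form_def unit_simps)
qed

text \<open>In the first direction all slices are singular, so the second is used: there the
  determinant of the slice at \<open>x\<close> is the cube of \<open>x $ 1\<close>.\<close>

lemma not_rank_le_4_unit_line: "\<not> rank_le 4 (line_form unit_frame unit_frame unit_frame)"
proof -
  have "\<not> rank_le 4 (rotate (line_form unit_frame unit_frame unit_frame))"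
  proof (rule not_rank_le_4[OF nondegenerate_unit_line(2)])
    fix x w :: "complex^3"
    assume "w \<noteq> 0" "slice (rotate (line_form unit_frame unit_frame unit_frame)) x *v w = 0"
    then show "x $ 1 = 0" by (auto simp: line_form_def unit_simps)
  qed
  then show ?thesis by simp
qed

text \<open>Independence of an indexed triple, witnessed by a left inverse that can be fed directly
  into \<open>tensor_map\<close>.\<close>

definition independent3 :: "(3 \<Rightarrow> complex^'n::finite) \<Rightarrow> bool" where
  "independent3 a \<longleftrightarrow> (\<exists>Q::complex^'n^3. \<forall>m. Q *v a m = axis m 1)"

lemma independent3_of_span:
  fixes a :: "3 \<Rightarrow> complex^'n::finite"
  assumes "3 \<le> vec.dim S" "S \<subseteq> vec.span (range a)"
  shows "independent3 a"
proof -
  have "vec.dim S \<le> vec.dim (range a)" by (rule vec.dim_mono[OF assms(2)])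
  moreover have "card (range a) \<le> 3" using card_image_le[of "UNIV :: 3 set" a] by simp
  ultimately have "vec.independent (range a)"
    using assms(1) by (intro vec.card_le_dim_spanning[of _ "range a"]) (auto intro: vec.span_base)
  moreover have "card (range a) = CARD(3)"
    using \<open>card (range a) \<le> 3\<close> \<open>vec.dim S \<le> _\<close> assms(1) vec.dim_le_card'[of "range a"] by simp
  then have "inj a" by (intro eq_card_imp_inj_on) auto
  ultimately show ?thesis unfolding independent3_def by (rule independent_dual_matrix)
qed

lemma fibers_subsetI: "(\<And>j k. fiber T j k \<in> S) \<Longrightarrow> fibers T \<subseteq> S"
  by (auto simp: fibers_def)

text \<open>The fibers in each direction lie in the span of the corresponding frame, so multilinear
  rank three forces that frame to be independent.\<close>

lemma concise_osculating_independent: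
  assumes "concise (osculating_form a b c)"
  shows "independent3 a" "independent3 b" "independent3 c"
proof -
  have sub: "fibers (osculating_form a b c) \<subseteq> vec.span (range a)"
    for a :: "3 \<Rightarrow> complex^'x::finite" and b :: "3 \<Rightarrow> complex^'y::finite" and c :: "3 \<Rightarrow> complex^'z::finite"
  proof (clarsimp simp: fibers_def)
    fix j k
    have "fiber (osculating_form a b c) j k = (b 1 $ j * c 3 $ k + b 2 $ j * c 2 $ k + b 3 $ j * c 1 $ k) *s a 1
       + (b 1 $ j * c 2 $ k + b 2 $ j * c 1 $ k) *s a 2 + (b 1 $ j * c 1 $ k) *s a 3"
      by (simp add: vec_eq_iff osculating_form_def algebra_simps)
    then show "fiber (osculating_form a b c) j k \<in> vec.span (range a)"
      by (simp add: vec.span_add vec.span_scale vec.span_base)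
  qed
  have "concise (osculating_form b c a)" "concise (osculating_form c a b)"
    using assms rotate_osculating_form[of a b c] rotate_osculating_form[of b c a] concise_rotate by metis+
  then show "independent3 a" "independent3 b" "independent3 c"
    using assms sub independent3_of_span unfolding concise_def by metis+
qed

lemma concise_line_independent:
  assumes "concise (line_form a b c)"
  shows "independent3 a" "independent3 b" "independent3 c"
proof -
  have "fiber (line_form a b c) j k = (b 2 $ j * c 1 $ k + b 1 $ j * c 2 $ k) *s a 1
       + (b 3 $ j * c 1 $ k + b 1 $ j * c 3 $ k) *s a 2 + (b 1 $ j * c 1 $ k) *s a 3" for j k
    by (simp add: vec_eq_iff line_form_def algebra_simps)
  then have a: "fibers (line_form a b c) \<subseteq> vec.span (range a)"
    by (intro fibers_subsetI) (simp only:, intro vec.span_add vec.span_scale vec.span_base rangeI)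
  have "fiber (rotate (line_form a b c)) k i = (a 1 $ i * c 1 $ k) *s b 2 + (a 2 $ i * c 1 $ k) *s b 3
       + (a 1 $ i * c 2 $ k + a 2 $ i * c 3 $ k + a 3 $ i * c 1 $ k) *s b 1" for k i
    by (simp add: vec_eq_iff line_form_def algebra_simps)
  then have b: "fibers (rotate (line_form a b c)) \<subseteq> vec.span (range b)"
    by (intro fibers_subsetI) (simp only:, intro vec.span_add vec.span_scale vec.span_base rangeI)
  have "fiber (rotate (rotate (line_form a b c))) i j = (a 1 $ i * b 1 $ j) *s c 2 + (a 2 $ i * b 1 $ j) *s c 3
       + (a 1 $ i * b 2 $ j + a 2 $ i * b 3 $ j + a 3 $ i * b 1 $ j) *s c 1" for i j
    by (simp add: vec_eq_iff line_form_def algebra_simps)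
  then have c: "fibers (rotate (rotate (line_form a b c))) \<subseteq> vec.span (range c)"
    by (intro fibers_subsetI) (simp only:, intro vec.span_add vec.span_scale vec.span_base rangeI)
  show "independent3 a" "independent3 b" "independent3 c"
    using assms a b c independent3_of_span unfolding concise_def by blast+
qed

lemma osculating_form_unit:
  assumes "independent3 a" "independent3 b" "independent3 c"
  shows "\<exists>A B C. tensor_map A B C (osculating_form a b c) = osculating_form unit_frame unit_frame unit_frame"
proof -
  obtain A :: "complex^'a^3" and B :: "complex^'b^3" and C :: "complex^'c^3"
    where "\<forall>m. A *v a m = axis m 1" "\<forall>m. B *v b m = axis m 1" "\<forall>m. C *v c m = axis m 1"
    using assms unfolding independent3_def by blast
  then show ?thesis
    by (intro exI[of _ A] exI[of _ B] exI[of _ C]) (simp add: tensor_map_osculating_form flip: unit_frame_def)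
qed

lemma line_form_unit:
  assumes "independent3 a" "independent3 b" "independent3 c"
  shows "\<exists>A B C. tensor_map A B C (line_form a b c) = line_form unit_frame unit_frame unit_frame"
proof -
  obtain A :: "complex^'a^3" and B :: "complex^'b^3" and C :: "complex^'c^3"
    where "\<forall>m. A *v a m = axis m 1" "\<forall>m. B *v b m = axis m 1" "\<forall>m. C *v c m = axis m 1"
    using assms unfolding independent3_def by blast
  then show ?thesis
    by (intro exI[of _ A] exI[of _ B] exI[of _ C]) (simp add: tensor_map_line_form flip: unit_frame_def)
qed

lemma tensor_rank_eq_5I: "rank_le 5 T \<Longrightarrow> \<not> rank_le 4 T \<Longrightarrow> tensor_rank T = 5"
  using tensor_rank_le_iff[of T 5] tensor_rank_le_iff[of T 4] by simp

lemma rank_concise_osculating: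
  assumes "concise T" "is_osculating T"
  shows "tensor_rank T = 5"
proof -
  obtain a b c where T: "T = osculating_form a b c" using assms is_osculating_def by blast
  obtain A B C where "tensor_map A B C T = osculating_form unit_frame unit_frame unit_frame"
    using osculating_form_unit[OF concise_osculating_independent] assms(1) unfolding T by blast
  then have "\<not> rank_le 4 T"
    using rank_le_tensor_map[of 4 T A B C] not_rank_le_4_unit_osculating by auto
  then show ?thesis unfolding T by (intro tensor_rank_eq_5I rank_le_5_osculating_form)
qed

lemma not_rank_le_4_line_form:
  assumes "concise (line_form a b c)"
  shows "\<not> rank_le 4 (line_form a b c)"
proof -
  obtain A B C where "tensor_map A B C (line_form a b c) = line_form unit_frame unit_frame unit_frame"
    using line_form_unit[OF concise_line_independent[OF assms]] by blast
  then show ?thesis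
    using rank_le_tensor_map[of 4 "line_form a b c" A B C] not_rank_le_4_unit_line by auto
qed

lemma rank_concise_any_line:
  assumes "concise T" "is_any_line T"
  shows "tensor_rank T = 5"
  using assms unfolding is_any_line_iff
  by (elim disjE exE) (auto intro!: tensor_rank_eq_5I simp: not_rank_le_4_line_form rank_le_5_line_form)

lemma dim_fibers_nondegenerate:
  fixes t :: "complex^(3 \<times> 'b::finite \<times> 'c::finite)"
  assumes "nondegenerate t"
  shows "3 \<le> vec.dim (fibers t)"
proof (rule ccontr)
  assume "\<not> ?thesis"
  then have "vec.dim (fibers t) \<le> CARD(2)" by simp
  then obtain P :: "complex^2^3" and Q where PQ: "map_first P (map_first Q t) = t"
    using reduce_first by blast
  \<comment> \<open>The two columns of \<open>P\<close> as rows, completed by a zero row: a kernel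
    vector annihilates the image of \<open>P\<close>, which contains all fibers.\<close>
  define M :: "complex^3^3" where "M = vector [\<chi> i. P $ i $ 1, \<chi> i. P $ i $ 2, 0]"
  have "det M = 0" by (simp add: M_def det_3)
  then obtain w where w: "w \<noteq> 0" "M *v w = 0" using ex_kernel_vector by blast
  have "bdot w (P *v y) = y $ 1 * (M *v w) $ 1 + y $ 2 * (M *v w) $ 2" for y
    by (simp add: bdot_3 matrix_vector_mult_def sum_2 sum_3 M_def algebra_simps)
  then have "bdot w (P *v y) = 0" for y using w by simp
  then have "bdot w v = 0" if "v \<in> fibers t" for v
    using that PQ fiber_map_first[of P "map_first Q t"] by (auto simp: fibers_def)
  then have "slice t w = 0" by (simp add: slice_eq_0_iff)
  then show False using assms w(1) by (simp add: nondegenerate_def)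
qed

lemma tensor_map_sum: "tensor_map A B C (sum f S) = (\<Sum>i\<in>S. tensor_map A B C (f i))"
  by (simp add: tensor_map_def map_first_sum rotate_sum)

text \<open>Both sides are linear in \<open>T\<close>, and every tensor is a finite sum of
  decomposable ones.\<close>

lemma rotate_tensor_map: "rotate (tensor_map A B C T) = tensor_map B C A (rotate T)"
proof -
  obtain r a b c where "T = (\<Sum>i<(r::nat). tensor3 (a i) (b i) (c i))"
    using ex_rank_le[of T] unfolding rank_le_def by blast
  then show ?thesis by (simp add: tensor_map_sum rotate_sum)
qed

lemma dim_fibers_map_first_le: "vec.dim (fibers (map_first M T)) \<le> vec.dim (fibers T)"
proof -
  have "fibers (map_first M T) = (*v) M ` fibers T"
    by (force simp: fibers_def fiber_map_first)
  then show ?thesis by (metis vec.dim_image_le matrix_vector_mul_linear_gen)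
qed

lemma dim_fibers_tensor_map_le: "vec.dim (fibers (tensor_map A B C T)) \<le> vec.dim (fibers T)"
proof -
  define U where "U = map_first C (rotate (rotate T))"
  have "vec.dim (fibers (tensor_map A B C T)) \<le> vec.dim (fibers (rotate (rotate (map_first B (rotate (rotate U))))))"
    unfolding tensor_map_def U_def by (rule dim_fibers_map_first_le)
  also have "\<dots> \<le> vec.dim (fibers (rotate (rotate (rotate (rotate U)))))"
    by (rule dim_fibers_rotate_rotate_map_first_le)
  also have "\<dots> = vec.dim (fibers (rotate U))" by simp
  also have "\<dots> \<le> vec.dim (fibers (rotate (rotate (rotate T))))"
    unfolding U_def by (rule dim_fibers_rotate_map_first_le)
  finally show ?thesis by simp
qed

lemma concise_of_tensor_map:
  fixes A :: "complex^'a::finite^3" and B :: "complex^'b::finite^3" and C :: "complex^'c::finite^3"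
  assumes "nondegenerate (tensor_map A B C T)" "nondegenerate (rotate (tensor_map A B C T))"
    "nondegenerate (rotate (rotate (tensor_map A B C T)))"
  shows "concise T"
  using assms[THEN dim_fibers_nondegenerate] dim_fibers_tensor_map_le
  unfolding concise_def rotate_tensor_map by (meson order_trans)

lemma concise_osculating_form:
  assumes "independent3 a" "independent3 b" "independent3 c"
  shows "concise (osculating_form a b c)"
proof -
  obtain A B C where "tensor_map A B C (osculating_form a b c) = osculating_form unit_frame unit_frame unit_frame"
    using osculating_form_unit[OF assms] by blast
  then show ?thesis
    using concise_of_tensor_map[of A B C "osculating_form a b c"]
    by (simp add: rotate_osculating_form nondegenerate_unit_osculating)
qed

lemma concise_line_form:
  assumes "independent3 a" "independent3 b" "independent3 c"
  shows "concise (line_form a b c)"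
proof -
  obtain A B C where "tensor_map A B C (line_form a b c) = line_form unit_frame unit_frame unit_frame"
    using line_form_unit[OF assms] by blast
  then show ?thesis
    using concise_of_tensor_map[of A B C "line_form a b c"] by (simp add: nondegenerate_unit_line)
qed

subsection \<open>Points of the Segre variety and of its third secant variety\<close>

lemma pt_eq_range: "pt v = range (\<lambda>k. k *s v)"
  by (simp add: pt_def vec.span_singleton)

lemma pt_eqD: "pt v = pt w \<Longrightarrow> \<exists>k. v = k *s w"
  using vec.span_base[of v "{v}"] unfolding pt_eq_range[symmetric] pt_def[symmetric]
  by (auto simp: pt_eq_range pt_def)

lemma pt_eq_0 [simp]: "pt v = pt 0 \<longleftrightarrow> v = 0"
  using pt_eqD[of v 0] by auto

lemma tensor3_eq_0: "tensor3 a b c = 0 \<longleftrightarrow> a = 0 \<or> b = 0 \<or> c = 0"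
  by (auto simp: tensor_eq_iff vec_eq_iff)

lemma tensor3_scale: "k *s tensor3 a b c = tensor3 (k *s a) b c"
  by (simp add: tensor_eq_iff)

lemma pt_in_segre_iff:
  assumes "v \<noteq> 0"
  shows "pt v \<in> segre \<longleftrightarrow> (\<exists>a b c. v = tensor3 a b c)"
proof
  assume "pt v \<in> segre"
  then obtain a b c where "pt v = pt (tensor3 a b c)" by (auto simp: segre_def)
  then obtain k where "v = k *s tensor3 a b c" using pt_eqD by blast
  then show "\<exists>a b c. v = tensor3 a b c" by (auto simp: tensor3_scale)
next
  assume "\<exists>a b c. v = tensor3 a b c"
  then obtain a b c where "v = tensor3 a b c" by blast
  moreover then have "a \<noteq> 0" "b \<noteq> 0" "c \<noteq> 0" using assms by (auto simp: tensor3_eq_0)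
  ultimately show "pt v \<in> segre" unfolding segre_def by blast
qed

lemma affine_cone_segre: "affine_cone segre = {v. \<exists>a b c. v = tensor3 a b c}"
proof -
  have "v \<in> affine_cone segre \<longleftrightarrow> (\<exists>a b c. v = tensor3 a b c)" for v :: "complex^('a::finite \<times> 'b::finite \<times> 'c::finite)"
  proof (cases "v = 0")
    case True
    then show ?thesis by (auto simp: affine_cone_def intro!: exI[of _ 0])
  next
    case False
    then show ?thesis by (simp add: affine_cone_def pt_in_segre_iff)
  qed
  then show ?thesis by blast
qed

lemma curve_in_eventually:
  assumes "curve_in y M"
  shows "\<forall>\<^sub>F t in at 0. y t \<in> M"
proof -
  obtain r where "r > 0" "\<forall>t\<in>ball 0 r. y t \<in> M" using assms unfolding curve_in_def by blast
  then show ?thesis by (auto simp: eventually_at intro!: exI[of _ r])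
qed

lemma span3: "v \<in> vec.span {x, y, z} \<longleftrightarrow> (\<exists>a b c. v = a *s x + b *s y + c *s z)"
proof -
  have "v \<in> vec.span {x, y, z} \<longleftrightarrow> (\<exists>a b c. v - a *s x - b *s y = c *s z)"
    by (simp add: vec.span_breakdown_eq vec.span_singleton image_iff)
  also have "\<dots> \<longleftrightarrow> (\<exists>a b c. v = a *s x + b *s y + c *s z)"
    by (simp add: algebra_simps)
  finally show ?thesis .
qed

lemma sigma3_nonzero: "pt T \<in> sigma3 X \<Longrightarrow> T \<noteq> 0"
  by (auto simp: sigma3_def projectivization_def pt_eq_0[symmetric] simp del: pt_eq_0)

lemma tendsto_smult_vec:
  fixes f :: "'x \<Rightarrow> complex"
  assumes "(f \<longlongrightarrow> k) F" "(g \<longlongrightarrow> v) F"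
  shows "((\<lambda>x. f x *s g x) \<longlongrightarrow> k *s v) F"
  by (intro vec_tendstoI) (simp add: tendsto_mult tendsto_vec_nth assms)

text \<open>\<open>T\<close> is a combination of the limit frame. The same combination of the moving
  frame tends to \<open>T\<close> and lies in the span of three points of the Segre variety.\<close>

lemma sigma3_border3:
  assumes "pt T \<in> sigma3 segre"
  shows "border3 T"
proof -
  let ?X = "{v. v \<noteq> 0 \<and> pt v \<in> segre}"
  obtain x1 x2 x3 E where x: "curve_in x1 ?X" "curve_in x2 ?X" "curve_in x3 ?X"
    and pl: "plane_tendsto (\<lambda>t. vec.span {x1 t, x2 t, x3 t}) E (at 0)" and E: "pt T \<subseteq> E"
    using assms unfolding sigma3_def by blast
  obtain e1 e2 e3 l1 l2 l3 where
    ev: "\<forall>\<^sub>F t in at 0. vec.dim (vec.span {x1 t, x2 t, x3 t}) = 3 \<and> vec.span {x1 t, x2 t, x3 t} = vec.span {e1 t, e2 t, e3 t}"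
    and lim: "(e1 \<longlongrightarrow> l1) (at 0)" "(e2 \<longlongrightarrow> l2) (at 0)" "(e3 \<longlongrightarrow> l3) (at 0)" and El: "E = vec.span {l1, l2, l3}"
    using pl unfolding plane_tendsto_def by blast
  have "T \<in> vec.span {l1, l2, l3}" using E El vec.span_base[of T "{T}"] by (auto simp: pt_def)
  then obtain a b c where T: "T = a *s l1 + b *s l2 + c *s l3" unfolding span3 by blast
  define S where "S t = a *s e1 t + b *s e2 t + c *s e3 t" for t
  have "(S \<longlongrightarrow> T) (at 0)"
    unfolding T S_def[abs_def] by (intro tendsto_add tendsto_smult_vec tendsto_const lim)
  moreover have "\<forall>\<^sub>F t in at 0. rank_le 3 (S t)"
    using ev x[THEN curve_in_eventually]
  proof eventually_elim
    case (elim t)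
    have "S t \<in> vec.span {e1 t, e2 t, e3 t}" unfolding span3 S_def by blast
    then have "S t \<in> vec.span {x1 t, x2 t, x3 t}" using elim(1) by simp
    then obtain p q r where S: "S t = p *s x1 t + q *s x2 t + r *s x3 t" unfolding span3 by blast
    obtain a1 b1 c1 a2 b2 c2 a3 b3 c3 where "x1 t = tensor3 a1 b1 c1" "x2 t = tensor3 a2 b2 c2" "x3 t = tensor3 a3 b3 c3"
      using elim(2-4) by (auto simp: pt_in_segre_iff)
    then have "S t = tensor3 (p *s a1) b1 c1 + tensor3 (q *s a2) b2 c2 + tensor3 (r *s a3) b3 c3"
      by (simp add: S tensor3_scale)
    moreover have "rank_le (Suc (Suc (Suc 0))) \<dots>" by (intro rank_le_plus_tensor3 rank_le_tensor3)
    ultimately show ?case by (simp add: numeral_3_eq_3)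
  qed
  ultimately show ?thesis unfolding border3_def by blast
qed

section \<open>Points of the secant variety from convergent frames\<close>

lemma matrix_left_inverse_independent3:
  fixes l :: "3 \<Rightarrow> complex^'n::finite"
  assumes "\<And>k1 k2 k3. k1 *s l 1 + k2 *s l 2 + k3 *s l 3 = 0 \<Longrightarrow> k1 = 0 \<and> k2 = 0 \<and> k3 = 0"
  shows "independent3 l"
proof -
  define M :: "complex^3^'n" where "M = (\<chi> r m. l m $ r)"
  have M: "M *v k = k$1 *s l 1 + k$2 *s l 2 + k$3 *s l 3" for k
    by (simp add: M_def vec_eq_iff matrix_vector_mult_def sum_3 mult_ac)
  have "x = 0" if "M *v x = 0" for x
    using assms[of "x$1" "x$2" "x$3"] that by (simp add: M vec_eq_iff forall_3)
  then obtain Q where Q: "Q ** M = mat 1" using matrix_left_invertible_ker[of M] by blast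
  have "M *v axis m 1 = l m" for m by (simp add: vec_eq_iff matrix_mult_axis) (simp add: M_def)
  then have "Q *v l m = axis m 1" for m
    by (metis Q matrix_vector_mul_assoc matrix_vector_mul_lid)
  then show ?thesis unfolding independent3_def by blast
qed

lemma independent3D:
  assumes "independent3 l" "k1 *s l 1 + k2 *s l 2 + k3 *s l 3 = 0"
  shows "k1 = 0" "k2 = 0" "k3 = 0"
proof -
  obtain Q :: "complex^'a^3" where Q: "\<forall>m. Q *v l m = axis m 1" using assms(1) independent3_def by blast
  have "Q *v (k1 *s l 1 + k2 *s l 2 + k3 *s l 3) = 0" by (simp add: assms(2))
  then have "k1 *s axis 1 1 + k2 *s axis 2 1 + k3 *s axis 3 1 = (0 :: complex^3)"
    by (simp add: Q matrix_vector_right_distrib vec.scale)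
  then show "k1 = 0" "k2 = 0" "k3 = 0" by (simp_all add: vec_eq_iff forall_3 axis_def)
qed

lemma independent3_insert:
  assumes "independent3 l"
  shows "vec.dim (vec.span {l 1, l 2, l 3}) = 3"
proof -
  obtain Q :: "complex^'a^3" where Q: "\<forall>m. Q *v l m = axis m 1" using assms(1) independent3_def by blast
  have "UNIV = {1, 2, 3 :: 3}" using exhaust_3 by auto
  then have "cart_basis = (\<lambda>i. axis i 1) ` {1, 2, 3 :: 3}" unfolding cart_basis_def by auto
  then have "cart_basis = ((*v) Q ` {l 1, l 2, l 3} :: (complex^3) set)" by (simp add: Q)
  then have "vec.dim (cart_basis :: (complex^3) set) \<le> vec.dim {l 1, l 2, l 3}"
    by (metis vec.dim_image_le matrix_vector_mul_linear_gen)
  moreover have "vec.dim (cart_basis :: (complex^3) set) = 3"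
    using vec.dim_eq_card_independent[of "cart_basis :: (complex^3) set"]
    by (simp add: independent_cart_basis card_cart_basis)
  moreover have "vec.dim {l 1, l 2, l 3} \<le> card {l 1, l 2, l 3}" by (intro vec.dim_le_card') auto
  moreover have "card {l 1, l 2, l 3} \<le> 3" by (simp add: card_insert_if)
  ultimately show ?thesis by (simp add: vec.dim_span)
qed

text \<open>After applying the left inverse of the limit frame, the moving frame becomes a square
  matrix tending to the identity, so its determinant is eventually nonzero.\<close>

lemma eventually_independent3:
  fixes l :: "3 \<Rightarrow> complex^'n::finite"
  assumes "independent3 l" "\<And>m. (e m \<longlongrightarrow> l m) F"
  shows "\<forall>\<^sub>F t in F. independent3 (\<lambda>m. e m t)"
proof -
  obtain Q :: "complex^'n^3" where Q: "\<forall>m. Q *v l m = axis m 1" using assms(1) independent3_def by blast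
  define G where "G t = (\<chi> m n. (Q *v e n t) $ m :: complex^3^3)" for t
  have "((\<lambda>t. det (G t)) \<longlongrightarrow> det (mat 1 :: complex^3^3)) F"
  proof (rule tendsto_det)
    fix i j
    have "((\<lambda>t. G t $ i $ j) \<longlongrightarrow> (Q *v l j) $ i) F"
      by (simp add: G_def matrix_vector_mult_def tendsto_sum tendsto_mult tendsto_vec_nth[OF assms(2)])
    then show "((\<lambda>t. G t $ i $ j) \<longlongrightarrow> mat 1 $ i $ j) F" by (simp add: Q mat_def axis_def)
  qed
  then have "\<forall>\<^sub>F t in F. det (G t) \<noteq> 0" by (rule tendsto_imp_eventually_ne) simp
  then show ?thesis
  proof eventually_elim
    case (elim t)
    then obtain B where B: "B ** G t = mat 1" using invertible_det_nz invertible_left_inverse by blast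
    have "G t *v axis m 1 = Q *v e m t" for m by (simp add: vec_eq_iff matrix_mult_axis G_def)
    then have "(B ** Q) *v e m t = axis m 1" for m
      by (metis B matrix_vector_mul_assoc matrix_vector_mul_lid)
    then show ?case unfolding independent3_def by blast
  qed
qed

lemma pt_in_sigma3I:
  fixes l :: "3 \<Rightarrow> complex^'n::finite"
  assumes x: "curve_in x1 {v. v \<noteq> 0 \<and> pt v \<in> X}" "curve_in x2 {v. v \<noteq> 0 \<and> pt v \<in> X}"
      "curve_in x3 {v. v \<noteq> 0 \<and> pt v \<in> X}"
    and ind: "independent3 l" and lim: "\<And>m. (e m \<longlongrightarrow> l m) (at 0)"
    and sp: "\<forall>\<^sub>F t in at 0. vec.span {x1 t, x2 t, x3 t} = vec.span {e 1 t, e 2 t, e 3 t}"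
  shows "pt (l 3) \<in> sigma3 X"
proof -
  let ?E = "vec.span {l 1, l 2, l 3}"
  have "l 3 \<noteq> 0" using independent3D(3)[OF ind, of 0 0 1] by auto
  moreover have "\<forall>\<^sub>F t in at 0. vec.dim (vec.span {x1 t, x2 t, x3 t}) = 3 \<and>
      vec.span {x1 t, x2 t, x3 t} = vec.span {e 1 t, e 2 t, e 3 t}"
    using sp eventually_independent3[OF ind lim]
  proof eventually_elim
    case (elim t)
    show ?case using independent3_insert[OF elim(2)] by (simp only: elim(1))
  qed
  then have "plane_tendsto (\<lambda>t. vec.span {x1 t, x2 t, x3 t}) ?E (at 0)"
    unfolding plane_tendsto_def using independent3_insert[OF ind] lim by blast
  moreover have "pt (l 3) \<subseteq> ?E" unfolding pt_def by (intro vec.span_mono) auto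
  ultimately show ?thesis unfolding sigma3_def projectivization_def using x by blast
qed

lemma tendsto_tensor3:
  assumes "(A \<longlongrightarrow> a) F" "(B \<longlongrightarrow> b) F" "(C \<longlongrightarrow> c) F"
  shows "((\<lambda>t. tensor3 (A t) (B t) (C t)) \<longlongrightarrow> tensor3 a b c) F"
proof (rule vec_tendstoI)
  show "((\<lambda>t. tensor3 (A t) (B t) (C t) $ p) \<longlongrightarrow> tensor3 a b c $ p) F" for p
    by (cases p) (simp add: tendsto_mult tendsto_vec_nth assms)
qed

lemma curve_in_tensor3:
  assumes "\<And>i. (\<lambda>t. A t $ i) holomorphic_on UNIV" "\<And>i. (\<lambda>t. B t $ i) holomorphic_on UNIV"
    "\<And>i. (\<lambda>t. C t $ i) holomorphic_on UNIV"
    and "\<And>t. tensor3 (A t) (B t) (C t) \<in> M"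
  shows "curve_in (\<lambda>t. tensor3 (A t) (B t) (C t)) M"
proof -
  have "(\<lambda>t. tensor3 (A t) (B t) (C t) $ p) holomorphic_on ball 0 1" for p
    by (cases p) (auto intro!: holomorphic_on_mult holomorphic_on_subset[OF assms(1)]
        holomorphic_on_subset[OF assms(2)] holomorphic_on_subset[OF assms(3)])
  then show ?thesis unfolding curve_in_def using assms(4) by (intro exI[of _ 1]) auto
qed

lemma pt_tensor3_in_segre: "a \<noteq> 0 \<Longrightarrow> b \<noteq> 0 \<Longrightarrow> c \<noteq> 0 \<Longrightarrow> tensor3 a b c \<in> {v. v \<noteq> 0 \<and> pt v \<in> segre}"
  using pt_in_segre_iff[of "tensor3 a b c"] by (auto simp: tensor3_eq_0)

lemma map_first_scale: "map_first M (k *s T) = k *s map_first M T"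
  by (simp add: tensor_eq_iff sum_distrib_left mult_ac)

lemma rotate_scale: "rotate (k *s T) = k *s rotate T"
  by (simp add: tensor_eq_iff)

lemma tensor_map_scale: "tensor_map A B C (k *s T) = k *s tensor_map A B C T"
  by (simp add: tensor_map_def map_first_scale rotate_scale)

text \<open>Once the frames are moved to unit frames, the coordinates \<open>(1,1,1)\<close>,
  \<open>(2,1,1)\<close>, \<open>(3,1,1)\<close> alone separate the three tensors
  \<open>l\<close>.\<close>

lemma independent3_tensors:
  fixes a :: "3 \<Rightarrow> complex^'a::finite" and b :: "3 \<Rightarrow> complex^'b::finite" and c :: "3 \<Rightarrow> complex^'c::finite"
  assumes ind: "independent3 a" "independent3 b" "independent3 c"
    and l: "\<And>A B C. \<forall>m. A *v a m = axis m 1 \<Longrightarrow> \<forall>m. B *v b m = axis m 1 \<Longrightarrow> \<forall>m. C *v c m = axis m 1 \<Longrightarrow>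
      \<forall>m n. tensor_map A B C (l n) $ (m, 1, 1) = (if m = n then 1 else 0)"
  shows "independent3 l"
proof (rule matrix_left_inverse_independent3)
  fix k1 k2 k3
  assume 0: "k1 *s l 1 + k2 *s l 2 + k3 *s l 3 = 0"
  obtain A :: "complex^'a^3" and B :: "complex^'b^3" and C :: "complex^'c^3"
    where Q: "\<forall>m. A *v a m = axis m 1" "\<forall>m. B *v b m = axis m 1" "\<forall>m. C *v c m = axis m 1"
    using ind unfolding independent3_def by blast
  have "tensor_map A B C (k1 *s l 1 + k2 *s l 2 + k3 *s l 3) = tensor_map A B C (0 *s 0)" using 0 by simp
  then have z: "(k1 *s tensor_map A B C (l 1) + k2 *s tensor_map A B C (l 2) + k3 *s tensor_map A B C (l 3)) $ (m, 1, 1) = 0" for m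
    by (simp only: tensor_map_add tensor_map_scale) simp
  show "k1 = 0 \<and> k2 = 0 \<and> k3 = 0"
    using z[of 1] z[of 2] z[of 3] l[OF Q] by simp
qed

lemma independent3_nonzero:
  assumes "independent3 a"
  shows "a 1 + s *s a 2 + t *s a 3 \<noteq> 0" "a 1 + t *s a 3 \<noteq> 0" "a 1 + s *s a 2 \<noteq> 0" "a 1 \<noteq> 0" "a 2 \<noteq> 0"
  using independent3D(1)[OF assms, of 1 s t] independent3D(1)[OF assms, of 1 0 t]
    independent3D(1)[OF assms, of 1 s 0] independent3D(1)[OF assms, of 1 0 0] independent3D(2)[OF assms, of 0 1 0]
  by auto

text \<open>With \<open>y\<close> the curve \<open>(a\<^sub>1 + t a\<^sub>2 + t\<^sup>2 a\<^sub>3) \<otimes> \<dots>\<close> the planes spanned by \<open>y(t)\<close>, \<open>y(-t)\<close>, \<open>y(0)\<close> tend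
  to the span of the Taylor coefficients of \<open>y\<close> of order at most two; the last one is the form.\<close>

lemma osculating_form_in_sigma3:
  fixes a :: "3 \<Rightarrow> complex^'a::finite" and b :: "3 \<Rightarrow> complex^'b::finite" and c :: "3 \<Rightarrow> complex^'c::finite"
  assumes ind: "independent3 a" "independent3 b" "independent3 c"
  shows "pt (osculating_form a b c) \<in> sigma3 segre"
proof -
  define y where "y t = tensor3 (a 1 + t *s a 2 + t^2 *s a 3) (b 1 + t *s b 2 + t^2 *s b 3) (c 1 + t *s c 2 + t^2 *s c 3)"
    for t :: complex
  define Y0 where "Y0 = tensor3 (a 1) (b 1) (c 1)"
  \<comment> \<open>\<open>t *s P t\<close> is the odd part of \<open>y\<close>, and
    \<open>Y0 + t^2 *s W t\<close> the even one. Both \<open>P\<close> and \<open>W\<close> depend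
    on \<open>t^2\<close> only, so \<open>y (- t)\<close> differs from \<open>y t\<close> just in
    the sign of the middle term.\<close>
  define P where "P t = tensor3 (a 2) (b 1 + t^2 *s b 3) (c 1 + t^2 *s c 3) +
     tensor3 (a 1 + t^2 *s a 3) (b 2) (c 1 + t^2 *s c 3) + tensor3 (a 1 + t^2 *s a 3) (b 1 + t^2 *s b 3) (c 2) +
     t^2 *s tensor3 (a 2) (b 2) (c 2)" for t :: complex
  define W where "W t = tensor3 (a 1) (b 1) (c 3) + tensor3 (a 1 + t^2 *s a 3) (b 2) (c 2) + tensor3 (a 1) (b 3) (c 1 + t^2 *s c 3) +
     tensor3 (a 2) (b 1 + t^2 *s b 3) (c 2) + tensor3 (a 2) (b 2) (c 1 + t^2 *s c 3) +
     tensor3 (a 3) (b 1 + t^2 *s b 3) (c 1 + t^2 *s c 3)" for t :: complex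
  define l where "l = triple Y0 (P 0) (W 0)"
  define e where "e = triple (\<lambda>t. Y0) P W"
  have y: "y t = Y0 + t *s P t + t^2 *s W t" for t
    by (simp add: tensor_eq_iff y_def Y0_def P_def W_def) (simp add: algebra_simps power2_eq_square)
  have hol: "(\<lambda>t. (u + t *s v + t^2 *s w) $ i) holomorphic_on UNIV" "(\<lambda>t. (u + (- t) *s v + (- t)^2 *s w) $ i) holomorphic_on UNIV"
    for u v w :: "complex^'x::finite" and i
    by (auto intro!: holomorphic_intros)
  have "curve_in y {v. v \<noteq> 0 \<and> pt v \<in> segre}"
    unfolding y_def[abs_def]
    by (intro curve_in_tensor3 hol pt_tensor3_in_segre independent3_nonzero ind)
  moreover have "curve_in (\<lambda>t. y (- t)) {v. v \<noteq> 0 \<and> pt v \<in> segre}"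
    unfolding y_def
    by (intro curve_in_tensor3 hol pt_tensor3_in_segre independent3_nonzero ind)
  moreover have "curve_in (\<lambda>t. Y0) {v. v \<noteq> 0 \<and> pt v \<in> segre}"
    unfolding Y0_def
    by (intro curve_in_tensor3 holomorphic_on_const pt_tensor3_in_segre independent3_nonzero ind)
  moreover have "independent3 l"
    by (rule independent3_tensors[OF ind]) (simp add: l_def Y0_def P_def W_def tensor_map_add axis_def forall_3)
  moreover have "(e m \<longlongrightarrow> l m) (at 0)" for m
  proof -
    have "(P \<longlongrightarrow> P 0) (at 0)" "(W \<longlongrightarrow> W 0) (at 0)"
      unfolding P_def[abs_def] W_def[abs_def]
      by (intro tendsto_add tendsto_tensor3 tendsto_smult_vec tendsto_const tendsto_power tendsto_ident_at)+
    then show ?thesis unfolding e_def l_def triple_def by (simp add: tendsto_const)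
  qed
  moreover have "vec.span {y t, y (- t), Y0} = vec.span {e 1 t, e 2 t, e 3 t}" if "t \<noteq> 0" for t
  proof -
    have "y t = 1 *s Y0 + t *s P t + t^2 *s W t" by (simp add: y)
    moreover have "P (- t) = P t" "W (- t) = W t" by (simp_all add: P_def W_def)
    then have y': "y (- t) = 1 *s Y0 + (- t) *s P t + t^2 *s W t" by (simp add: y)
    moreover have "Y0 = 1 *s Y0 + 0 *s P t + 0 *s W t" by simp
    ultimately have "{y t, y (- t), Y0} \<subseteq> vec.span {Y0, P t, W t}" unfolding span3 insert_subset by blast
    \<comment> \<open>First and second central difference quotients of \<open>y\<close> at
      0.\<close>
    moreover have "P t = (1/(2*t)) *s y t + (- 1/(2*t)) *s y (- t) + 0 *s Y0"
      "W t = (1/(2*t^2)) *s y t + (1/(2*t^2)) *s y (- t) + (- 1/t^2) *s Y0" "Y0 = 0 *s y t + 0 *s y (- t) + 1 *s Y0"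
      using that by (simp_all add: y' y[of t] vec_eq_iff field_simps power2_eq_square)
    then have "{Y0, P t, W t} \<subseteq> vec.span {y t, y (- t), Y0}" unfolding span3 insert_subset by blast
    ultimately show ?thesis unfolding e_def by (simp add: vec.span_eq)
  qed
  then have "\<forall>\<^sub>F t in at 0. vec.span {y t, y (- t), Y0} = vec.span {e 1 t, e 2 t, e 3 t}"
    by (auto simp: eventually_at intro!: exI[of _ 1])
  ultimately have "pt (l 3) \<in> sigma3 segre" by (rule pt_in_sigma3I)
  moreover have "l 3 = osculating_form a b c" by (simp add: l_def W_def osculating_form_def)
  ultimately show ?thesis by simp
qed

text \<open>Here \<open>x\<^sub>1(t)\<close> and \<open>x\<^sub>2(t)\<close> move away from two points of a line in the Segre variety and
  \<open>x\<^sub>3 = x\<^sub>1(0) + x\<^sub>2(0)\<close> is a third point of this line.\<close>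

lemma line_form_in_sigma3:
  fixes a :: "3 \<Rightarrow> complex^'a::finite" and b :: "3 \<Rightarrow> complex^'b::finite" and c :: "3 \<Rightarrow> complex^'c::finite"
  assumes ind: "independent3 a" "independent3 b" "independent3 c"
  shows "pt (line_form a b c) \<in> sigma3 segre"
proof -
  define x1 where "x1 t = tensor3 (a 1 + t *s a 3) (b 1 + t *s b 2) (c 1 + t *s c 2)" for t :: complex
  define x2 where "x2 t = tensor3 (a 2) (b 1 + t *s b 3) (c 1 + t *s c 3)" for t :: complex
  \<comment> \<open>The coefficient 1 gives the first factor the shape treated in
    \<open>independent3_nonzero\<close>.\<close>
  define x3 where "x3 = tensor3 (a 1 + 1 *s a 2) (b 1) (c 1)"
  \<comment> \<open>The difference quotient of \<open>x1 t + x2 t - x3\<close>; at 0 it is the sum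
    of the two velocities.\<close>
  define W where "W t = tensor3 (a 1) (b 2) (c 1 + t *s c 2) + tensor3 (a 1) (b 1) (c 2) +
     tensor3 (a 2) (b 3) (c 1 + t *s c 3) + tensor3 (a 2) (b 1) (c 3) +
     tensor3 (a 3) (b 1 + t *s b 2) (c 1 + t *s c 2)" for t :: complex
  define l where "l = triple (x1 0) (x2 0) (W 0)"
  define e where "e = triple x1 x2 W"
  have y: "x3 = x1 t + x2 t - t *s W t" for t
    by (simp add: tensor_eq_iff x1_def x2_def x3_def W_def) (simp add: algebra_simps)
  have hol: "(\<lambda>t. (u + t *s v) $ i) holomorphic_on UNIV"
    for u v :: "complex^'x::finite" and i
    by (auto intro!: holomorphic_intros)
  have "curve_in x1 {v. v \<noteq> 0 \<and> pt v \<in> segre}"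
    unfolding x1_def[abs_def]
    by (intro curve_in_tensor3 hol pt_tensor3_in_segre independent3_nonzero ind)
  moreover have "curve_in x2 {v. v \<noteq> 0 \<and> pt v \<in> segre}"
    unfolding x2_def[abs_def]
    by (intro curve_in_tensor3 hol holomorphic_on_const pt_tensor3_in_segre independent3_nonzero ind)
  moreover have "curve_in (\<lambda>t. x3) {v. v \<noteq> 0 \<and> pt v \<in> segre}"
    unfolding x3_def
    by (intro curve_in_tensor3 holomorphic_on_const pt_tensor3_in_segre independent3_nonzero ind)
  moreover have "independent3 l"
    by (rule independent3_tensors[OF ind]) (simp add: l_def x1_def x2_def W_def tensor_map_add axis_def forall_3)
  moreover have "(e m \<longlongrightarrow> l m) (at 0)" for m
  proof -
    have "(x1 \<longlongrightarrow> x1 0) (at 0)" "(x2 \<longlongrightarrow> x2 0) (at 0)" "(W \<longlongrightarrow> W 0) (at 0)"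
      unfolding x1_def[abs_def] x2_def[abs_def] W_def[abs_def]
      by (intro tendsto_add tendsto_tensor3 tendsto_smult_vec tendsto_const tendsto_ident_at)+
    then show ?thesis unfolding e_def l_def triple_def by simp
  qed
  moreover have "vec.span {x1 t, x2 t, x3} = vec.span {e 1 t, e 2 t, e 3 t}" if "t \<noteq> 0" for t
  proof -
    have "x1 t = 1 *s x1 t + 0 *s x2 t + 0 *s W t" "x2 t = 0 *s x1 t + 1 *s x2 t + 0 *s W t"
      "x3 = 1 *s x1 t + 1 *s x2 t + (- t) *s W t"
      by (simp_all add: y[of t])
    then have "{x1 t, x2 t, x3} \<subseteq> vec.span {x1 t, x2 t, W t}" unfolding span3 insert_subset by blast
    moreover have "x1 t = 1 *s x1 t + 0 *s x2 t + 0 *s x3" "x2 t = 0 *s x1 t + 1 *s x2 t + 0 *s x3"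
      "W t = (1/t) *s x1 t + (1/t) *s x2 t + (- 1/t) *s x3"
      using that by (simp_all add: y[of t] vec_eq_iff field_simps)
    then have "{x1 t, x2 t, W t} \<subseteq> vec.span {x1 t, x2 t, x3}" unfolding span3 insert_subset by blast
    ultimately show ?thesis unfolding e_def by (simp add: vec.span_eq)
  qed
  then have "\<forall>\<^sub>F t in at 0. vec.span {x1 t, x2 t, x3} = vec.span {e 1 t, e 2 t, e 3 t}"
    by (auto simp: eventually_at intro!: exI[of _ 1])
  ultimately have "pt (l 3) \<in> sigma3 segre" by (rule pt_in_sigma3I)
  moreover have "l 3 = line_form a b c" by (simp add: l_def W_def line_form_def)
  ultimately show ?thesis by simp
qed

subsection \<open>Rotation of the three factors\<close>

lemma linear_rotate: "Vector_Spaces.linear (*s) (*s) rotate"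
  by unfold_locales (simp_all add: tensor_eq_iff algebra_simps)

lemma span_rotate: "vec.span (rotate ` S) = rotate ` vec.span S"
  by (rule vec.linear_span_image[OF linear_rotate])

lemma span_rotate3: "vec.span {rotate x, rotate y, rotate z} = rotate ` vec.span {x, y, z}"
  using span_rotate[of "{x, y, z}"] by simp

lemma dim_rotate: "vec.dim (rotate ` S) = vec.dim S"
  by (rule vec.dim_image_eq[OF linear_rotate]) (simp add: inj_on_def)

lemma pt_rotate: "pt (rotate v) = rotate ` pt v"
  unfolding pt_def using span_rotate[of "{v}"] by simp

lemma rotate_eq_0 [simp]: "rotate v = 0 \<longleftrightarrow> v = 0"
  by (auto simp: tensor_eq_iff)

lemma segre_rotate: "v \<noteq> 0 \<Longrightarrow> pt v \<in> segre \<Longrightarrow> pt (rotate v) \<in> segre"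
  unfolding pt_in_segre_iff using pt_in_segre_iff[of "rotate v"] by auto blast

lemma curve_in_rotate:
  assumes "curve_in y M" "\<And>v. v \<in> M \<Longrightarrow> rotate v \<in> N"
  shows "curve_in (\<lambda>t. rotate (y t)) N"
proof -
  obtain r where r: "r > 0" "\<And>i. (\<lambda>t. y t $ i) holomorphic_on ball 0 r" "\<forall>t\<in>ball 0 r. y t \<in> M"
    using assms(1) unfolding curve_in_def by blast
  have "(\<lambda>t. rotate (y t) $ p) holomorphic_on ball 0 r" for p
    by (cases p) (simp add: r(2))
  then show ?thesis unfolding curve_in_def using r assms(2) by blast
qed

lemma tendsto_rotate:
  assumes "(S \<longlongrightarrow> T) F"
  shows "((\<lambda>s. rotate (S s)) \<longlongrightarrow> rotate T) F"
proof (rule vec_tendstoI)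
  show "((\<lambda>s. rotate (S s) $ p) \<longlongrightarrow> rotate T $ p) F" for p
    by (cases p) (simp add: tendsto_vec_nth[OF assms])
qed

text \<open>Needed because only one of the three types of tangents along lines is shown directly to
  lie in the secant variety.\<close>

lemma sigma3_rotate:
  assumes "pt T \<in> sigma3 segre"
  shows "pt (rotate T) \<in> sigma3 segre"
proof -
  let ?X = "{v. v \<noteq> 0 \<and> pt v \<in> segre}"
  obtain x1 x2 x3 E where x: "curve_in x1 ?X" "curve_in x2 ?X" "curve_in x3 ?X"
    and pl: "plane_tendsto (\<lambda>t. vec.span {x1 t, x2 t, x3 t}) E (at 0)" and E: "pt T \<subseteq> E"
    using assms unfolding sigma3_def by blast
  obtain e1 e2 e3 l1 l2 l3 where dE: "vec.dim E = 3" and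
    ev: "\<forall>\<^sub>F t in at 0. vec.dim (vec.span {x1 t, x2 t, x3 t}) = 3 \<and> vec.span {x1 t, x2 t, x3 t} = vec.span {e1 t, e2 t, e3 t}"
    and lim: "(e1 \<longlongrightarrow> l1) (at 0)" "(e2 \<longlongrightarrow> l2) (at 0)" "(e3 \<longlongrightarrow> l3) (at 0)" and El: "E = vec.span {l1, l2, l3}"
    using pl unfolding plane_tendsto_def by blast
  have "plane_tendsto (\<lambda>t. vec.span {rotate (x1 t), rotate (x2 t), rotate (x3 t)}) (rotate ` E) (at 0)"
    unfolding plane_tendsto_def
  proof (intro conjI exI)
    show "vec.dim (rotate ` E) = 3" by (simp add: dim_rotate dE)
    show "rotate ` E = vec.span {rotate l1, rotate l2, rotate l3}" by (simp only: span_rotate3 El)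
    show "\<forall>\<^sub>F t in at 0. vec.dim (vec.span {rotate (x1 t), rotate (x2 t), rotate (x3 t)}) = 3 \<and>
      vec.span {rotate (x1 t), rotate (x2 t), rotate (x3 t)} = vec.span {rotate (e1 t), rotate (e2 t), rotate (e3 t)}"
      using ev 
    proof eventually_elim
      case (elim t)
      then show ?case unfolding span_rotate3 dim_rotate by (elim conjE, intro conjI) (assumption, rule arg_cong)
    qed
  qed (intro tendsto_rotate lim)+
  moreover have "curve_in (\<lambda>t. rotate (x1 t)) ?X" "curve_in (\<lambda>t. rotate (x2 t)) ?X" "curve_in (\<lambda>t. rotate (x3 t)) ?X"
    by (rule curve_in_rotate[OF x(1)] curve_in_rotate[OF x(2)] curve_in_rotate[OF x(3)]; simp add: segre_rotate)+
  moreover have "pt (rotate T) \<subseteq> rotate ` E" unfolding pt_rotate using E by blast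
  moreover have "rotate T \<noteq> 0" using sigma3_nonzero[OF assms] by simp
  ultimately show ?thesis unfolding sigma3_def projectivization_def by blast
qed

subsection \<open>Jets of curves in the cone over the Segre variety\<close>

definition has_curve_deriv :: "(complex \<Rightarrow> complex^'n::finite) \<Rightarrow> complex^'n \<Rightarrow> complex \<Rightarrow> bool" where
  "has_curve_deriv y v t \<longleftrightarrow> (\<forall>i. ((\<lambda>s. y s $ i) has_field_derivative v $ i) (at t))"

lemma curve_deriv_eqI: "has_curve_deriv y v t \<Longrightarrow> curve_deriv y t = v"
  by (simp add: has_curve_deriv_def curve_deriv_def vec_eq_iff DERIV_imp_deriv)

lemma has_curve_deriv_const: "has_curve_deriv (\<lambda>t. v) 0 t"
  by (simp add: has_curve_deriv_def)

lemma has_curve_deriv_add: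
  "has_curve_deriv y u t \<Longrightarrow> has_curve_deriv z v t \<Longrightarrow> has_curve_deriv (\<lambda>t. y t + z t) (u + v) t"
  by (simp add: has_curve_deriv_def DERIV_add)

lemma has_curve_deriv_scale:
  assumes "(f has_field_derivative f') (at t)" "has_curve_deriv y v t"
  shows "has_curve_deriv (\<lambda>t. f t *s y t) (f' *s y t + f t *s v) t"
  using assms unfolding has_curve_deriv_def
  by (auto intro!: derivative_eq_intros)

lemma has_curve_deriv_tensor3:
  fixes A :: "complex \<Rightarrow> complex^'a::finite" and B :: "complex \<Rightarrow> complex^'b::finite"
    and C :: "complex \<Rightarrow> complex^'c::finite"
  assumes "has_curve_deriv A a t" "has_curve_deriv B b t" "has_curve_deriv C c t"
  shows "has_curve_deriv (\<lambda>t. tensor3 (A t) (B t) (C t))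
     (tensor3 a (B t) (C t) + tensor3 (A t) b (C t) + tensor3 (A t) (B t) c) t"
  unfolding has_curve_deriv_def
proof
  fix p :: "'a \<times> 'b \<times> 'c"
  obtain i j k where p: "p = (i, j, k)" by (cases p)
  show "((\<lambda>s. tensor3 (A s) (B s) (C s) $ p) has_field_derivative
     (tensor3 a (B t) (C t) + tensor3 (A t) b (C t) + tensor3 (A t) (B t) c) $ p) (at t)"
    using assms unfolding has_curve_deriv_def p
    by (auto intro!: derivative_eq_intros simp: algebra_simps)
qed

lemma curve_deriv_cong:
  assumes "r > 0" "\<And>s. s \<in> ball 0 r \<Longrightarrow> y s = z s"
  shows "curve_deriv y 0 = curve_deriv z 0"
proof -
  have "\<forall>\<^sub>F s in nhds 0. y s $ i = z s $ i" for i
    using eventually_nhds_in_open[of "ball 0 r" 0] assms by (auto elim: eventually_mono)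
  then show ?thesis by (simp add: curve_deriv_def vec_eq_iff deriv_cong_ev)
qed

lemma jet_tensor3:
  assumes r: "r > 0" "\<And>t. t \<in> ball 0 r \<Longrightarrow> y t = tensor3 (A t) (B t) (C t)"
    and 1: "\<And>t. t \<in> ball 0 r \<Longrightarrow> has_curve_deriv A (A1 t) t"
      "\<And>t. t \<in> ball 0 r \<Longrightarrow> has_curve_deriv B (B1 t) t" "\<And>t. t \<in> ball 0 r \<Longrightarrow> has_curve_deriv C (C1 t) t"
    and 2: "has_curve_deriv A1 A2 0" "has_curve_deriv B1 B2 0" "has_curve_deriv C1 C2 0"
  shows "curve_deriv y 0 = tensor3 (A1 0) (B 0) (C 0) + tensor3 (A 0) (B1 0) (C 0) + tensor3 (A 0) (B 0) (C1 0)"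
    and "curve_deriv (curve_deriv y) 0 =
      tensor3 A2 (B 0) (C 0) + tensor3 (A 0) B2 (C 0) + tensor3 (A 0) (B 0) C2 +
      2 *s (tensor3 (A1 0) (B1 0) (C 0) + tensor3 (A1 0) (B 0) (C1 0) + tensor3 (A 0) (B1 0) (C1 0))"
proof -
  let ?z = "\<lambda>t. tensor3 (A1 t) (B t) (C t) + tensor3 (A t) (B1 t) (C t) + tensor3 (A t) (B t) (C1 t)"
  have D: "curve_deriv y t = ?z t" if t: "t \<in> ball 0 r" for t
  proof -
    have "\<forall>\<^sub>F s in nhds t. y s $ i = tensor3 (A s) (B s) (C s) $ i" for i
      using eventually_nhds_in_open[of "ball 0 r" t] t r by (auto elim: eventually_mono)
    then have "curve_deriv y t = curve_deriv (\<lambda>t. tensor3 (A t) (B t) (C t)) t"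
      by (simp add: curve_deriv_def vec_eq_iff deriv_cong_ev)
    also have "\<dots> = ?z t" by (intro curve_deriv_eqI has_curve_deriv_tensor3 1 t)
    finally show ?thesis .
  qed
  have 0: "0 \<in> ball 0 r" using r by simp
  show "curve_deriv y 0 = ?z 0" by (rule D[OF 0])
  have "curve_deriv (curve_deriv y) 0 = curve_deriv ?z 0" using r(1) D by (rule curve_deriv_cong)
  also have "\<dots> =
      (tensor3 A2 (B 0) (C 0) + tensor3 (A1 0) (B1 0) (C 0) + tensor3 (A1 0) (B 0) (C1 0)) +
      (tensor3 (A1 0) (B1 0) (C 0) + tensor3 (A 0) B2 (C 0) + tensor3 (A 0) (B1 0) (C1 0)) +
      (tensor3 (A1 0) (B 0) (C1 0) + tensor3 (A 0) (B1 0) (C1 0) + tensor3 (A 0) (B 0) C2)"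
    by (intro curve_deriv_eqI has_curve_deriv_add has_curve_deriv_tensor3 1 2 0)
  also have "\<dots> = tensor3 A2 (B 0) (C 0) + tensor3 (A 0) B2 (C 0) + tensor3 (A 0) (B 0) C2 +
      2 *s (tensor3 (A1 0) (B1 0) (C 0) + tensor3 (A1 0) (B 0) (C1 0) + tensor3 (A 0) (B1 0) (C1 0))"
    by (simp add: vec_eq_iff algebra_simps)
  finally show "curve_deriv (curve_deriv y) 0 = \<dots>" .
qed

section \<open>Lifting curves to the three factors and dividing by the parameter\<close>

lemma holomorphic_has_curve_deriv:
  assumes "\<And>i. (\<lambda>t. A t $ i) holomorphic_on ball 0 r" "t \<in> ball 0 r"
  shows "has_curve_deriv A (curve_deriv A t) t"
  unfolding has_curve_deriv_def curve_deriv_def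
  using holomorphic_derivI[OF assms(1) open_ball assms(2)] by simp

lemma holomorphic_curve_deriv:
  assumes "\<And>i. (\<lambda>t. A t $ i) holomorphic_on ball 0 r"
  shows "(\<lambda>t. curve_deriv A t $ i) holomorphic_on ball 0 r"
  unfolding curve_deriv_def using holomorphic_deriv[OF assms open_ball] by simp

text \<open>The quadrics cutting out the Segre variety: 2 by 2 minors of flattenings. Being
  polynomial equations, they show that the cone is closed.\<close>

lemma decomposable_iff:
  fixes v :: "complex^('a::finite \<times> 'b::finite \<times> 'c::finite)"
  shows "(\<exists>a b c. v = tensor3 a b c) \<longleftrightarrow>
    (\<forall>i j k i' j' k'. v$(i,j,k) * v$(i',j',k') = v$(i',j,k) * v$(i,j',k') \<and>
       v$(i,j,k) * v$(i',j',k') = v$(i,j',k) * v$(i',j,k'))" (is "?L \<longleftrightarrow> ?R")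
proof
  assume ?R
  show ?L
  proof (cases "v = 0")
    case True
    then show ?thesis by (auto intro!: exI[of _ 0])
  next
    case False
    then obtain i0 j0 k0 where nz: "v$(i0,j0,k0) \<noteq> 0" by (auto simp: tensor_eq_iff)
    let ?n = "v$(i0,j0,k0)"
    have "v$(i,j,k) = v$(i,j0,k0) * (v$(i0,j,k0) / ?n) * (v$(i0,j0,k) / ?n)" for i j k
    proof -
      have "v$(i,j,k) * ?n = v$(i0,j,k) * v$(i,j0,k0)" "v$(i0,j,k) * ?n = v$(i0,j0,k) * v$(i0,j,k0)"
        using \<open>?R\<close> by blast+
      then have "v$(i,j,k) * (?n * ?n) = v$(i,j0,k0) * v$(i0,j,k0) * v$(i0,j0,k)" by algebra
      then show ?thesis using nz by (simp add: eq_divide_eq)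
    qed
    then have "v = tensor3 (\<chi> i. v$(i,j0,k0)) (\<chi> j. v$(i0,j,k0) / ?n) (\<chi> k. v$(i0,j0,k) / ?n)"
      unfolding tensor_eq_iff tensor3_nth vec_lambda_beta by blast
    then show ?thesis by blast
  qed
qed (auto simp: mult_ac)

text \<open>Near a nonzero point some coordinate stays nonzero, and dividing by it recovers the
  factors holomorphically from three coordinate fibers.\<close>

lemma curve_lift:
  fixes y :: "complex \<Rightarrow> complex^('a::finite \<times> 'b::finite \<times> 'c::finite)"
  assumes y: "curve_in y (affine_cone segre)" "y 0 \<noteq> 0"
  shows "\<exists>r>0. \<exists>A B C. (\<forall>i. (\<lambda>t. A t $ i) holomorphic_on ball 0 r) \<and> (\<forall>i. (\<lambda>t. B t $ i) holomorphic_on ball 0 r) \<and>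
     (\<forall>i. (\<lambda>t. C t $ i) holomorphic_on ball 0 r) \<and> (\<forall>t\<in>ball 0 r. y t = tensor3 (A t) (B t) (C t))"
proof -
  obtain R where R: "R > 0" "\<And>i. (\<lambda>t. y t $ i) holomorphic_on ball 0 R"
    and cone: "\<And>t. t \<in> ball 0 R \<Longrightarrow> \<exists>a b c. y t = tensor3 a b c"
    using y(1) unfolding curve_in_def affine_cone_segre by auto
  obtain i0 j0 k0 where nz: "y 0 $ (i0,j0,k0) \<noteq> 0" using y(2) by (auto simp: tensor_eq_iff)
  let ?n = "\<lambda>t. y t $ (i0,j0,k0)"
  have "isCont ?n 0"
    using holomorphic_on_imp_continuous_on[OF R(2)] R(1) by (simp add: continuous_on_eq_continuous_at)
  then have "\<exists>e>0. \<forall>t. dist 0 t < e \<longrightarrow> ?n t \<noteq> 0" using nz by (rule continuous_at_avoid)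
  then obtain e where e: "e > 0" "\<And>t. dist 0 t < e \<Longrightarrow> ?n t \<noteq> 0" by blast
  define r where "r = min R e"
  have r: "r > 0" "ball 0 r \<subseteq> ball 0 R" "\<And>t. t \<in> ball 0 r \<Longrightarrow> ?n t \<noteq> 0"
    using R(1) e by (auto simp: r_def)
  have hol: "(\<lambda>t. y t $ i) holomorphic_on ball 0 r" for i using R(2) r(2) by (rule holomorphic_on_subset)
  let ?A = "\<lambda>t. \<chi> i. y t $ (i,j0,k0)"
  let ?B = "\<lambda>t. \<chi> j. y t $ (i0,j,k0) / ?n t"
  let ?C = "\<lambda>t. \<chi> k. y t $ (i0,j0,k) / ?n t"
  have "y t = tensor3 (?A t) (?B t) (?C t)" if t: "t \<in> ball 0 r" for t
  proof -
    obtain a b c where "y t = tensor3 a b c" using cone t r(2) by blast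
    then show ?thesis using r(3)[OF t] by (simp add: tensor_eq_iff)
  qed
  moreover have "\<forall>i. (\<lambda>t. ?A t $ i) holomorphic_on ball 0 r" "\<forall>i. (\<lambda>t. ?B t $ i) holomorphic_on ball 0 r"
     "\<forall>i. (\<lambda>t. ?C t $ i) holomorphic_on ball 0 r"
    using hol r(3) by (auto intro!: holomorphic_on_divide)
  ultimately show ?thesis using r(1) by (intro exI[of _ r] conjI exI[of _ ?A] exI[of _ ?B] exI[of _ ?C]) auto
qed

lemma jet_of_curve:
  fixes y :: "complex \<Rightarrow> complex^('a::finite \<times> 'b::finite \<times> 'c::finite)"
  assumes y: "curve_in y (affine_cone segre)" "y 0 \<noteq> 0"
  shows "\<exists>a b c a1 b1 c1 a2 b2 c2. y 0 = tensor3 a b c \<and>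
      curve_deriv y 0 = tensor3 a1 b c + tensor3 a b1 c + tensor3 a b c1 \<and>
      curve_deriv (curve_deriv y) 0 = tensor3 a2 b c + tensor3 a b2 c + tensor3 a b c2 +
        2 *s (tensor3 a1 b1 c + tensor3 a1 b c1 + tensor3 a b1 c1)"
proof -
  obtain r A B C where r: "r > 0" and hol: "\<And>i. (\<lambda>t. A t $ i) holomorphic_on ball 0 r"
    "\<And>i. (\<lambda>t. B t $ i) holomorphic_on ball 0 r" "\<And>i. (\<lambda>t. C t $ i) holomorphic_on ball 0 r"
    and eq: "\<And>t. t \<in> ball 0 r \<Longrightarrow> y t = tensor3 (A t) (B t) (C t)"
    using curve_lift[OF y] by blast
  have 0: "0 \<in> ball 0 r" using r by simp
  note jet = jet_tensor3[OF r eq hol[THEN holomorphic_has_curve_deriv]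
      holomorphic_has_curve_deriv[OF hol(1)[THEN holomorphic_curve_deriv] 0]
      holomorphic_has_curve_deriv[OF hol(2)[THEN holomorphic_curve_deriv] 0]
      holomorphic_has_curve_deriv[OF hol(3)[THEN holomorphic_curve_deriv] 0]]
  show ?thesis using jet eq[OF 0] by blast
qed

text \<open>At the vertex of the cone \<open>y t = t *s z t\<close> with \<open>z\<close> again a
  holomorphic curve in the cone, since the cone is closed. This lowers the order of vanishing by
  one, and the product rule explains the factor 2.\<close>

lemma divide_curve:
  fixes y :: "complex \<Rightarrow> complex^('a::finite \<times> 'b::finite \<times> 'c::finite)"
  assumes y: "curve_in y (affine_cone segre)" "y 0 = 0"
  shows "\<exists>z. curve_in z (affine_cone segre) \<and> curve_deriv y 0 = z 0 \<and>
     curve_deriv (curve_deriv y) 0 = 2 *s curve_deriv z 0"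
proof -
  obtain r where r: "r > 0" "\<And>i. (\<lambda>t. y t $ i) holomorphic_on ball 0 r"
    and cone: "\<And>t. t \<in> ball 0 r \<Longrightarrow> \<exists>a b c. y t = tensor3 a b c"
    using y(1) unfolding curve_in_def affine_cone_segre by auto
  \<comment> \<open>The removable singularity at 0 is filled by the derivative;
    \<open>y 0 $ i\<close>, which is 0, and \<open>t - 0\<close> are kept to fit
    \<open>pole_lemma_open\<close>.\<close>
  define z where "z t = (\<chi> i. if t = 0 then deriv (\<lambda>s. y s $ i) 0 else (y t $ i - y 0 $ i) / (t - 0))" for t
  have hol: "(\<lambda>t. z t $ i) holomorphic_on ball 0 r" for i
    using pole_lemma_open[OF r(2) open_ball, of 0 i] by (simp add: z_def)
  have yz: "y t = t *s z t" for t using y(2) by (simp add: z_def vec_eq_iff)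
  have cone': "\<exists>a b c. z t = tensor3 a b c" if t: "t \<in> ball 0 r" "t \<noteq> 0" for t
  proof -
    obtain a b c where "y t = tensor3 a b c" using cone[OF t(1)] by blast
    then have "z t = tensor3 ((1/t) *s a) b c" using yz[of t] t(2) by (simp add: vec_eq_iff tensor_eq_iff field_simps)
    then show ?thesis by blast
  qed
  have cz: "\<exists>a b c. z t = tensor3 a b c" if t: "t \<in> ball 0 r" for t
  proof (cases "t = 0")
    case True
    have lim: "((\<lambda>t. z t $ i) \<longlongrightarrow> z 0 $ i) (at 0)" for i
      using holomorphic_on_imp_continuous_on[OF hol[of i]] r(1)
      by (simp add: continuous_on_eq_continuous_at isCont_def)
    have "\<forall>\<^sub>F t in at 0. t \<in> ball 0 r \<and> t \<noteq> 0"
      using r(1) by (auto simp: eventually_at dist_commute intro!: exI[of _ r])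
    then have dec: "\<forall>\<^sub>F t in at 0. \<exists>a b c. z t = tensor3 a b c"
      by eventually_elim (rule cone'; simp)
    \<comment> \<open>A quadratic equation valid on all decomposable tensors passes to the limit
      \<open>z 0\<close>.\<close>
    have closed: "z 0 $ p * z 0 $ q = z 0 $ p' * z 0 $ q'"
      if "\<And>v. (\<exists>a b c. v = tensor3 a b c) \<Longrightarrow> v $ p * v $ q = v $ p' * v $ q'" for p q p' q'
    proof -
      have "\<forall>\<^sub>F t in at 0. z t $ p * z t $ q = z t $ p' * z t $ q'"
        using dec by eventually_elim (rule that)
      moreover have "((\<lambda>t. z t $ p' * z t $ q') \<longlongrightarrow> z 0 $ p' * z 0 $ q') (at 0)" by (intro tendsto_mult lim)
      ultimately have "((\<lambda>t. z t $ p * z t $ q) \<longlongrightarrow> z 0 $ p' * z 0 $ q') (at 0)" by (simp add: tendsto_cong)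
      moreover have "((\<lambda>t. z t $ p * z t $ q) \<longlongrightarrow> z 0 $ p * z 0 $ q) (at 0)" by (intro tendsto_mult lim)
      ultimately show ?thesis using tendsto_unique[OF at_neq_bot] by blast
    qed
    show ?thesis unfolding True decomposable_iff
      by (intro allI conjI closed) (auto simp: mult_ac)
  qed (rule cone'[OF t])
  have "curve_in z (affine_cone segre)"
    unfolding curve_in_def affine_cone_segre using r(1) hol cz by blast
  moreover have 1: "curve_deriv y 0 = z 0" by (simp add: curve_deriv_def z_def)
  moreover have "curve_deriv (curve_deriv y) 0 = 2 *s curve_deriv z 0"
  proof -
    have d: "curve_deriv y t = 1 *s z t + t *s curve_deriv z t" if "t \<in> ball 0 r" for t
    proof -
      have "y = (\<lambda>t. t *s z t)" using yz by blast
      moreover have "has_curve_deriv (\<lambda>t. t *s z t) (1 *s z t + t *s curve_deriv z t) t"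
        by (intro has_curve_deriv_scale DERIV_ident holomorphic_has_curve_deriv[OF hol that])
      ultimately show ?thesis using curve_deriv_eqI by metis
    qed
    have 0: "0 \<in> ball 0 r" using r by simp
    have "curve_deriv (curve_deriv y) 0 = curve_deriv (\<lambda>t. 1 *s z t + t *s curve_deriv z t) 0"
      using r(1) d by (rule curve_deriv_cong)
    also have "\<dots> = (0 *s z 0 + 1 *s curve_deriv z 0) + (1 *s curve_deriv z 0 + 0 *s curve_deriv (curve_deriv z) 0)"
      by (intro curve_deriv_eqI has_curve_deriv_add has_curve_deriv_scale DERIV_ident DERIV_const
          holomorphic_has_curve_deriv[OF hol 0] holomorphic_has_curve_deriv[OF holomorphic_curve_deriv[OF hol] 0])
    also have "\<dots> = 2 *s curve_deriv z 0" by (simp add: vec_eq_iff)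
    finally show ?thesis .
  qed
  ultimately show ?thesis by blast
qed

lemma curve_in_at_0: "curve_in y M \<Longrightarrow> y 0 \<in> M"
  unfolding curve_in_def by force

text \<open>The cases are the orders of vanishing of \<open>y\<close> at 0. Vanishing leaves a
  tangent vector or a single decomposable tensor, both of which are osculating forms with some zero
  vectors.\<close>

lemma osculating_of_curve:
  assumes y: "curve_in y (affine_cone segre)"
  shows "is_osculating (y 0 + curve_deriv y 0 + curve_deriv (curve_deriv y) 0)"
proof (cases "y 0 = 0")
  case False
  obtain a b c a1 b1 c1 a2 b2 c2 where "y 0 = tensor3 a b c"
      "curve_deriv y 0 = tensor3 a1 b c + tensor3 a b1 c + tensor3 a b c1"
      "curve_deriv (curve_deriv y) 0 = tensor3 a2 b c + tensor3 a b2 c + tensor3 a b c2 +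
        2 *s (tensor3 a1 b1 c + tensor3 a1 b c1 + tensor3 a b1 c1)"
    using jet_of_curve[OF y False] by blast
  \<comment> \<open>The terms of \<open>y\<close> and \<open>y'\<close> are absorbed by the third
    vectors of the frames, and the factor 2 of the mixed second derivatives by the third
    factor.\<close>
  then show ?thesis
    by (intro is_osculatingI[of _ a b "c + c1 + c2" b1 "2 *s c1" "(1/2) *s (b1 + b2)" "2 *s c" a1 "(1/2) *s (a1 + a2)"])
       (simp add: tensor_eq_iff algebra_simps)
next
  case True
  obtain z where z: "curve_in z (affine_cone segre)" "curve_deriv y 0 = z 0"
     "curve_deriv (curve_deriv y) 0 = 2 *s curve_deriv z 0"
    using divide_curve[OF y True] by blast
  show ?thesis
  proof (cases "z 0 = 0")
    case False
    obtain a b c a1 b1 c1 where "z 0 = tensor3 a b c"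
        "curve_deriv z 0 = tensor3 a1 b c + tensor3 a b1 c + tensor3 a b c1"
      using jet_of_curve[OF z(1) False] by blast
    then show ?thesis unfolding z True
      by (intro is_osculatingI[of _ a b "c + 2 *s c1" 0 0 "2 *s b1" c 0 "2 *s a1"])
         (simp add: tensor_eq_iff algebra_simps)
  next
    case z0: True
    obtain w where w: "curve_in w (affine_cone segre)" "curve_deriv z 0 = w 0"
      using divide_curve[OF z(1) z0] by blast
    have "w 0 \<in> affine_cone segre" using w(1) by (rule curve_in_at_0)
    then obtain a b c where "w 0 = tensor3 a b c" unfolding affine_cone_segre by blast
    with w(2) show ?thesis unfolding z z0 True
      by (intro is_osculatingI[of _ 0 b 0 0 0 0 c 0 "2 *s a"]) (simp add: tensor_eq_iff)
  qed
qed

lemma curve_of_osculating_form: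
  fixes a :: "3 \<Rightarrow> complex^'a::finite" and b :: "3 \<Rightarrow> complex^'b::finite" and c :: "3 \<Rightarrow> complex^'c::finite"
  shows "\<exists>y. curve_in y (affine_cone segre) \<and>
     osculating_form a b c = y 0 + curve_deriv y 0 + curve_deriv (curve_deriv y) 0"
proof -
  \<comment> \<open>Halving \<open>c 1\<close> and \<open>c 2\<close> below cancels the factor 2 of
    the mixed terms in the second derivative. The corrected third vectors cancel what
    \<open>y\<close> and its first derivative contribute.\<close>
  define a3 where "a3 = a 3 - (1/2) *s (a 1 + a 2)"
  define b3 where "b3 = b 3 - (1/2) *s b 2"
  define c3 where "c3 = (1/2) *s c 3 - (1/4) *s c 2"
  let ?Q = "\<lambda>u v w t. u + (t *s v + t^2 *s w)"
  define y where "y t = tensor3 (?Q (a 1) (a 2) a3 t) (?Q (b 1) (b 2) b3 t) (?Q ((1/2) *s c 1) ((1/2) *s c 2) c3 t)"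
    for t :: complex
  have "((\<lambda>t. t^2) has_field_derivative 2 * t) (at t)" "((\<lambda>t. 2 * t) has_field_derivative 2) (at t)" for t :: complex
    by (auto intro!: derivative_eq_intros)
  note d2 = this
  have q: "has_curve_deriv (?Q u v w) (0 + ((1 *s v + t *s 0) + ((2 * t) *s w + t^2 *s 0))) t"
      "has_curve_deriv (\<lambda>t. 0 + ((1 *s v + t *s 0) + ((2 * t) *s w + t^2 *s 0))) (2 *s w) 0"
    for u v w :: "complex^'x::finite" and t
  proof -
    show "has_curve_deriv (?Q u v w) (0 + ((1 *s v + t *s 0) + ((2 * t) *s w + t^2 *s 0))) t"
      by (intro has_curve_deriv_add has_curve_deriv_scale has_curve_deriv_const DERIV_ident d2)
    have "has_curve_deriv (\<lambda>t. v + (2 * t) *s w) (0 + (2 *s w + (2 * 0) *s 0)) 0"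
      by (intro has_curve_deriv_add has_curve_deriv_scale has_curve_deriv_const d2)
    then show "has_curve_deriv (\<lambda>t. 0 + ((1 *s v + t *s 0) + ((2 * t) *s w + t^2 *s 0))) (2 *s w) 0" by simp
  qed
  have "curve_in y (affine_cone segre)"
    unfolding y_def[abs_def]
    by (intro curve_in_tensor3) (auto simp: affine_cone_segre intro!: holomorphic_intros)
  moreover have "osculating_form a b c = y 0 + curve_deriv y 0 + curve_deriv (curve_deriv y) 0"
    unfolding jet_tensor3[OF zero_less_one y_def q(1) q(1) q(1) q(2) q(2) q(2)]
    by (simp add: y_def tensor_eq_iff osculating_form_def a3_def b3_def c3_def field_simps)
  ultimately show ?thesis by blast
qed

section \<open>Tangent vectors at two points of a line\<close>

lemma tensor3_eq_parallel:
  assumes "tensor3 a b c = tensor3 a' b' c'" "tensor3 a b c \<noteq> 0"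
  shows "\<exists>k l m. a' = k *s a \<and> b' = l *s b \<and> c' = m *s c"
proof -
  have e: "a$i * b$j * c$k = a'$i * b'$j * c'$k" for i j k
    using assms(1) by (simp add: tensor_eq_iff)
  obtain i j k where nz: "a$i * b$j * c$k \<noteq> 0" using assms(2) by (auto simp: tensor_eq_iff)
  then have nz': "a'$i * b'$j * c'$k \<noteq> 0" by (simp add: e)
  have "a' = ((b$j * c$k) / (b'$j * c'$k)) *s a" "b' = ((a$i * c$k) / (a'$i * c'$k)) *s b"
      "c' = ((a$i * b$j) / (a'$i * b'$j)) *s c"
    using nz nz' e[of _ j k] e[of i _ k] e[of i j] by (simp_all add: vec_eq_iff field_simps)
  then show ?thesis by blast
qed

text \<open>The lift of a curve determines the factors of its starting point only up to scalars,
  which are moved into the velocities.\<close>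

lemma tangent_vector_form:
  assumes "x' \<in> affine_tangent_space segre (tensor3 a b c)" "tensor3 a b c \<noteq> 0"
  shows "\<exists>a1 b1 c1. x' = tensor3 a1 b c + tensor3 a b1 c + tensor3 a b c1"
proof -
  obtain g where g: "x' = curve_deriv g 0" "curve_in g (affine_cone segre)" "g 0 = tensor3 a b c"
    using assms(1) unfolding affine_tangent_space_def by blast
  then have "g 0 \<noteq> 0" using assms(2) by simp
  then obtain a' b' c' a1 b1 c1 where "g 0 = tensor3 a' b' c'"
     and d: "curve_deriv g 0 = tensor3 a1 b' c' + tensor3 a' b1 c' + tensor3 a' b' c1"
    using jet_of_curve[OF g(2)] by blast
  then obtain k l m where "a' = k *s a" "b' = l *s b" "c' = m *s c"
    using tensor3_eq_parallel[of a b c a' b' c'] g(3) assms(2) by metis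
  then have "x' = tensor3 ((l * m) *s a1) b c + tensor3 a ((k * m) *s b1) c + tensor3 a b ((k * l) *s c1)"
    using g(1) d by (simp add: tensor_eq_iff mult_ac)
  then show ?thesis by blast
qed

lemma tangent_vectorI:
  "tensor3 a1 b c + tensor3 a b1 c + tensor3 a b c1 \<in> affine_tangent_space segre (tensor3 a b c)"
proof -
  define g where "g t = tensor3 (a + t *s a1) (b + t *s b1) (c + t *s c1)" for t :: complex
  have "curve_in g (affine_cone segre)"
    unfolding g_def[abs_def]
    by (intro curve_in_tensor3) (auto simp: affine_cone_segre intro!: holomorphic_intros)
  moreover have "g 0 = tensor3 a b c" by (simp add: g_def)
  moreover have lin: "has_curve_deriv (\<lambda>t. u + t *s v) (0 + (1 *s v + 0 *s 0)) 0" for u v :: "complex^'x::finite"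
    by (intro has_curve_deriv_add has_curve_deriv_scale has_curve_deriv_const DERIV_ident)
  have "curve_deriv g 0 = tensor3 a1 b c + tensor3 a b1 c + tensor3 a b c1"
    using curve_deriv_eqI[OF has_curve_deriv_tensor3[OF lin lin lin], of a a1 b b1 c c1]
    unfolding g_def[abs_def] by simp
  ultimately show ?thesis unfolding affine_tangent_space_def by (auto intro!: exI[of _ g])
qed

lemma parallel_of_minors:
  fixes x x' :: "complex^'n::finite"
  assumes "x \<noteq> 0" "\<And>i j. x$i * x'$j = x$j * x'$i"
  shows "\<exists>l. x' = l *s x"
proof -
  obtain i where i: "x $ i \<noteq> 0" using assms(1) by (auto simp: vec_eq_iff)
  have "x' $ j = x' $ i / x $ i * x $ j" for j
    using i assms(2)[of i j] by (simp add: field_simps)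
  then have "x' = (x' $ i / x $ i) *s x" unfolding vec_eq_iff vector_smult_component by blast
  then show ?thesis by blast
qed

text \<open>In the flattening along the first factor the sum must have rank one, so either the first
  factors or the remaining products \<open>outer b c\<close> and \<open>outer b' c'\<close> are
  parallel.\<close>

lemma sum_decomposable_first:
  fixes a a' :: "complex^'a::finite" and b b' :: "complex^'b::finite" and c c' :: "complex^'c::finite"
  assumes sum: "\<exists>a'' b'' c''. tensor3 a b c + tensor3 a' b' c' = tensor3 a'' b'' c''"
    and nz: "tensor3 a b c \<noteq> 0" "tensor3 a' b' c' \<noteq> 0"
  shows "(\<exists>l. a' = l *s a) \<or> ((\<exists>l. b' = l *s b) \<and> (\<exists>m. c' = m *s c))"
proof -
  define v where "v = tensor3 a b c + tensor3 a' b' c'"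
  have n: "a \<noteq> 0" "b \<noteq> 0" "c \<noteq> 0" "b' \<noteq> 0" "c' \<noteq> 0" using nz by (auto simp: tensor3_eq_0)
  have "v$(i,j,k) * v$(i',j',k') = v$(i',j,k) * v$(i,j',k')" for i j k i' j' k'
    using sum unfolding v_def[symmetric] decomposable_iff by blast
  \<comment> \<open>The minor exchanging the first indices is a minor of \<open>a, a'\<close> times
    a minor of the two products, so one of the two families of minors vanishes.\<close>
  then have A: "(a$i * a'$i' - a$i' * a'$i) * (b$j * c$k * (b'$j' * c'$k') - b'$j * c'$k * (b$j' * c$k')) = 0"
    for i i' j j' k k'
    by (simp add: v_def algebra_simps)
  show ?thesis
  proof (cases "\<forall>i i'. a$i * a'$i' = a$i' * a'$i")
    case True
    then have "\<exists>l. a' = l *s a" by (intro parallel_of_minors n) simp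
    then show ?thesis ..
  next
    case False
    then obtain i i' where "a$i * a'$i' - a$i' * a'$i \<noteq> 0" by auto
    then have e: "b$j * c$k * (b'$j' * c'$k') = b'$j * c'$k * (b$j' * c$k')" for j j' k k'
      using A[of i i' j k j' k'] by simp
    obtain p q r s where nz: "b$p \<noteq> 0" "c$q \<noteq> 0" "b'$r \<noteq> 0" "c'$s \<noteq> 0" using n by (auto simp: vec_eq_iff)
    have "b$p * c$q * (b'$r * c'$s) \<noteq> 0" using nz by simp
    then have nz2: "b'$p \<noteq> 0" "c'$q \<noteq> 0" using e[of p q r s] by auto
    have "b$i * b'$j = b$j * b'$i" for i j using e[of i q j q] nz nz2 by (simp add: mult_ac)
    moreover have "c$i * c'$j = c$j * c'$i" for i j using e[of p i p j] nz nz2 by (simp add: mult_ac)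
    ultimately show ?thesis by (intro disjI2 conjI parallel_of_minors n)
  qed
qed

lemma sum_decomposable_parallel:
  fixes a a' :: "complex^'a::finite" and b b' :: "complex^'b::finite" and c c' :: "complex^'c::finite"
  assumes sum: "\<exists>a'' b'' c''. tensor3 a b c + tensor3 a' b' c' = tensor3 a'' b'' c''"
    and nz: "tensor3 a b c \<noteq> 0" "tensor3 a' b' c' \<noteq> 0"
  shows "((\<exists>l. b' = l *s b) \<and> (\<exists>m. c' = m *s c)) \<or> ((\<exists>l. a' = l *s a) \<and> (\<exists>m. c' = m *s c)) \<or>
    ((\<exists>l. a' = l *s a) \<and> (\<exists>m. b' = m *s b))"
proof -
  obtain a'' b'' c'' where "tensor3 a b c + tensor3 a' b' c' = tensor3 a'' b'' c''" using sum by blast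
  from arg_cong[OF this, of rotate]
  have "\<exists>b'' c'' a''. tensor3 b c a + tensor3 b' c' a' = tensor3 b'' c'' a''"
    unfolding rotate_add rotate_tensor3 by blast
  moreover have "tensor3 b c a \<noteq> 0" "tensor3 b' c' a' \<noteq> 0" using nz by (auto simp: tensor3_eq_0)
  ultimately have "(\<exists>l. b' = l *s b) \<or> ((\<exists>l. c' = l *s c) \<and> (\<exists>m. a' = m *s a))"
    by (rule sum_decomposable_first)
  then show ?thesis using sum_decomposable_first[OF assms] by argo
qed

text \<open>\<open>x + y\<close> lies on the line and is decomposable, so \<open>x\<close> and
  \<open>y\<close> agree up to scalars in two factors; the remaining factor decides the type of the
  form.\<close>

lemma any_line_of_tangents:
  fixes x y :: "complex^('a::finite \<times> 'b::finite \<times> 'c::finite)"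
  assumes nz: "x \<noteq> 0" "y \<noteq> 0" and line: "on_line_in segre (pt x) (pt y)"
    and tan: "x' \<in> affine_tangent_space segre x" "y' \<in> affine_tangent_space segre y"
  shows "is_any_line (x' + y')"
proof -
  obtain L where L: "vec.subspace L" "projectivization L \<subseteq> segre" "pt x \<in> projectivization L" "pt y \<in> projectivization L"
    using line unfolding on_line_in_def by blast
  have inL: "v \<in> L" if v: "pt v \<in> projectivization L" for v
  proof -
    obtain w where "w \<in> L" "pt v = pt w" using v unfolding projectivization_def by blast
    then show ?thesis using pt_eqD L(1) vec.subspace_scale by metis
  qed
  have dec: "\<exists>a b c. v = tensor3 a b c" if "v \<in> L" for v
  proof (cases "v = 0")
    case True
    then show ?thesis by (auto intro!: exI[of _ 0])
  next
    case False
    then have "pt v \<in> segre" using that L(2) unfolding projectivization_def by blast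
    then show ?thesis using pt_in_segre_iff False by blast
  qed
  have xy: "x \<in> L" "y \<in> L" using inL L by blast+
  obtain a b c where x: "x = tensor3 a b c" using dec xy by blast
  obtain a' b' c' where y: "y = tensor3 a' b' c'" using dec xy by blast
  have "\<exists>a'' b'' c''. tensor3 a b c + tensor3 a' b' c' = tensor3 a'' b'' c''"
    using dec[OF vec.subspace_add[OF L(1) xy]] unfolding x y .
  then have par: "((\<exists>l. b' = l *s b) \<and> (\<exists>m. c' = m *s c)) \<or> ((\<exists>l. a' = l *s a) \<and> (\<exists>m. c' = m *s c)) \<or>
    ((\<exists>l. a' = l *s a) \<and> (\<exists>m. b' = m *s b))"
    using nz unfolding x y by (rule sum_decomposable_parallel)
  obtain a1 b1 c1 where x': "x' = tensor3 a1 b c + tensor3 a b1 c + tensor3 a b c1"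
    using tangent_vector_form tan(1) nz(1) unfolding x by blast
  obtain a2 b2 c2 where y': "y' = tensor3 a2 b' c' + tensor3 a' b2 c' + tensor3 a' b' c2"
    using tangent_vector_form tan(2) nz(2) unfolding y by blast
  from par consider l m where "b' = l *s b" "c' = m *s c" | l m where "a' = l *s a" "c' = m *s c"
    | l m where "a' = l *s a" "b' = m *s b" by blast
  then show ?thesis
  proof cases
    case 1
    \<comment> \<open>The scalars \<open>l\<close>, \<open>m\<close> are absorbed by the velocities,
      and both velocities of the first factor are collected in the last vector.\<close>
    have "is_line (x' + y')"
      by (rule is_lineI[of _ a b1 c b c1 "a'" "m *s b2" "l *s c2" "a1 + (l * m) *s a2"])
         (simp add: x' y' 1 tensor_eq_iff algebra_simps)
    then show ?thesis by (simp add: is_any_line_def)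
  next
    case 2
    have "is_line (rotate (x' + y'))"
      by (rule is_lineI[of _ b c1 a c a1 "b'" "l *s c2" "m *s a2" "b1 + (l * m) *s b2"])
         (simp add: x' y' 2 tensor_eq_iff algebra_simps)
    then show ?thesis by (simp add: is_any_line_def)
  next
    case 3
    have "is_line (rotate (rotate (x' + y')))"
      by (rule is_lineI[of _ c a1 b a b1 "c'" "m *s a2" "l *s b2" "c1 + (l * m) *s c2"])
         (simp add: x' y' 3 tensor_eq_iff algebra_simps)
    then show ?thesis by (simp add: is_any_line_def)
  qed
qed

subsection \<open>Points of the two families\<close>

lemma osculating_form_in_osculating_points:
  assumes "pt T \<in> sigma3 segre" "is_osculating T"
  shows "pt T \<in> osculating_points segre"
proof -
  obtain y where "curve_in y (affine_cone segre)" "T = y 0 + curve_deriv y 0 + curve_deriv (curve_deriv y) 0"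
    using assms(2) curve_of_osculating_form unfolding is_osculating_def by metis
  then show ?thesis unfolding osculating_points_def using assms(1) by blast
qed

lemma osculating_pointsD:
  assumes "p \<in> osculating_points segre"
  shows "\<exists>T. p = pt T \<and> pt T \<in> sigma3 segre \<and> is_osculating T"
proof -
  obtain y where "p \<in> sigma3 segre" "curve_in y (affine_cone segre)"
    "p = pt (y 0 + curve_deriv y 0 + curve_deriv (curve_deriv y) 0)"
    using assms unfolding osculating_points_def by blast
  then show ?thesis using osculating_of_curve by blast
qed

lemma line_tangent_pointsD:
  assumes "p \<in> line_tangent_points segre"
  shows "\<exists>T. p = pt T \<and> pt T \<in> sigma3 segre \<and> is_any_line T"
proof -
  obtain x y x' y' where "p \<in> sigma3 segre" "x \<noteq> 0" "y \<noteq> 0" "on_line_in segre (pt x) (pt y)"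
     "x' \<in> affine_tangent_space segre x" "y' \<in> affine_tangent_space segre y" "p = pt (x' + y')"
    using assms unfolding line_tangent_points_def by blast
  then show ?thesis using any_line_of_tangents by blast
qed

lemma line_form_in_line_tangent_points:
  assumes "pt (line_form a b c) \<in> sigma3 segre" "independent3 a" "independent3 b" "independent3 c"
  shows "pt (line_form a b c) \<in> line_tangent_points segre"
proof -
  define x where "x = tensor3 (a 1) (b 1) (c 1)"
  define y where "y = tensor3 (a 2) (b 1) (c 1)"
  let ?x' = "tensor3 (a 3) (b 1) (c 1) + tensor3 (a 1) (b 2) (c 1) + tensor3 (a 1) (b 1) (c 2)"
  let ?y' = "tensor3 0 (b 1) (c 1) + tensor3 (a 2) (b 3) (c 1) + tensor3 (a 2) (b 1) (c 3)"
  let ?L = "vec.span {x, y}"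
  note nz = assms(2-4)[THEN independent3_nonzero(4)] assms(2)[THEN independent3_nonzero(5)]
  have xy: "x \<noteq> 0" "y \<noteq> 0" using nz by (simp_all add: x_def y_def tensor3_eq_0)
  have seg: "pt x \<in> segre" "pt y \<in> segre" using pt_tensor3_in_segre nz by (auto simp: x_def y_def)
  have xny: "x \<notin> vec.span {y}"
  proof
    assume "x \<in> vec.span {y}"
    then obtain k where "x = k *s y" by (auto simp: vec.span_singleton)
    then have "tensor3 (a 1 + (- k) *s a 2) (b 1) (c 1) = 0"
      by (simp add: x_def y_def tensor_eq_iff algebra_simps)
    then show False using nz independent3_nonzero(3)[OF assms(2), of "- k"] by (simp add: tensor3_eq_0)
  qed
  then have "vec.independent {x, y}" "x \<noteq> y" using xy vec.span_base[of y "{y}"]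
    by (auto simp: vec.independent_insert)
  then have "vec.dim ?L = 2" using vec.dim_span_eq_card_independent[of "{x, y}"] by simp
  moreover have "projectivization ?L \<subseteq> segre"
  proof
    fix p assume "p \<in> projectivization ?L"
    then obtain v where v: "v \<in> ?L" "v \<noteq> 0" "p = pt v" unfolding projectivization_def by blast
    then obtain k l where "v - k *s x = l *s y" by (auto simp: vec.span_breakdown_eq vec.span_singleton)
    then have "v = tensor3 (k *s a 1 + l *s a 2) (b 1) (c 1)"
      by (simp add: x_def y_def tensor_eq_iff vec_eq_iff algebra_simps)
    then show "p \<in> segre" using v pt_in_segre_iff by blast
  qed
  moreover have "x \<in> ?L" "y \<in> ?L" by (simp_all add: vec.span_base)
  then have "pt x \<in> projectivization ?L" "pt y \<in> projectivization ?L"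
    unfolding projectivization_def using xy by blast+
  ultimately have "on_line_in segre (pt x) (pt y)"
    unfolding on_line_in_def using vec.subspace_span by blast
  moreover have "?x' \<in> affine_tangent_space segre x" "?y' \<in> affine_tangent_space segre y"
    unfolding x_def y_def by (rule tangent_vectorI)+
  moreover have "line_form a b c = ?x' + ?y'" by (simp add: line_form_def)
  ultimately show ?thesis unfolding line_tangent_points_def using assms(1) xy seg by auto
qed

lemma affine_tangent_space_rotate:
  assumes "x' \<in> affine_tangent_space segre x"
  shows "rotate x' \<in> affine_tangent_space segre (rotate x)"
proof -
  obtain g where g: "x' = curve_deriv g 0" "curve_in g (affine_cone segre)" "g 0 = x"
    using assms unfolding affine_tangent_space_def by blast
  have "curve_in (\<lambda>t. rotate (g t)) (affine_cone segre)"
    using g(2) by (rule curve_in_rotate) (auto simp: affine_cone_segre, blast)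
  moreover have "curve_deriv (\<lambda>t. rotate (g t)) 0 = rotate x'"
    by (simp add: g(1) curve_deriv_def tensor_eq_iff)
  ultimately show ?thesis unfolding affine_tangent_space_def mem_Collect_eq
    by (intro exI[of _ "\<lambda>t. rotate (g t)"]) (simp add: g(3))
qed

lemma on_line_in_rotate:
  assumes "on_line_in segre (pt x) (pt y)"
  shows "on_line_in segre (pt (rotate x)) (pt (rotate y))"
proof -
  obtain L where L: "vec.subspace L" "vec.dim L = 2" "projectivization L \<subseteq> segre"
    "pt x \<in> projectivization L" "pt y \<in> projectivization L"
    using assms unfolding on_line_in_def by blast
  have "rotate ` L = vec.span (rotate ` L)"
    unfolding span_rotate using L(1) by (simp add: vec.span_eq_iff[THEN iffD2])
  then have "vec.subspace (rotate ` L)" using vec.subspace_span by metis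
  moreover have "vec.dim (rotate ` L) = 2" by (simp add: dim_rotate L)
  moreover have "projectivization (rotate ` L) \<subseteq> segre"
  proof
    fix p assume "p \<in> projectivization (rotate ` L)"
    then obtain w where "w \<in> L" "rotate w \<noteq> 0" "p = pt (rotate w)" unfolding projectivization_def by blast
    moreover then have "pt w \<in> segre" using L(3) unfolding projectivization_def by auto
    ultimately show "p \<in> segre" using segre_rotate by auto
  qed
  moreover have "pt (rotate v) \<in> projectivization (rotate ` L)" if v: "pt v \<in> projectivization L" for v
  proof -
    obtain w where w: "w \<in> L" "w \<noteq> 0" "pt v = pt w" using v unfolding projectivization_def by blast
    then have "pt (rotate v) = pt (rotate w)" by (simp add: pt_rotate)
    moreover have "rotate w \<noteq> 0" using w by simp
    ultimately show ?thesis unfolding projectivization_def using w(1) by blast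
  qed
  ultimately show ?thesis unfolding on_line_in_def using L(4,5) by blast
qed

lemma line_tangent_points_rotate:
  assumes "pt T \<in> line_tangent_points segre"
  shows "pt (rotate T) \<in> line_tangent_points segre"
proof -
  obtain x y x' y' where *: "pt T \<in> sigma3 segre" "x \<noteq> 0" "y \<noteq> 0" "pt x \<in> segre" "pt y \<in> segre"
     "on_line_in segre (pt x) (pt y)"
     "x' \<in> affine_tangent_space segre x" "y' \<in> affine_tangent_space segre y" "pt T = pt (x' + y')"
    using assms unfolding line_tangent_points_def by blast
  have "pt (rotate T) = pt (rotate x' + rotate y')"
    using *(9) by (simp add: pt_rotate flip: rotate_add)
  moreover have "rotate x \<noteq> 0" "rotate y \<noteq> 0" using * by simp_all
  ultimately show ?thesis unfolding line_tangent_points_def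
    using sigma3_rotate[OF *(1)] segre_rotate[OF *(2,4)] segre_rotate[OF *(3,5)] on_line_in_rotate[OF *(6)]
      affine_tangent_space_rotate[OF *(7)] affine_tangent_space_rotate[OF *(8)] by blast
qed

lemma concise_line_in_line_tangent_points:
  assumes "pt T \<in> sigma3 segre" "concise T" "is_any_line T"
  shows "pt T \<in> line_tangent_points segre"
proof -
  consider a b c where "T = line_form a b c" | a b c where "T = rotate (line_form a b c)"
    | a b c where "T = rotate (rotate (line_form a b c))"
    using assms(3) unfolding is_any_line_iff by blast
  then show ?thesis
  proof cases
    case 1
    then show ?thesis
      using assms(1,2) by (auto intro!: line_form_in_line_tangent_points dest: concise_line_independent)
  next
    case 2
    have "pt (line_form a b c) \<in> sigma3 segre"
      using sigma3_rotate[OF sigma3_rotate[OF assms(1)]] by (simp add: 2)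
    then have "pt (line_form a b c) \<in> line_tangent_points segre"
      using assms(2) by (intro line_form_in_line_tangent_points concise_line_independent) (simp_all add: 2)
    then show ?thesis unfolding 2 by (rule line_tangent_points_rotate)
  next
    case 3
    have "pt (line_form a b c) \<in> sigma3 segre"
      using sigma3_rotate[OF assms(1)] by (simp add: 3)
    then have "pt (line_form a b c) \<in> line_tangent_points segre"
      using assms(2) by (intro line_form_in_line_tangent_points concise_line_independent) (simp_all add: 3)
    then show ?thesis unfolding 3 by (intro line_tangent_points_rotate)
  qed
qed

lemma is_osculating_scale: "is_osculating T \<Longrightarrow> is_osculating (k *s T)"
  unfolding is_osculating_def
proof (elim exE)
  fix a b c assume "T = osculating_form a b c"
  then have "k *s T = osculating_form (\<lambda>i. k *s a i) b c"
    by (simp add: tensor_eq_iff osculating_form_def algebra_simps)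
  then show "\<exists>a b c. k *s T = osculating_form a b c" by blast
qed

lemma is_any_line_scale:
  assumes "is_any_line T"
  shows "is_any_line (k *s T)"
proof -
  have scale: "is_line (k *s S)" if S: "is_line S" for S :: "complex^('x::finite \<times> 'y::finite \<times> 'z::finite)"
  proof -
    obtain a b c where "S = line_form a b c" using S is_line_def by blast
    then have "k *s S = line_form (\<lambda>i. k *s a i) b c"
      by (simp add: tensor_eq_iff line_form_def algebra_simps)
    then show ?thesis using is_line_def by blast
  qed
  from assms show ?thesis
    unfolding is_any_line_def rotate_scale by (elim disjE) (simp_all add: scale)
qed

text \<open>Scaling is \<open>map_first\<close> with a scalar matrix, under which no multilinear
  rank increases.\<close>

lemma concise_scaleD:
  assumes "concise (k *s T)"
  shows "concise T"
proof -
  have "k *s T = map_first (k *k mat 1) T"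
    by (simp add: tensor_eq_iff mat_def if_distrib if_distribR cong: if_cong)
  then show ?thesis
    using assms dim_fibers_map_first_le[of "k *k mat 1" T] dim_fibers_rotate_map_first_le[of "k *k mat 1" T]
      dim_fibers_rotate_rotate_map_first_le[of "k *k mat 1" T]
    unfolding concise_def by (metis order_trans)
qed

subsection \<open>The Zariski topology\<close>

lemma hom_poly_scale: "hom_poly d f \<Longrightarrow> f (k *s v) = k^d * f v"
  by (induction rule: hom_poly.induct) (simp_all add: distrib_left power_add)

lemma hom_poly_tendsto: "hom_poly d f \<Longrightarrow> (T \<longlongrightarrow> v) F \<Longrightarrow> ((\<lambda>s. f (T s)) \<longlongrightarrow> f v) F"
  by (induction rule: hom_poly.induct) (auto intro!: tendsto_add tendsto_mult tendsto_vec_nth)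

lemma hom_poly_0: "hom_poly d (\<lambda>v :: complex^'n::finite. 0)"
proof (induction d)
  case 0
  then show ?case by (rule hom_poly.const)
next
  case (Suc d)
  have "hom_poly (d + 1) (\<lambda>v :: complex^'n. 0 * v $ undefined)"
    using Suc hom_poly.coord by (rule hom_poly.mult)
  then show ?case by simp
qed

lemma hom_poly_cmult: "hom_poly d f \<Longrightarrow> hom_poly d (\<lambda>v. k * f v)"
  using hom_poly.mult[OF hom_poly.const] by fastforce

lemma hom_poly_diff:
  assumes "hom_poly d f" "hom_poly d g"
  shows "hom_poly d (\<lambda>v. f v - g v)"
  using hom_poly.add[OF assms(1) hom_poly_cmult[OF assms(2), of "-1"]] by simp

lemma hom_poly_sum: "finite A \<Longrightarrow> (\<And>i. i \<in> A \<Longrightarrow> hom_poly d (f i)) \<Longrightarrow> hom_poly d (\<lambda>v. \<Sum>i\<in>A. f i v)"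
  by (induction rule: finite_induct) (simp_all add: hom_poly_0 hom_poly.add)

lemma hom_poly_det3:
  assumes h: "\<And>m n. hom_poly 1 (\<lambda>v. A v $ m $ n)"
  shows "hom_poly 3 (\<lambda>v. det (A v :: complex^3^3))"
proof -
  have "hom_poly (1 + 1 + 1) (\<lambda>v. A v $ i $ j * A v $ k $ l * A v $ m $ n)" for i j k l m n
    by (intro hom_poly.mult h)
  then have "hom_poly 3 (\<lambda>v. A v $ i $ j * A v $ k $ l * A v $ m $ n)" for i j k l m n
    by (simp add: numeral_3_eq_3)
  then show ?thesis unfolding det_3 by (intro hom_poly.add hom_poly_diff)
qed

lemma hom_poly_rotate: "hom_poly d f \<Longrightarrow> hom_poly d (\<lambda>v. f (rotate v))"
proof (induction rule: hom_poly.induct)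
  case (coord i)
  then show ?case by (cases i) (simp del: One_nat_def add: hom_poly.coord)
qed (auto intro: hom_poly.intros)

text \<open>A 3 by 3 minor of fixed fibers, taken after a projection \<open>Q\<close> adapted to
  \<open>T\<close>, certifies rank at least three wherever it does not vanish.\<close>

lemma hom_poly_dim_fibers:
  fixes T :: "complex^('a::finite \<times> 'b::finite \<times> 'c::finite)"
  assumes "3 \<le> vec.dim (fibers T)"
  shows "\<exists>f. hom_poly 3 f \<and> f T \<noteq> 0 \<and> (\<forall>S. f S \<noteq> 0 \<longrightarrow> 3 \<le> vec.dim (fibers S))"
proof -
  have "CARD(3) \<le> vec.dim (fibers T)" using assms by simp
  then obtain Q :: "complex^'a^3" and g where Q: "\<And>m. Q *v fiber T (fst (g m)) (snd (g m)) = axis m 1"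
    using ex_independent_fibers by blast
  define G where "G S = (\<chi> m n. (Q *v fiber S (fst (g n)) (snd (g n))) $ m :: complex^3^3)" for S
  have "hom_poly 3 (\<lambda>S. det (G S))"
    by (rule hom_poly_det3)
       (simp del: One_nat_def add: G_def matrix_vector_mult_def hom_poly_sum hom_poly_cmult hom_poly.coord)
  moreover have "G T = mat 1" by (simp add: G_def vec_eq_iff mat_def axis_def Q)
  then have "det (G T) \<noteq> 0" by simp
  moreover have "3 \<le> vec.dim (fibers S)" if d: "det (G S) \<noteq> 0" for S
  proof -
    let ?l = "\<lambda>n. fiber S (fst (g n)) (snd (g n))"
    obtain B where B: "B ** G S = mat 1" using d invertible_det_nz invertible_left_inverse by blast
    have "G S *v axis m 1 = Q *v ?l m" for m by (simp add: vec_eq_iff matrix_mult_axis G_def)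
    then have "(B ** Q) *v ?l m = axis m 1" for m
      by (metis B matrix_vector_mul_assoc matrix_vector_mul_lid)
    then have "independent3 ?l" unfolding independent3_def by blast
    then have "3 = vec.dim (vec.span {?l 1, ?l 2, ?l 3})" by (rule independent3_insert[symmetric])
    also have "\<dots> \<le> vec.dim (fibers S)" by (simp add: vec.dim_subset)
    finally show ?thesis .
  qed
  ultimately show ?thesis by blast
qed

lemma openin_zariski_basic: "hom_poly d f \<Longrightarrow> openin zariski {pt v | v. v \<noteq> 0 \<and> f v \<noteq> 0}"
  unfolding zariski_def by (rule topology_generated_by_Basis) blast

lemma pt_in_topspace_zariski: "v \<noteq> 0 \<Longrightarrow> pt v \<in> topspace zariski"
  using openin_subset[OF openin_zariski_basic[OF hom_poly.const[of 1]]] by auto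

definition concise_points :: "(complex^('a::finite \<times> 'b::finite \<times> 'c::finite)) set set" where
  "concise_points = {pt v | v. v \<noteq> 0 \<and> concise v}"

lemma openin_concise_points: "openin zariski concise_points"
proof (subst openin_subopen, intro ballI)
  fix p :: "(complex^('a::finite \<times> 'b::finite \<times> 'c::finite)) set"
  assume "p \<in> concise_points"
  then obtain T where T: "p = pt T" "T \<noteq> 0" "concise T" unfolding concise_points_def by blast
  obtain f where f: "hom_poly 3 f" "f T \<noteq> 0" "\<forall>S. f S \<noteq> 0 \<longrightarrow> 3 \<le> vec.dim (fibers S)"
    using hom_poly_dim_fibers[of T] T(3) unfolding concise_def by blast
  obtain g where g: "hom_poly 3 g" "g (rotate T) \<noteq> 0" "\<forall>S. g S \<noteq> 0 \<longrightarrow> 3 \<le> vec.dim (fibers S)"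
    using hom_poly_dim_fibers[of "rotate T"] T(3) unfolding concise_def by blast
  obtain h where h: "hom_poly 3 h" "h (rotate (rotate T)) \<noteq> 0" "\<forall>S. h S \<noteq> 0 \<longrightarrow> 3 \<le> vec.dim (fibers S)"
    using hom_poly_dim_fibers[of "rotate (rotate T)"] T(3) unfolding concise_def by blast
  let ?F = "\<lambda>S. f S * g (rotate S) * h (rotate (rotate S))"
  have "hom_poly (3 + 3 + 3) ?F"
    by (intro hom_poly.mult f hom_poly_rotate[OF g(1)] hom_poly_rotate[OF hom_poly_rotate[OF h(1)]])
  then have "openin zariski {pt v | v. v \<noteq> 0 \<and> ?F v \<noteq> 0}" by (rule openin_zariski_basic)
  moreover have "p \<in> {pt v | v. v \<noteq> 0 \<and> ?F v \<noteq> 0}" using T f g h by auto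
  moreover have "{pt v | v. v \<noteq> 0 \<and> ?F v \<noteq> 0} \<subseteq> concise_points"
    using f(3) g(3) h(3) unfolding concise_points_def concise_def by auto
  ultimately show "\<exists>U. openin zariski U \<and> p \<in> U \<and> U \<subseteq> concise_points" by blast
qed

lemma concise_pointsD:
  assumes "pt T \<in> concise_points"
  shows "concise T"
proof -
  obtain v where v: "pt v = pt T" "concise v" using assms unfolding concise_points_def by auto
  then obtain k where "v = k *s T" using pt_eqD by blast
  with v(2) show ?thesis using concise_scaleD by blast
qed

text \<open>Zariski open sets are open in the classical topology as well, so approximation by
  convergent families suffices for Zariski density.\<close>

lemma zariski_open_eventually:
  assumes "openin zariski U" "pt v \<in> U" "v \<noteq> 0" "(T \<longlongrightarrow> v) F"
  shows "\<forall>\<^sub>F s in F. pt (T s) \<in> U"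
proof -
  have "generate_topology_on {{pt v | v. v \<noteq> 0 \<and> f v \<noteq> 0} | f. \<exists>d. hom_poly d f} U"
    using assms(1) unfolding zariski_def by (simp add: openin_topology_generated_by_iff)
  then show ?thesis using assms(2)
  proof induction
    case Empty
    then show ?case by simp
  next
    case (Int a b)
    then show ?case by (simp add: eventually_conj_iff)
  next
    case (UN K)
    then obtain k where k: "k \<in> K" "pt v \<in> k" by blast
    then have "\<forall>\<^sub>F s in F. pt (T s) \<in> k" using UN by blast
    then show ?case by eventually_elim (use k in blast)
  next
    case (Basis s)
    then obtain f d where f: "s = {pt v | v. v \<noteq> 0 \<and> f v \<noteq> 0}" "hom_poly d f" by blast
    with Basis obtain w where w: "pt v = pt w" "f w \<noteq> 0" by blast
    then obtain k where k: "v = k *s w" using pt_eqD by blast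
    with assms(3) have "k \<noteq> 0" by auto
    then have "f v \<noteq> 0" using w(2) by (simp add: k hom_poly_scale[OF f(2)])
    then have "\<forall>\<^sub>F s in F. f (T s) \<noteq> 0" using hom_poly_tendsto[OF f(2) assms(4)] by (rule tendsto_imp_eventually_ne[rotated])
    moreover have "\<forall>\<^sub>F s in F. T s \<noteq> 0" using assms(3,4) by (intro tendsto_imp_eventually_ne)
    ultimately show ?case unfolding f(1) by eventually_elim blast
  qed
qed

subsection \<open>Density of the points of rank five\<close>

text \<open>Adding \<open>s\<close> times distinct unit vectors makes a 3 by 3 minor of the frame a
  monic cubic in \<open>s\<close>, which has only finitely many zeros.\<close>

lemma ex_independent_perturbation:
  fixes a :: "3 \<Rightarrow> complex^'a::finite"
  assumes "3 \<le> CARD('a)"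
  shows "\<exists>A. (\<forall>i. (A i \<longlongrightarrow> a i) (at (0::complex))) \<and> (\<forall>\<^sub>F s in at 0. independent3 (\<lambda>i. A i s))"
proof -
  obtain e :: "3 \<Rightarrow> 'a" where e: "inj e"
    using card_le_inj[of "UNIV :: 3 set" "UNIV :: 'a set"] assms by auto
  define A where "A i s = a i + s *s axis (e i) 1" for i and s :: complex
  define P :: "complex^'a^3" where "P = (\<chi> m r. if r = e m then 1 else 0)"
  define G :: "complex^3^3" where "G = (\<chi> m i. (P *v a i) $ m)"
  have "(A i \<longlongrightarrow> a i + 0 *s axis (e i) 1) (at 0)" for i
    unfolding A_def[abs_def] by (intro tendsto_add tendsto_smult_vec tendsto_const tendsto_ident_at)
  then have lim: "\<forall>i. (A i \<longlongrightarrow> a i) (at 0)" by simp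
  have PA: "P *v A i s = (G + s *k mat 1) *v axis i 1" for i s
  proof -
    have "(P *v axis (e i) 1) $ m = mat 1 $ m $ i" for m
      using e by (auto simp: matrix_mult_axis P_def mat_def inj_eq)
    then show ?thesis
      by (simp add: vec_eq_iff matrix_mult_axis A_def matrix_vector_right_distrib vec.scale G_def)
  qed
  \<comment> \<open>The coefficients of \<open>det_pencil\<close> with \<open>mat 1\<close> as
    second matrix; the leading coefficient 1 makes the polynomial nonzero.\<close>
  let ?p = "[:det G, trace (adj3 G ** mat 1), trace (G ** adj3 (mat 1)), 1:]"
  have "poly ?p s = det (G + s *k mat 1)" for s
    by (simp add: det_pencil power2_eq_square power3_eq_cube algebra_simps)
  moreover have "finite {s. poly ?p s = 0}" by (rule poly_roots_finite) simp
  ultimately have fin: "finite {s. det (G + s *k mat 1) = 0}" by simp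
  have "\<forall>\<^sub>F s in at 0. det (G + s *k mat 1) \<noteq> 0"
    unfolding eventually_at_topological
  proof (intro exI conjI)
    show "open (- ({s. det (G + s *k mat 1) = 0} - {0}))"
      by (intro open_Compl finite_imp_closed finite_Diff fin)
  qed auto
  then have "\<forall>\<^sub>F s in at 0. independent3 (\<lambda>i. A i s)"
  proof eventually_elim
    case (elim s)
    then obtain B where B: "B ** (G + s *k mat 1) = mat 1" using invertible_det_nz invertible_left_inverse by blast
    then have "(B ** P) *v A m s = axis m 1" for m
      by (metis PA matrix_vector_mul_assoc matrix_vector_mul_lid)
    then show ?case unfolding independent3_def by blast
  qed
  with lim show ?thesis by blast
qed

lemma ex_independent_perturbations:
  fixes a :: "3 \<Rightarrow> complex^'a::finite" and b :: "3 \<Rightarrow> complex^'b::finite" and c :: "3 \<Rightarrow> complex^'c::finite"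
  assumes "3 \<le> CARD('a)" "3 \<le> CARD('b)" "3 \<le> CARD('c)"
  shows "\<exists>A B C. (\<forall>i. (A i \<longlongrightarrow> a i) (at (0::complex)) \<and> (B i \<longlongrightarrow> b i) (at 0) \<and> (C i \<longlongrightarrow> c i) (at 0)) \<and>
     (\<forall>\<^sub>F s in at 0. independent3 (\<lambda>i. A i s) \<and> independent3 (\<lambda>i. B i s) \<and> independent3 (\<lambda>i. C i s))"
  using ex_independent_perturbation[OF assms(1), of a] ex_independent_perturbation[OF assms(2), of b]
    ex_independent_perturbation[OF assms(3), of c] unfolding eventually_conj_iff by fast

lemma osculating_approximation:
  fixes T :: "complex^('a::finite \<times> 'b::finite \<times> 'c::finite)"
  assumes "is_osculating T" and dims: "3 \<le> CARD('a)" "3 \<le> CARD('b)" "3 \<le> CARD('c)"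
  shows "\<exists>S. (S \<longlongrightarrow> T) (at (0::complex)) \<and> (\<forall>\<^sub>F s in at 0. concise (S s) \<and> pt (S s) \<in> osculating_points segre)"
proof -
  obtain a b c where T: "T = osculating_form a b c" using assms(1) is_osculating_def by blast
  obtain A :: "3 \<Rightarrow> complex \<Rightarrow> complex^'a" and B :: "3 \<Rightarrow> complex \<Rightarrow> complex^'b" and C :: "3 \<Rightarrow> complex \<Rightarrow> complex^'c"
    where lim: "\<And>i. (A i \<longlongrightarrow> a i) (at 0)" "\<And>i. (B i \<longlongrightarrow> b i) (at 0)" "\<And>i. (C i \<longlongrightarrow> c i) (at 0)"
    and ev: "\<forall>\<^sub>F s in at 0. independent3 (\<lambda>i. A i s) \<and> independent3 (\<lambda>i. B i s) \<and> independent3 (\<lambda>i. C i s)"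
    using ex_independent_perturbations[OF dims, of a b c] by blast
  define S where "S s = osculating_form (\<lambda>i. A i s) (\<lambda>i. B i s) (\<lambda>i. C i s)" for s
  have "(S \<longlongrightarrow> T) (at 0)"
    unfolding S_def[abs_def] T osculating_form_def by (intro tendsto_add tendsto_tensor3 lim)
  moreover have "\<forall>\<^sub>F s in at 0. concise (S s) \<and> pt (S s) \<in> osculating_points segre"
    using ev
  proof eventually_elim
    case (elim s)
    then have ind: "independent3 (\<lambda>i. A i s)" "independent3 (\<lambda>i. B i s)" "independent3 (\<lambda>i. C i s)" by auto
    have "is_osculating (S s)" unfolding is_osculating_def S_def by blast
    then show ?case
      using concise_osculating_form[OF ind] osculating_form_in_sigma3[OF ind] osculating_form_in_osculating_points
      unfolding S_def by blast
  qed
  ultimately show ?thesis by blast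
qed

lemma line_form_approximation:
  fixes a :: "3 \<Rightarrow> complex^'a::finite" and b :: "3 \<Rightarrow> complex^'b::finite" and c :: "3 \<Rightarrow> complex^'c::finite"
  assumes dims: "3 \<le> CARD('a)" "3 \<le> CARD('b)" "3 \<le> CARD('c)"
  shows "\<exists>S. (S \<longlongrightarrow> line_form a b c) (at (0::complex)) \<and>
     (\<forall>\<^sub>F s in at 0. concise (S s) \<and> pt (S s) \<in> line_tangent_points segre)"
proof -
  obtain A :: "3 \<Rightarrow> complex \<Rightarrow> complex^'a" and B :: "3 \<Rightarrow> complex \<Rightarrow> complex^'b" and C :: "3 \<Rightarrow> complex \<Rightarrow> complex^'c"
    where lim: "\<And>i. (A i \<longlongrightarrow> a i) (at 0)" "\<And>i. (B i \<longlongrightarrow> b i) (at 0)" "\<And>i. (C i \<longlongrightarrow> c i) (at 0)"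
    and ev: "\<forall>\<^sub>F s in at 0. independent3 (\<lambda>i. A i s) \<and> independent3 (\<lambda>i. B i s) \<and> independent3 (\<lambda>i. C i s)"
    using ex_independent_perturbations[OF dims, of a b c] by blast
  define S where "S s = line_form (\<lambda>i. A i s) (\<lambda>i. B i s) (\<lambda>i. C i s)" for s
  have "(S \<longlongrightarrow> line_form a b c) (at 0)"
    unfolding S_def[abs_def] line_form_def by (intro tendsto_add tendsto_tensor3 lim)
  moreover have "\<forall>\<^sub>F s in at 0. concise (S s) \<and> pt (S s) \<in> line_tangent_points segre"
    using ev
  proof eventually_elim
    case (elim s)
    then have ind: "independent3 (\<lambda>i. A i s)" "independent3 (\<lambda>i. B i s)" "independent3 (\<lambda>i. C i s)" by auto
    show ?case unfolding S_def
      using concise_line_form[OF ind] line_form_in_line_tangent_points[OF line_form_in_sigma3[OF ind] ind] by blast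
  qed
  ultimately show ?thesis by blast
qed

lemma line_approximation:
  fixes T :: "complex^('a::finite \<times> 'b::finite \<times> 'c::finite)"
  assumes "is_any_line T" and dims: "3 \<le> CARD('a)" "3 \<le> CARD('b)" "3 \<le> CARD('c)"
  shows "\<exists>S. (S \<longlongrightarrow> T) (at (0::complex)) \<and> (\<forall>\<^sub>F s in at 0. concise (S s) \<and> pt (S s) \<in> line_tangent_points segre)"
proof -
  have rot: "\<exists>S. (S \<longlongrightarrow> rotate T) (at (0::complex)) \<and> (\<forall>\<^sub>F s in at 0. concise (S s) \<and> pt (S s) \<in> line_tangent_points segre)"
    if S: "\<exists>S. (S \<longlongrightarrow> T) (at (0::complex)) \<and> (\<forall>\<^sub>F s in at 0. concise (S s) \<and> pt (S s) \<in> line_tangent_points segre)"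
    for T :: "complex^('x::finite \<times> 'y::finite \<times> 'z::finite)"
  proof -
    obtain S where S: "(S \<longlongrightarrow> T) (at (0::complex))" "\<forall>\<^sub>F s in at 0. concise (S s) \<and> pt (S s) \<in> line_tangent_points segre"
      using S by blast
    have "\<forall>\<^sub>F s in at 0. concise (rotate (S s)) \<and> pt (rotate (S s)) \<in> line_tangent_points segre"
      using S(2) by eventually_elim (simp add: line_tangent_points_rotate)
    then show ?thesis using tendsto_rotate[OF S(1)] by blast
  qed
  from assms(1) show ?thesis
    unfolding is_any_line_iff
  proof (elim disjE exE)
    fix a b c assume T: "T = line_form a b c"
    show ?thesis unfolding T by (rule line_form_approximation[OF dims])
  next
    fix a b c assume T: "T = rotate (line_form a b c)"
    show ?thesis unfolding T by (intro rot line_form_approximation dims)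
  next
    fix a b c assume T: "T = rotate (rotate (line_form a b c))"
    show ?thesis unfolding T by (intro rot line_form_approximation dims)
  qed
qed

lemma subset_closure_of_concise:
  assumes "\<And>p. p \<in> Z \<Longrightarrow> \<exists>T. p = pt T \<and> T \<noteq> 0 \<and>
     (\<exists>S. (S \<longlongrightarrow> T) (at (0::complex)) \<and> (\<forall>\<^sub>F s in at 0. concise (S s) \<and> pt (S s) \<in> Z))"
  shows "Z \<subseteq> zariski closure_of (concise_points \<inter> Z)"
proof
  fix p assume "p \<in> Z"
  then obtain T S where T: "p = pt T" "T \<noteq> 0" and S: "(S \<longlongrightarrow> T) (at (0::complex))"
     "\<forall>\<^sub>F s in at 0. concise (S s) \<and> pt (S s) \<in> Z" using assms by blast
  have "\<exists>q. q \<in> concise_points \<inter> Z \<and> q \<in> U" if U: "p \<in> U" "openin zariski U" for U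
  proof -
    have "\<forall>\<^sub>F s in at 0. pt (S s) \<in> U" using zariski_open_eventually[OF U(2) _ T(2) S(1)] U(1) T(1) by simp
    moreover have "\<forall>\<^sub>F s in at 0. S s \<noteq> 0" using S(1) T(2) by (rule tendsto_imp_eventually_ne)
    ultimately have "\<forall>\<^sub>F s in at 0. pt (S s) \<in> concise_points \<inter> Z \<and> pt (S s) \<in> U"
      using S(2) by eventually_elim (auto simp: concise_points_def)
    then show ?thesis using eventually_happens[of _ "at (0::complex)"] by (metis (no_types, lifting) at_neq_bot)
  qed
  then show "p \<in> zariski closure_of (concise_points \<inter> Z)"
    using pt_in_topspace_zariski[OF T(2)] T(1) by (auto simp: in_closure_of)
qed

theorem theorem1p8:
  fixes X :: "(complex^('a::finite \<times> 'b::finite \<times> 'c::finite)) set set"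
  assumes X: "X = segre"
    and dims: "CARD('a) \<ge> 2" "CARD('b) \<ge> 2" "CARD('c) \<ge> 2"
  shows "(\<exists>U V.
      openin (subtopology zariski (osculating_points X)) U \<and>
      openin (subtopology zariski (line_tangent_points X)) V \<and>
      (CARD('a) \<ge> 3 \<and> CARD('b) \<ge> 3 \<and> CARD('c) \<ge> 3 \<longrightarrow>
         osculating_points X \<subseteq> zariski closure_of U \<and>
         line_tangent_points X \<subseteq> zariski closure_of V) \<and>
      (\<forall>T. pt T \<in> U \<longrightarrow> tensor_rank T = 5) \<and>
      (\<forall>T. pt T \<in> V \<longrightarrow> tensor_rank T = 5) \<and>
      (\<forall>T. pt T \<in> sigma3 X \<and> pt T \<notin> U \<union> V \<longrightarrow> tensor_rank T < 5)) \<and>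
      (\<forall>T. pt T \<in> sigma3 X \<longrightarrow> tensor_rank T \<le> 5) \<and>
      (CARD('a) \<ge> 3 \<and> CARD('b) \<ge> 3 \<and> CARD('c) \<ge> 3 \<longrightarrow>
         (\<exists>T. pt T \<in> sigma3 X \<and> tensor_rank T = 5))"
proof -
  define U where "U = concise_points \<inter> osculating_points X"
  define V where "V = concise_points \<inter> line_tangent_points X"
  have open': "openin (subtopology zariski (osculating_points X)) U"
    "openin (subtopology zariski (line_tangent_points X)) V"
    unfolding U_def V_def openin_subtopology using openin_concise_points by blast+
  have dense: "osculating_points X \<subseteq> zariski closure_of U \<and> line_tangent_points X \<subseteq> zariski closure_of V"
    if "CARD('a) \<ge> 3 \<and> CARD('b) \<ge> 3 \<and> CARD('c) \<ge> 3"
  proof -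
    have "\<exists>T. p = pt T \<and> T \<noteq> 0 \<and>
       (\<exists>S. (S \<longlongrightarrow> T) (at (0::complex)) \<and> (\<forall>\<^sub>F s in at 0. concise (S s) \<and> pt (S s) \<in> osculating_points X))"
      if p: "p \<in> osculating_points X" for p
    proof -
      obtain T where T: "p = pt T" "pt T \<in> sigma3 segre" "is_osculating T"
        using osculating_pointsD p X by blast
      then show ?thesis
        using sigma3_nonzero osculating_approximation \<open>CARD('a) \<ge> 3 \<and> CARD('b) \<ge> 3 \<and> CARD('c) \<ge> 3\<close> X by blast
    qed
    moreover have "\<exists>T. p = pt T \<and> T \<noteq> 0 \<and>
       (\<exists>S. (S \<longlongrightarrow> T) (at (0::complex)) \<and> (\<forall>\<^sub>F s in at 0. concise (S s) \<and> pt (S s) \<in> line_tangent_points X))"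
      if p: "p \<in> line_tangent_points X" for p
    proof -
      obtain T where T: "p = pt T" "pt T \<in> sigma3 segre" "is_any_line T"
        using line_tangent_pointsD p X by blast
      then show ?thesis
        using sigma3_nonzero line_approximation \<open>CARD('a) \<ge> 3 \<and> CARD('b) \<ge> 3 \<and> CARD('c) \<ge> 3\<close> X by blast
    qed
    ultimately show ?thesis unfolding U_def V_def by (intro conjI subset_closure_of_concise)
  qed
  have rankU: "tensor_rank T = 5" if T: "pt T \<in> U" for T
  proof -
    obtain S where S: "pt T = pt S" "is_osculating S" using T osculating_pointsD X unfolding U_def by blast
    \<comment> \<open>The given representative \<open>T\<close> need not be the normal form
      \<open>S\<close> itself; the form is transported by scaling.\<close>
    then obtain k where "T = k *s S" using pt_eqD by blast
    then show ?thesis using rank_concise_osculating concise_pointsD is_osculating_scale S(2) T unfolding U_def by blast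
  qed
  have rankV: "tensor_rank T = 5" if T: "pt T \<in> V" for T
  proof -
    obtain S where S: "pt T = pt S" "is_any_line S" using T line_tangent_pointsD X unfolding V_def by blast
    then obtain k where "T = k *s S" using pt_eqD by blast
    then show ?thesis using rank_concise_any_line concise_pointsD is_any_line_scale S(2) T unfolding V_def by blast
  qed
  have other: "tensor_rank T < 5" if T: "pt T \<in> sigma3 X" "pt T \<notin> U \<union> V" for T
  proof -
    have b: "border3 T" using T(1) sigma3_border3 X by blast
    have "rank_le 4 T"
    proof (cases "concise T")
      case False
      then show ?thesis using b rank_le_4_not_concise by blast
    next
      case True
      then have "pt T \<in> concise_points" unfolding concise_points_def using sigma3_nonzero T(1) by blast
      then have "\<not> is_osculating T" "\<not> is_any_line T"
        using osculating_form_in_osculating_points concise_line_in_line_tangent_points True T X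
        unfolding U_def V_def by blast+
      then show ?thesis using classified_concise_border3[OF b True] unfolding classified_def by blast
    qed
    then show ?thesis using tensor_rank_le_iff[of T 4] by simp
  qed
  have "tensor_rank T \<le> 5" if "pt T \<in> sigma3 X" for T
    using rankU[of T] rankV[of T] other[of T] that by fastforce
  moreover have "\<exists>T. pt T \<in> sigma3 X \<and> tensor_rank T = 5" if d: "CARD('a) \<ge> 3 \<and> CARD('b) \<ge> 3 \<and> CARD('c) \<ge> 3"
  proof -
    \<comment> \<open>The zero tensor is a degenerate osculating form; perturbing its frames
      produces a concise point of the family.\<close>
    have "is_osculating (0 :: complex^('a \<times> 'b \<times> 'c))" by (rule is_osculatingI[of _ 0 0 0 0 0 0 0 0 0]) simp
    then obtain S :: "complex \<Rightarrow> complex^('a \<times> 'b \<times> 'c)" where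
      "\<forall>\<^sub>F s in at 0. concise (S s) \<and> pt (S s) \<in> osculating_points segre"
      using osculating_approximation d by blast
    then obtain s where s: "concise (S s)" "pt (S s) \<in> osculating_points segre"
      using eventually_happens[of _ "at (0::complex)"] by (metis (no_types, lifting) at_neq_bot)
    then have sig: "pt (S s) \<in> sigma3 X" unfolding osculating_points_def X by blast
    then have "pt (S s) \<in> U" unfolding U_def concise_points_def X using s sigma3_nonzero by blast
    with sig show ?thesis using rankU by blast
  qed
  ultimately show ?thesis using open' dense rankU rankV other by blast
qed

end
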